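(* Let $0\le p\le m-1$ and $q=m-p$. Let $\boldsymbol{X}\sim F$ be an absolutely continuous random vector in $\mathbb{R}^m$ that is elliptically symmetric with mean $\boldsymbol{\mu}$ and covariance matrix $\Sigma$. Let $d(\cdot,\cdot)$ be a statistical data depth with respect to at least elliptical symmetry, and let $\sigma(\cdot)$ be the corresponding dispersion measure. If $\sigma(F)<\infty$, then $$(\hat S_p,\hat S_q)=\arg\min_{(S_p,S_q)\in\mathcal{S}_{p,q}}\sigma(F_{B_q})$$ if and only if $\hat S_p$ and $\hat S_q$ are the orthogonal subspaces of $\mathbb{R}^m$ generated by the first $p$ and the last $q$ principal directions obtained from principal component analysis (PCA). In turn, this is equivalent to $$(\hat S_p,\hat S_q)=\arg\max_{(S_p,S_q)\in\mathcal{S}_{p,q}}\sigma(F_{B_p}).$$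
   Context: $\mathcal{S}_{p,q}$ is the set of all pairs $(S_p,S_q)$ of mutually orthogonal linear subspaces of $\mathbb{R}^m$ of dimensions $p$ and $q=m-p$. For a subspace $S_k$ of dimension $k$, $B_k$ denotes a $k\times m$ matrix whose rows form an orthonormal basis of $S_k$, and $F_{B_k}$ is the distribution of $B_k\boldsymbol{X}$ on $\mathbb{R}^k$; the value $\sigma(F_{B_k})$ does not depend on the chosen orthonormal basis of $S_k$. Minimizers and maximizers need not be unique; "$=\arg\min$" (resp. "$=\arg\max$") means that the pair attains the minimum (resp. maximum). Spherical symmetry: $\boldsymbol{Y}$ is spherically symmetric about $\boldsymbol\nu$ if $\boldsymbol Y-\boldsymbol\nu\stackrel{d}{=}U(\boldsymbol Y-\boldsymbol\nu)$ for all orthogonal matrices $U$. Elliptical symmetry: $\boldsymbol X$ is elliptically symmetric with parameters $\boldsymbol\mu$ and $\Sigma$ if $\boldsymbol X\stackrel{d}{=}A^\top\boldsymbol Y+\boldsymbol\mu$, where $\boldsymbol Y$ is a spherically symmetric random vector (about the origin) in $\mathbb{R}^k$ and the $k\times m$ matrix $A$ satisfies $A^\top A=\Sigma$ with $\operatorname{rank}(\Sigma)=k\le m$. Statistical data depth (in every dimension $k$): a bounded function $d(\boldsymbol x,F)\in[0,\infty)$ of $\boldsymbol x\in\mathbb{R}^k$ and of a distribution $F$ on $\mathbb{R}^k$ such that: (D1) affine invariance: $d(\boldsymbol x,F)=d(A\boldsymbol x+\boldsymbol b,F_{A,\boldsymbol b})$ for all nonsingular $A$ and all $\boldsymbol b$,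 where $F_{A,\boldsymbol b}$ is the distribution of $A\boldsymbol X+\boldsymbol b$, $\boldsymbol X\sim F$; (D2) maximality at center: if $F$ is symmetric about $\boldsymbol\mu$ (for a given notion of symmetry), then $d(\boldsymbol x,F)\le d(\boldsymbol\mu,F)$ for all $\boldsymbol x$; (D3) monotonicity: if $\boldsymbol\mu$ maximizes $d(\cdot,F)$, then $d(\boldsymbol x,F)\le d(\boldsymbol\mu+\alpha(\boldsymbol x-\boldsymbol\mu),F)$ for $\alpha\in[0,1]$ (in some cases this is only required when $F$ is symmetric as in (D2)); (D4) $d(\boldsymbol x,F)\to0$ as $\|\boldsymbol x\|\to\infty$. "With respect to at least elliptical symmetry" means that the notion of symmetry in (D2) includes elliptical symmetry. Dispersion measure: $\sigma(F)=\int_{\mathbb{R}^k}d(\boldsymbol x,F)\,d\boldsymbol x$ for $F$ a distribution on $\mathbb{R}^k$. Principal directions from PCA: orthonormal eigenvectors of $\Sigma$ ordered by decreasing eigenvalue, so the last $q$ are associated with the $q$ smallest eigenvalues; in case of ties among eigenvalues, any choice of orthonormal eigenvectors is allowed.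
   Formalization: For p > 0 it is additionally assumed that σ(F_{B_k}) is positive and finite for k = p, q and all B_k with orthonormal rows; without this the claim fails, e.g. for the depth d ≡ 0, where every pair attains both the minimum and the maximum. *)

theory Defs
  imports "HOL-Probability.Probability" "Jordan_Normal_Form.DL_Rank" "Jordan_Normal_Form.Char_Poly"
begin

unbundle no vec_syntax and no inner_syntax

text \<open>
  Every dimension \<open>k\<close> (including \<open>k = 0\<close>, where \<open>\<real>\<^sup>k\<close> is a single point of mass 1) has to be
  available at once, so \<open>\<real>\<^sup>k\<close> is \<open>carrier_vec k\<close>, with the Lebesgue measure transported from the
  product measure on \<open>{..<k} \<rightarrow> \<real>\<close>.
\<close>

definition lborel_vec :: "nat \<Rightarrow> real vec measure" where
  "lborel_vec k = embed_measure (\<Pi>\<^sub>M i\<in>{..<k}. lborel) (vec k)"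

lemma space_lborel_vec [simp]: "space (lborel_vec k) = carrier_vec k"
proof -
  have "x \<in> vec k ` (\<Pi>\<^sub>E i\<in>{..<k}. UNIV)" if "x \<in> carrier_vec k" for x :: "real vec"
    using that by (intro image_eqI[of _ _ "restrict (vec_index x) {..<k}"]) auto
  then show ?thesis
    by (auto simp: lborel_vec_def space_embed_measure space_PiM)
qed

lemma inj_on_vec: "inj_on (vec k) (space (\<Pi>\<^sub>M i\<in>{..<k}. (lborel :: real measure)))"
proof (rule inj_onI)
  fix f g :: "nat \<Rightarrow> real"
  assume f: "f \<in> space (\<Pi>\<^sub>M i\<in>{..<k}. lborel)" and g: "g \<in> space (\<Pi>\<^sub>M i\<in>{..<k}. lborel)"
    and eq: "vec k f = vec k g"
  have "f i = g i" if "i < k" for i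
    using arg_cong[OF eq, of "\<lambda>v. v $ i"] that by simp
  with f g show "f = g"
    by (intro PiE_ext[of f "{..<k}" "\<lambda>_. UNIV" g]) (auto simp: space_PiM)
qed

lemma measurable_vec_index [measurable (raw)]:
  assumes "i < k"
  shows "(\<lambda>x. x $ i) \<in> borel_measurable (lborel_vec k)"
proof -
  have eq: "(\<lambda>f. vec k f $ i) = (\<lambda>f. f i)"
    using assms by auto
  moreover have "(\<lambda>f. f i) \<in> borel_measurable (\<Pi>\<^sub>M i\<in>{..<k}. lborel)"
    using assms measurable_component_singleton[of i "{..<k}" "\<lambda>_. lborel"] by simp
  ultimately show ?thesis
    unfolding lborel_vec_def by (intro measurable_embed_measure1) (simp only: eq)
qed

lemma measurable_into_lborel_vec:
  assumes "\<And>x. x \<in> space M \<Longrightarrow> f x \<in> carrier_vec k"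
    and "\<And>i. i < k \<Longrightarrow> (\<lambda>x. f x $ i) \<in> borel_measurable M"
  shows "f \<in> M \<rightarrow>\<^sub>M lborel_vec k"
proof -
  have "(\<lambda>x. restrict (vec_index (f x)) {..<k}) \<in> M \<rightarrow>\<^sub>M (\<Pi>\<^sub>M i\<in>{..<k}. lborel)"
    using assms(2) by (intro measurable_restrict) auto
  from measurable_compose[OF this measurable_embed_measure2'[OF inj_on_vec]]
  have "(\<lambda>x. vec k (restrict (vec_index (f x)) {..<k})) \<in> M \<rightarrow>\<^sub>M lborel_vec k"
    by (simp add: lborel_vec_def)
  moreover have "vec k (restrict (vec_index (f x)) {..<k}) = f x" if "x \<in> space M" for x
    using assms(1)[OF that] by auto
  ultimately show ?thesis
    by (subst measurable_cong[of M f]) auto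
qed

lemma measurable_affine:
  assumes A: "A \<in> carrier_mat k m" and b: "b \<in> carrier_vec k"
  shows "(\<lambda>x. A *\<^sub>v x + b) \<in> lborel_vec m \<rightarrow>\<^sub>M lborel_vec k"
proof (rule measurable_into_lborel_vec)
  fix i assume i: "i < k"
  have "(\<lambda>x. (\<Sum>j<m. A $$ (i, j) * x $ j) + b $ i) \<in> borel_measurable (lborel_vec m)"
    by (intro borel_measurable_add borel_measurable_sum borel_measurable_times
        borel_measurable_const measurable_vec_index) auto
  moreover have "(A *\<^sub>v x + b) $ i = (\<Sum>j<m. A $$ (i, j) * x $ j) + b $ i"
    if "x \<in> space (lborel_vec m)" for x
    using that i A b by (auto simp: scalar_prod_def lessThan_atLeast0)
  ultimately show "(\<lambda>x. (A *\<^sub>v x + b) $ i) \<in> borel_measurable (lborel_vec m)"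
    by (subst measurable_cong) auto
qed (use A b in auto)

definition distribution :: "nat \<Rightarrow> real vec measure \<Rightarrow> bool" where
  "distribution k F \<longleftrightarrow> prob_space F \<and> sets F = sets (lborel_vec k)"

definition affine_image :: "nat \<Rightarrow> real mat \<Rightarrow> real vec \<Rightarrow> real vec measure \<Rightarrow> real vec measure" where
  "affine_image k A b F = distr F (lborel_vec k) (\<lambda>x. A *\<^sub>v x + b)"

definition linear_image :: "nat \<Rightarrow> real mat \<Rightarrow> real vec measure \<Rightarrow> real vec measure" where
  "linear_image k A F = distr F (lborel_vec k) (\<lambda>x. A *\<^sub>v x)"

definition has_mean :: "nat \<Rightarrow> real vec measure \<Rightarrow> real vec \<Rightarrow> bool" where
  "has_mean k F \<mu> \<longleftrightarrow> \<mu> \<in> carrier_vec k \<and>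
     (\<forall>i<k. integrable F (\<lambda>x. x $ i) \<and> \<mu> $ i = (\<integral>x. x $ i \<partial>F))"

definition has_covariance :: "nat \<Rightarrow> real vec measure \<Rightarrow> real vec \<Rightarrow> real mat \<Rightarrow> bool" where
  "has_covariance k F \<mu> \<Sigma> \<longleftrightarrow> \<Sigma> \<in> carrier_mat k k \<and>
     (\<forall>i<k. \<forall>j<k. integrable F (\<lambda>x. (x $ i - \<mu> $ i) * (x $ j - \<mu> $ j)) \<and>
        \<Sigma> $$ (i, j) = (\<integral>x. (x $ i - \<mu> $ i) * (x $ j - \<mu> $ j) \<partial>F))"

definition spherically_symmetric :: "nat \<Rightarrow> real vec measure \<Rightarrow> real vec \<Rightarrow> bool" where
  "spherically_symmetric k G \<nu> \<longleftrightarrow> distribution k G \<and> \<nu> \<in> carrier_vec k \<and>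
     (\<forall>U \<in> carrier_mat k k. U * U\<^sup>T = 1\<^sub>m k \<longrightarrow>
        distr G (lborel_vec k) (\<lambda>y. y - \<nu>) = distr G (lborel_vec k) (\<lambda>y. U *\<^sub>v (y - \<nu>)))"

definition elliptically_symmetric ::
    "nat \<Rightarrow> real vec measure \<Rightarrow> real vec \<Rightarrow> real mat \<Rightarrow> bool" where
  "elliptically_symmetric m F \<mu> \<Sigma> \<longleftrightarrow> \<mu> \<in> carrier_vec m \<and> \<Sigma> \<in> carrier_mat m m \<and>
     (\<exists>k\<le>m. \<exists>A \<in> carrier_mat k m. \<exists>G.
        vec_space.rank m \<Sigma> = k \<and> A\<^sup>T * A = \<Sigma> \<and>
        spherically_symmetric k G (0\<^sub>v k) \<and> F = affine_image m (A\<^sup>T) \<mu> G)"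

text \<open>
  \<open>symm F \<mu>\<close> is the underlying notion of symmetry of \<open>F\<close> about \<open>\<mu>\<close>.  Neither \<open>symm\<close> nor \<open>d\<close> takes
  the dimension as an argument, since it is determined by \<open>space F\<close>.  Monotonicity is demanded
  only for symmetric \<open>F\<close>, which is the weaker of its two customary variants.  In dimension 0 the
  vanishing condition is void, as there are no points of large norm.
\<close>

definition statistical_depth ::
    "(real vec measure \<Rightarrow> real vec \<Rightarrow> bool) \<Rightarrow> (real vec \<Rightarrow> real vec measure \<Rightarrow> real) \<Rightarrow> bool" where
  "statistical_depth symm d \<longleftrightarrow> (\<forall>k.
     (\<exists>C. \<forall>F x. distribution k F \<longrightarrow> x \<in> carrier_vec k \<longrightarrow> 0 \<le> d x F \<and> d x F \<le> C) \<and>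
     (\<forall>F. distribution k F \<longrightarrow>
       (\<forall>A \<in> carrier_mat k k. \<forall>b \<in> carrier_vec k. \<forall>x \<in> carrier_vec k. invertible_mat A \<longrightarrow>
          d x F = d (A *\<^sub>v x + b) (affine_image k A b F)) \<and>
       (\<forall>\<mu> \<in> carrier_vec k. symm F \<mu> \<longrightarrow> (\<forall>x \<in> carrier_vec k. d x F \<le> d \<mu> F)) \<and>
       ((\<exists>\<nu> \<in> carrier_vec k. symm F \<nu>) \<longrightarrow>
          (\<forall>\<mu> \<in> carrier_vec k. (\<forall>y \<in> carrier_vec k. d y F \<le> d \<mu> F) \<longrightarrow>
            (\<forall>x \<in> carrier_vec k. \<forall>\<alpha> \<in> {0..1}. d x F \<le> d (\<mu> + \<alpha> \<cdot>\<^sub>v (x - \<mu>)) F))) \<and>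
       (\<forall>\<epsilon>>0. \<exists>R. \<forall>x \<in> carrier_vec k. R < sqrt (x \<bullet> x) \<longrightarrow> d x F < \<epsilon>)))"

definition includes_elliptical_symmetry :: "(real vec measure \<Rightarrow> real vec \<Rightarrow> bool) \<Rightarrow> bool" where
  "includes_elliptical_symmetry symm \<longleftrightarrow>
     (\<forall>k F \<mu> \<Sigma>. elliptically_symmetric k F \<mu> \<Sigma> \<longrightarrow> symm F \<mu>)"

text \<open>
  The value is extended real, so that finiteness is a meaningful condition.  Measurability of
  \<open>\<lambda>x. d x F\<close> is not presupposed: the integral is the lower integral, which agrees with the Lebesgue
  integral whenever \<open>\<lambda>x. d x F\<close> is measurable.
\<close>

definition dispersion ::
    "(real vec \<Rightarrow> real vec measure \<Rightarrow> real) \<Rightarrow> nat \<Rightarrow> real vec measure \<Rightarrow> ennreal" where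
  "dispersion d k F = (\<integral>\<^sup>+ x. ennreal (d x F) \<partial>lborel_vec k)"

abbreviation vec_span :: "nat \<Rightarrow> real vec set \<Rightarrow> real vec set" where
  "vec_span m \<equiv> LinearCombinations.module.span class_ring (module_vec TYPE(real) m)"

abbreviation vec_subspace :: "nat \<Rightarrow> real vec set \<Rightarrow> bool" where
  "vec_subspace m S \<equiv> VectorSpace.subspace class_ring S (module_vec TYPE(real) m)"

abbreviation vec_dim :: "nat \<Rightarrow> real vec set \<Rightarrow> nat" where
  "vec_dim m S \<equiv> vectorspace.dim class_ring ((module_vec TYPE(real) m)\<lparr>carrier := S\<rparr>)"

definition orthogonal_pairs :: "nat \<Rightarrow> nat \<Rightarrow> nat \<Rightarrow> (real vec set \<times> real vec set) set" where
  "orthogonal_pairs m p q = {(S, T). vec_subspace m S \<and> vec_subspace m T \<and>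
     vec_dim m S = p \<and> vec_dim m T = q \<and> (\<forall>x\<in>S. \<forall>y\<in>T. x \<bullet> y = 0)}"

definition orthonormal_rows :: "nat \<Rightarrow> nat \<Rightarrow> real mat \<Rightarrow> bool" where
  "orthonormal_rows k m B \<longleftrightarrow> B \<in> carrier_mat k m \<and> B * B\<^sup>T = 1\<^sub>m k"

text \<open>
  \<open>basis_mat k m S\<close> is an arbitrary choice of \<open>B\<^sub>k\<close> for a \<open>k\<close>-dimensional subspace \<open>S\<close>; by affine
  invariance of the depth, the dispersion of the projection does not depend on it.
\<close>

definition basis_mat :: "nat \<Rightarrow> nat \<Rightarrow> real vec set \<Rightarrow> real mat" where
  "basis_mat k m S = (SOME B. orthonormal_rows k m B \<and> vec_span m (set (rows B)) = S)"

definition principal_directions :: "nat \<Rightarrow> real mat \<Rightarrow> real vec list \<Rightarrow> bool" where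
  "principal_directions m \<Sigma> vs \<longleftrightarrow> length vs = m \<and> set vs \<subseteq> carrier_vec m \<and>
     (\<forall>i<m. \<forall>j<m. vs ! i \<bullet> vs ! j = (if i = j then 1 else 0)) \<and>
     (\<exists>ev. (\<forall>i<m. eigenvector \<Sigma> (vs ! i) (ev i)) \<and> (\<forall>i j. i \<le> j \<longrightarrow> j < m \<longrightarrow> ev j \<le> ev i))"

definition pca_pair ::
    "nat \<Rightarrow> nat \<Rightarrow> real mat \<Rightarrow> real vec set \<times> real vec set \<Rightarrow> bool" where
  "pca_pair m p \<Sigma> = (\<lambda>(S, T). \<exists>vs. principal_directions m \<Sigma> vs \<and>
     S = vec_span m (set (take p vs)) \<and> T = vec_span m (set (drop p vs)))"

end

theory Submission
  imports Defs "HOL-Computational_Algebra.Fundamental_Theorem_Algebra"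
begin

text \<open>
  Write \<open>F\<close> as the law of \<open>A\<^sup>T Y + \<mu>\<close> with \<open>Y\<close> spherical.  For \<open>B\<close> with orthonormal rows, factor
  \<open>B A\<^sup>T = L V\<close> with \<open>L\<close> triangular and \<open>V\<close> with orthonormal rows.  By spherical symmetry the law of
  \<open>V Y\<close> depends only on the number \<open>n\<close> of rows, so affine invariance and the change of variables by \<open>L\<close>
  give \<open>\<sigma>(F\<^sub>B) = sqrt (det (B \<Sigma> B\<^sup>T)) \<cdot> \<kappa>\<^sub>n\<close>; no other property of the depth matters.

  It remains to optimise \<open>det (B \<Sigma> B\<^sup>T)\<close>.  Choose \<open>B\<close> with \<open>B \<Sigma> B\<^sup>T\<close> diagonal and let \<open>v\<^sub>j\<close>, \<open>l\<^sub>j\<close> be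
  the eigenvectors and the decreasing eigenvalues of \<open>\<Sigma>\<close>.  Jensen's inequality for the logarithm yields
  \<open>ln det (B \<Sigma> B\<^sup>T) \<ge> \<Sum>\<^sub>j w\<^sub>j ln l\<^sub>j\<close> with \<open>w\<^sub>j = |B v\<^sub>j|\<^sup>2 \<in> [0, 1]\<close> and \<open>\<Sum>\<^sub>j w\<^sub>j = n\<close>, which is at least
  the sum of the \<open>n\<close> smallest \<open>ln l\<^sub>j\<close>.  Equality forces the row space of \<open>B\<close> to contain every
  eigenspace strictly below the threshold eigenvalue and to be orthogonal to every one strictly above it.
  For the maximum the same argument is applied to \<open>\<Sigma>\<^sup>-\<^sup>1\<close> and the subspace \<open>\<Sigma>\<^sup>1\<^sup>/\<^sup>2 S\<close>.
\<close>

section \<open>Orthonormal systems and subspaces\<close>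

text \<open>The factor \<open>L\<close> is triangular because a triangular affine map can be
  integrated coordinate by coordinate, each step being an affine substitution on the line. The
  resulting rule for measurable integrands extends to an arbitrary depth since the map is a
  bimeasurable bijection. Absolute continuity acts through hyperplanes being null sets: it makes
  \<Sigma> positive definite, so the logarithms are defined and \<open>B A\<^sup>T\<close> has
  independent rows. The scatter \<open>A\<^sup>T A\<close> is only proportional to \<Sigma>; the
  ratio depends on \<open>F\<close> but not on the subspace and goes into the constant \<kappa>. The
  main obstacle is ties: at the threshold eigenvalue the optimal weights need not be 0 or 1, so
  optimality does not single out eigenvectors. PCA pairs are therefore recognised without
  eigenvectors: \<open>S\<close> and \<open>T\<close> are orthogonal for the form of \<Sigma>, and
  one number separates the values of the form on their unit vectors. The spectral theorem inside
  \<open>S\<close> and \<open>T\<close> then supplies principal directions. The inverse enters for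
  the maximum because Jensen bounds the logarithm of a quadratic form from below; an upper bound
  needs the reciprocal.\<close>

definition orthonormal_list :: "nat \<Rightarrow> real vec list \<Rightarrow> bool" where
  "orthonormal_list m vs \<longleftrightarrow> set vs \<subseteq> carrier_vec m \<and>
     (\<forall>i<length vs. \<forall>j<length vs. vs ! i \<bullet> vs ! j = (if i = j then 1 else 0))"

lemma scalar_prod_self_nonneg: "0 \<le> x \<bullet> (x :: real vec)"
  by (simp add: scalar_prod_def sum_nonneg)

lemma scalar_prod_self_eq_0:
  "x \<in> carrier_vec n \<Longrightarrow> x \<bullet> (x :: real vec) = 0 \<longleftrightarrow> x = 0\<^sub>v n"
  by (auto simp: scalar_prod_def sum_nonneg_eq_0_iff)

lemma scalar_prod_self_pos:
  "x \<in> carrier_vec n \<Longrightarrow> x \<noteq> 0\<^sub>v n \<Longrightarrow> 0 < x \<bullet> (x :: real vec)"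
  using scalar_prod_self_nonneg[of x] scalar_prod_self_eq_0[of x n] by linarith

lemma orthonormal_rows_iff_orthonormal_list:
  "orthonormal_rows k m B \<longleftrightarrow> B \<in> carrier_mat k m \<and> orthonormal_list m (rows B)"
proof (cases "B \<in> carrier_mat k m")
  case True
  have "B * B\<^sup>T = 1\<^sub>m k \<longleftrightarrow> (\<forall>i<k. \<forall>j<k. row B i \<bullet> row B j = (if i = j then 1 else 0))"
    using True by (auto simp: mat_eq_iff)
  with True show ?thesis
    by (auto simp: orthonormal_rows_def orthonormal_list_def rows_def)
qed (simp add: orthonormal_rows_def)

lemma orthonormal_rows_mat_of_rows:
  assumes "orthonormal_list m vs"
  shows "orthonormal_rows (length vs) m (mat_of_rows m vs)"
  using assms by (auto simp: orthonormal_rows_iff_orthonormal_list orthonormal_list_def)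

text \<open>Zero rows are appended to make the matrix square. The transpose of the padded matrix
  kills the unit vector of index \<open>r\<close>, so the determinant vanishes and a kernel vector
  exists.\<close>

lemma ex_kernel_vec:
  fixes A :: "real mat"
  assumes A: "A \<in> carrier_mat r c" and rc: "r < c"
  obtains v where "v \<in> carrier_vec c" "v \<noteq> 0\<^sub>v c" "A *\<^sub>v v = 0\<^sub>v r"
proof -
  define A' where "A' = mat c c (\<lambda>(i, j). if i < r then A $$ (i, j) else 0)"
  have A': "A' \<in> carrier_mat c c" by (simp add: A'_def)
  have "A'\<^sup>T *\<^sub>v unit_vec c r = 0\<^sub>v c"
    using rc by (auto simp: A'_def vec_eq_iff)
  then have "det A'\<^sup>T = 0"
    using A' rc by (subst det_0_iff_vec_prod_zero[of _ c])
      (auto intro!: exI[of _ "unit_vec c r"])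
  then have "det A' = 0"
    using A' by (simp add: det_transpose)
  then obtain v where v: "v \<in> carrier_vec c" "v \<noteq> 0\<^sub>v c" "A' *\<^sub>v v = 0\<^sub>v c"
    using det_0_iff_vec_prod_zero[OF A'] by blast
  have "A *\<^sub>v v = 0\<^sub>v r"
  proof (rule eq_vecI)
    fix i assume "i < dim_vec (0\<^sub>v r :: real vec)"
    then have i: "i < r" by simp
    have "row A i = row A' i"
      using A i rc by (auto simp: A'_def)
    then have "(A *\<^sub>v v) $ i = (A' *\<^sub>v v) $ i"
      using A A' i rc by auto
    with v(3) i rc show "(A *\<^sub>v v) $ i = 0\<^sub>v r $ i" by simp
  qed (use A in auto)
  with v that show ?thesis by blast
qed

lemma orthonormal_list_append1:
  assumes vs: "orthonormal_list m vs" and x: "x \<in> carrier_vec m" "x \<noteq> 0\<^sub>v m"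
    and orth: "\<And>v. v \<in> set vs \<Longrightarrow> v \<bullet> x = 0"
  shows "orthonormal_list m (vs @ [(1 / sqrt (x \<bullet> x)) \<cdot>\<^sub>v x])"
proof -
  have "0 < x \<bullet> x"
    using x by (rule scalar_prod_self_pos)
  then have "((1 / sqrt (x \<bullet> x)) \<cdot>\<^sub>v x) \<bullet> ((1 / sqrt (x \<bullet> x)) \<cdot>\<^sub>v x) = 1"
    using x by (simp add: scalar_prod_smult_distrib[of _ m] smult_scalar_prod_distrib[of _ m])
  moreover have "v \<bullet> ((1 / sqrt (x \<bullet> x)) \<cdot>\<^sub>v x) = 0" "((1 / sqrt (x \<bullet> x)) \<cdot>\<^sub>v x) \<bullet> v = 0" if "v \<in> set vs" for v
  proof -
    have v: "v \<in> carrier_vec m" using vs that by (auto simp: orthonormal_list_def)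
    show 1: "v \<bullet> ((1 / sqrt (x \<bullet> x)) \<cdot>\<^sub>v x) = 0"
      using v x orth[OF that] by (simp add: scalar_prod_smult_distrib[of _ m])
    show "((1 / sqrt (x \<bullet> x)) \<cdot>\<^sub>v x) \<bullet> v = 0"
      using 1 v x by (subst comm_scalar_prod[of _ m]) auto
  qed
  ultimately show ?thesis
    using vs x by (auto simp: orthonormal_list_def nth_append less_Suc_eq)
qed

lemma mat_of_rows_mult_vec_index:
  assumes "set vs \<subseteq> carrier_vec m" "i < length vs"
  shows "(mat_of_rows m vs *\<^sub>v x) $ i = vs ! i \<bullet> x"
proof -
  have "row (mat_of_rows m vs) i = vs ! i"
    using assms nth_mem[OF assms(2)] by (intro mat_of_rows_row) auto
  with assms show ?thesis by simp
qed

lemma mat_of_rows_mult_vec_eq_0_iff: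
  assumes "set vs \<subseteq> carrier_vec m"
  shows "mat_of_rows m vs *\<^sub>v x = 0\<^sub>v (length vs) \<longleftrightarrow> (\<forall>v\<in>set vs. v \<bullet> x = (0::real))"
  using assms
  by (auto simp: vec_eq_iff all_set_conv_all_nth mat_of_rows_mult_vec_index simp del: index_mult_mat_vec)

text \<open>A longer list would give the wide matrix \<open>?V\<^sup>T\<close> a nonzero kernel
  vector, although \<open>?V\<close> inverts it from the left.\<close>

lemma orthonormal_list_length_le:
  assumes vs: "orthonormal_list m vs"
  shows "length vs \<le> m"
proof (rule ccontr)
  let ?V = "mat_of_rows m vs"
  assume "\<not> length vs \<le> m"
  then obtain x where x: "x \<in> carrier_vec (length vs)" "x \<noteq> 0\<^sub>v (length vs)" "?V\<^sup>T *\<^sub>v x = 0\<^sub>v m"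
    using ex_kernel_vec[of "?V\<^sup>T" m "length vs"] by auto
  have "x = (?V * ?V\<^sup>T) *\<^sub>v x"
    using orthonormal_rows_mat_of_rows[OF vs] x by (simp add: orthonormal_rows_def)
  also have "\<dots> = ?V *\<^sub>v (?V\<^sup>T *\<^sub>v x)"
    using x by (intro assoc_mult_mat_vec) auto
  also have "\<dots> = 0\<^sub>v (length vs)"
    by (auto simp: x(3) vec_eq_iff)
  finally show False using x by simp
qed

lemma orthonormal_list_extend:
  assumes "orthonormal_list m vs"
  obtains ws where "orthonormal_list m (vs @ ws)" "length (vs @ ws) = m"
proof -
  have "\<exists>ws. orthonormal_list m (vs @ ws) \<and> length (vs @ ws) = m"
    using assms
  proof (induction "m - length vs" arbitrary: vs)
    case 0
    then show ?case
      using orthonormal_list_length_le[OF 0(2)] by (intro exI[of _ "[]"]) auto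
  next
    case (Suc d)
    then have vs: "set vs \<subseteq> carrier_vec m" by (simp add: orthonormal_list_def)
    obtain x where x: "x \<in> carrier_vec m" "x \<noteq> 0\<^sub>v m" "mat_of_rows m vs *\<^sub>v x = 0\<^sub>v (length vs)"
      using Suc(2) by (elim ex_kernel_vec[of "mat_of_rows m vs" "length vs" m, rotated -1]) auto
    let ?y = "(1 / sqrt (x \<bullet> x)) \<cdot>\<^sub>v x"
    have "orthonormal_list m (vs @ [?y])"
      using x Suc(3) mat_of_rows_mult_vec_eq_0_iff[OF vs] by (intro orthonormal_list_append1) auto
    moreover have "d = m - length (vs @ [?y])"
      using Suc(2) by simp
    ultimately obtain ws where "orthonormal_list m ((vs @ [?y]) @ ws)" "length ((vs @ [?y]) @ ws) = m"
      using Suc(1) by blast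
    then show ?case
      by (intro exI[of _ "?y # ws"]) simp
  qed
  with that show ?thesis by blast
qed

lemma orthonormal_rows_square:
  assumes "orthonormal_rows m m V"
  shows "V\<^sup>T * V = 1\<^sub>m m"
  using assms mat_mult_left_right_inverse[of V m "V\<^sup>T"] by (auto simp: orthonormal_rows_def)

section \<open>Spans in coordinates, projections and Gram-Schmidt\<close>

text \<open>Bridge from the abstract span to matrices; membership in a span is tested through
  coordinates from here on.\<close>

lemma vec_span_set:
  assumes "set vs \<subseteq> carrier_vec m"
  shows "vec_span m (set vs) = (\<lambda>c. (mat_of_rows m vs)\<^sup>T *\<^sub>v c) ` carrier_vec (length vs)"
proof -
  interpret V: vec_space "TYPE(real)" m .
  have "vec_span m (set vs) = {V.lincomb_list c vs |c. True}"
    using V.span_list_as_span[OF assms] by (auto simp: V.span_list_def)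
  also have "\<dots> = {mat_of_cols m vs *\<^sub>v vec (length vs) c |c. True}"
    using assms by (subst V.lincomb_list_as_mat_mult) auto
  also have "\<dots> = (\<lambda>c. (mat_of_rows m vs)\<^sup>T *\<^sub>v c) ` carrier_vec (length vs)"
  proof -
    have "\<exists>f. c = vec (length vs) f" if "c \<in> carrier_vec (length vs)" for c :: "real vec"
      using that by (intro exI[of _ "($) c"]) auto
    then show ?thesis
      by (fastforce simp: transpose_mat_of_rows image_iff)
  qed
  finally show ?thesis .
qed

lemma mult_mat_vec_transpose_cancel:
  assumes "orthonormal_rows k m B" "c \<in> carrier_vec k"
  shows "B *\<^sub>v (B\<^sup>T *\<^sub>v c) = c"
proof -
  have "B *\<^sub>v (B\<^sup>T *\<^sub>v c) = (B * B\<^sup>T) *\<^sub>v c"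
    using assms by (intro assoc_mult_mat_vec[symmetric]) (auto simp: orthonormal_rows_def)
  with assms show ?thesis by (simp add: orthonormal_rows_def)
qed

text \<open>\<open>V\<^sup>T V\<close> is the orthogonal projection onto the span, and the span
  consists of its fixed points.\<close>

lemma in_vec_span_orthonormal_iff:
  assumes "orthonormal_list m vs"
  defines "V \<equiv> mat_of_rows m vs"
  shows "x \<in> vec_span m (set vs) \<longleftrightarrow> x \<in> carrier_vec m \<and> V\<^sup>T *\<^sub>v (V *\<^sub>v x) = x"
proof -
  have V: "orthonormal_rows (length vs) m V"
    unfolding V_def using assms(1) by (rule orthonormal_rows_mat_of_rows)
  have Vc: "V \<in> carrier_mat (length vs) m" by (simp add: V_def)
  have "x \<in> vec_span m (set vs) \<longleftrightarrow> x \<in> (\<lambda>c. V\<^sup>T *\<^sub>v c) ` carrier_vec (length vs)"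
    using assms by (subst vec_span_set) (auto simp: orthonormal_list_def)
  also have "\<dots> \<longleftrightarrow> x \<in> carrier_vec m \<and> V\<^sup>T *\<^sub>v (V *\<^sub>v x) = x"
  proof
    assume "x \<in> (\<lambda>c. V\<^sup>T *\<^sub>v c) ` carrier_vec (length vs)"
    then obtain c where c: "c \<in> carrier_vec (length vs)" "x = V\<^sup>T *\<^sub>v c" by auto
    with mult_mat_vec_transpose_cancel[OF V] Vc
    show "x \<in> carrier_vec m \<and> V\<^sup>T *\<^sub>v (V *\<^sub>v x) = x" by auto
  next
    assume "x \<in> carrier_vec m \<and> V\<^sup>T *\<^sub>v (V *\<^sub>v x) = x"
    then show "x \<in> (\<lambda>c. V\<^sup>T *\<^sub>v c) ` carrier_vec (length vs)"
      using Vc by (intro image_eqI[of _ _ "V *\<^sub>v x"]) auto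
  qed
  finally show ?thesis .
qed

lemma vec_subspace_span:
  assumes "A \<subseteq> carrier_vec m"
  shows "vec_subspace m (vec_span m A)"
proof -
  interpret V: vec_space "TYPE(real)" m .
  show ?thesis
    using assms by (auto simp: subspace_def V.span_is_submodule vec_vs)
qed

lemma orthonormal_list_distinct:
  assumes "orthonormal_list m vs"
  shows "distinct vs"
  unfolding distinct_conv_nth
proof (intro allI impI notI)
  fix i j assume ij: "i < length vs" "j < length vs" "i \<noteq> j" "vs ! i = vs ! j"
  have "vs ! i \<bullet> vs ! i = 1" "vs ! i \<bullet> vs ! j = 0"
    using assms ij(1-3) by (auto simp: orthonormal_list_def)
  with ij(4) show False by simp
qed

lemma vec_dim_span_orthonormal:
  assumes vs: "orthonormal_list m vs"
  shows "vec_dim m (vec_span m (set vs)) = length vs"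
proof -
  interpret V: vec_space "TYPE(real)" m .
  let ?V = "mat_of_rows m vs"
  have c: "set vs \<subseteq> carrier_vec m" using vs by (simp add: orthonormal_list_def)
  have cols: "cols ?V\<^sup>T = vs"
    using c by (simp add: transpose_mat_of_rows)
  have "V.lin_indpt (set vs)"
  proof
    assume "V.lin_dep (set vs)"
    then obtain v where v: "v \<in> carrier_vec (length vs)" "v \<noteq> 0\<^sub>v (length vs)" "?V\<^sup>T *\<^sub>v v = 0\<^sub>v m"
      using V.lin_depE[of "?V\<^sup>T" "length vs"] orthonormal_list_distinct[OF vs] cols
      by (metis mat_of_rows_carrier(1) transpose_carrier_mat)
    have "v = ?V *\<^sub>v 0\<^sub>v m"
      using mult_mat_vec_transpose_cancel[OF orthonormal_rows_mat_of_rows[OF vs] v(1)] v(3) by simp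
    also have "\<dots> = 0\<^sub>v (length vs)"
      by (auto simp: vec_eq_iff)
    finally show False using v(2) by simp
  qed
  then have "maximal (set vs) (\<lambda>T. T \<subseteq> set vs \<and> V.lin_indpt T)"
    by (auto simp: maximal_def)
  then have "vec_dim m (vec_span m (set vs)) = card (set vs)"
    using c by (intro V.dim_span) auto
  with orthonormal_list_distinct[OF vs] show ?thesis
    by (simp add: distinct_card)
qed

lemma vec_subspace_closed:
  assumes "vec_subspace m T"
  shows "T \<subseteq> carrier_vec m" "x \<in> T \<Longrightarrow> y \<in> T \<Longrightarrow> x + y \<in> T" "x \<in> T \<Longrightarrow> c \<cdot>\<^sub>v x \<in> T"
  using assms submodule.subset[of _ T] submodule.m_closed[of _ T] submodule.smult_closed[of _ T]
  by (fastforce simp: subspace_def class_ring_simps module_vec_simps)+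

lemma vec_span_subset_subspace:
  assumes "vec_subspace m T" "A \<subseteq> T"
  shows "vec_span m A \<subseteq> T"
proof -
  interpret V: vec_space "TYPE(real)" m .
  show ?thesis
    using assms by (intro V.span_is_subset) (auto simp: subspace_def)
qed

text \<open>One Gram-Schmidt step: \<open>w\<close> is the projection of \<open>t\<close>, and
  \<open>x\<close> is what remains. It drives both the construction of bases and that of
  flags.\<close>

lemma ex_orthogonal_residual:
  assumes T: "vec_subspace m T" and vs: "orthonormal_list m vs" "set vs \<subseteq> T"
    and t: "t \<in> T" "t \<notin> vec_span m (set vs)"
  shows "\<exists>x\<in>T. \<exists>w\<in>vec_span m (set vs). x \<noteq> 0\<^sub>v m \<and> (\<forall>v\<in>set vs. v \<bullet> x = 0) \<and> t = w + x"
proof -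
  let ?n = "length vs"
  have Tc: "T \<subseteq> carrier_vec m" using T by (rule vec_subspace_closed)
  define V where "V = mat_of_rows m vs"
  have V: "orthonormal_rows ?n m V"
    using orthonormal_rows_mat_of_rows[OF vs(1)] by (simp add: V_def)
  have Vc: "V \<in> carrier_mat ?n m" using V by (simp add: orthonormal_rows_def)
  have sub: "vec_span m (set vs) \<subseteq> T"
    using T vs(2) by (rule vec_span_subset_subspace)
  have tc: "t \<in> carrier_vec m" using t Tc by auto
  define w where "w = V\<^sup>T *\<^sub>v (V *\<^sub>v t)"
  have "V *\<^sub>v t \<in> carrier_vec ?n" using Vc tc by simp
  then have w: "w \<in> vec_span m (set vs)"
    unfolding w_def V_def using vs Tc by (subst vec_span_set) auto
  then have wT: "w \<in> T" using sub by auto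
  have wc: "w \<in> carrier_vec m" using wT Tc by auto
  define x where "x = t + (-1) \<cdot>\<^sub>v w"
  have x: "x \<in> T" unfolding x_def using T t wT by (intro vec_subspace_closed)
  have x0: "x \<noteq> 0\<^sub>v m"
  proof
    assume "x = 0\<^sub>v m"
    have "t = w"
    proof (rule eq_vecI)
      fix i assume i: "i < dim_vec w"
      have "x $ i = 0" using i wc \<open>x = 0\<^sub>v m\<close> by simp
      then show "t $ i = w $ i" using i tc wc by (simp add: x_def)
    qed (use tc wc in auto)
    with w t show False by simp
  qed
  have "V *\<^sub>v x = V *\<^sub>v t + (-1) \<cdot>\<^sub>v (V *\<^sub>v w)"
    unfolding x_def using Vc tc wc
    by (simp add: mult_add_distrib_mat_vec[of _ ?n m] mult_mat_vec[of _ ?n m])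
  also have "V *\<^sub>v w = V *\<^sub>v t"
    unfolding w_def using V Vc tc by (intro mult_mat_vec_transpose_cancel) auto
  finally have "V *\<^sub>v x = 0\<^sub>v ?n"
    using Vc tc by (auto simp: vec_eq_iff)
  then have "\<forall>v\<in>set vs. v \<bullet> x = 0"
    using mat_of_rows_mult_vec_eq_0_iff[of vs m x] vs Tc by (auto simp: V_def)
  moreover have "t = w + x" using tc wc by (auto simp: x_def vec_eq_iff)
  ultimately show ?thesis using x x0 w by blast
qed

text \<open>An orthonormal list in \<open>T\<close> of maximal length among those with property
  \<open>P\<close> must span \<open>T\<close>: otherwise a Gram-Schmidt residual exists,
  \<open>ex\<close> replaces it by one with \<open>P\<close>, and \<open>scale\<close> keeps
  \<open>P\<close> under normalisation. The property will be that of being an eigenvector.\<close>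

lemma subspace_orthonormal_basis_such_that:
  assumes T: "vec_subspace m T"
    and scale: "\<And>x c. P x \<Longrightarrow> c \<noteq> 0 \<Longrightarrow> P (c \<cdot>\<^sub>v x)"
    and ex: "\<And>vs. orthonormal_list m vs \<Longrightarrow> set vs \<subseteq> T \<Longrightarrow> \<forall>v\<in>set vs. P v \<Longrightarrow>
      \<exists>x\<in>T. x \<noteq> 0\<^sub>v m \<and> (\<forall>v\<in>set vs. v \<bullet> x = 0) \<Longrightarrow>
      \<exists>x\<in>T. x \<noteq> 0\<^sub>v m \<and> (\<forall>v\<in>set vs. v \<bullet> x = 0) \<and> P x"
  obtains vs where "orthonormal_list m vs" "vec_span m (set vs) = T" "length vs = vec_dim m T"
    "\<forall>v\<in>set vs. P v"
proof -
  \<comment> \<open>A greatest length exists because orthonormal lists have at most \<open>m\<close>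
    members.\<close>
  define Q where "Q n \<longleftrightarrow> (\<exists>vs. orthonormal_list m vs \<and> set vs \<subseteq> T \<and> (\<forall>v\<in>set vs. P v) \<and> length vs = n)" for n
  have Q0: "Q 0" unfolding Q_def
    by (intro exI[of _ "[]"]) (auto simp: orthonormal_list_def)
  have Qm: "n \<le> m" if "Q n" for n
    using that orthonormal_list_length_le by (auto simp: Q_def)
  define n where "n = (GREATEST n. Q n)"
  have "Q n" unfolding n_def using Q0 Qm by (rule GreatestI_nat)
  then obtain vs where vs: "orthonormal_list m vs" "set vs \<subseteq> T" "\<forall>v\<in>set vs. P v" "length vs = n"
    by (auto simp: Q_def)
  have Tc: "T \<subseteq> carrier_vec m" using T by (rule vec_subspace_closed)
  have "T \<subseteq> vec_span m (set vs)"
  proof (rule subsetI, rule ccontr)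
    fix t assume "t \<in> T" and "t \<notin> vec_span m (set vs)"
    then obtain x where x: "x \<in> T" "x \<noteq> 0\<^sub>v m" "\<forall>v\<in>set vs. v \<bullet> x = 0" "P x"
      using ex_orthogonal_residual[OF T vs(1,2)] ex[OF vs(1-3)] by blast
    let ?y = "(1 / sqrt (x \<bullet> x)) \<cdot>\<^sub>v x"
    have xc: "x \<in> carrier_vec m" using x Tc by auto
    have "orthonormal_list m (vs @ [?y])"
      using vs x xc by (intro orthonormal_list_append1) auto
    moreover have "?y \<in> T" using x T by (intro vec_subspace_closed)
    moreover have "P ?y" using x xc scalar_prod_self_pos[of x m] by (intro scale) auto
    ultimately have "Q (Suc n)"
      unfolding Q_def using vs by (intro exI[of _ "vs @ [?y]"]) auto
    then have "Suc n \<le> n"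
      unfolding n_def using Qm by (rule Greatest_le_nat)
    then show False by simp
  qed
  moreover have "vec_span m (set vs) \<subseteq> T"
    using T vs(2) by (rule vec_span_subset_subspace)
  ultimately have "vec_span m (set vs) = T" by auto
  then show ?thesis
    using vs vec_dim_span_orthonormal[OF vs(1)] by (intro that[of vs]) auto
qed

lemma subspace_orthonormal_basis:
  assumes "vec_subspace m T"
  obtains vs where "orthonormal_list m vs" "vec_span m (set vs) = T" "length vs = vec_dim m T"
  using assms by (rule subspace_orthonormal_basis_such_that[where P = "\<lambda>_. True"]) auto

section \<open>The spectral theorem\<close>

lemma symmetric_mat_scalar_prod:
  assumes "M \<in> carrier_mat n n" "M\<^sup>T = M" "x \<in> carrier_vec n" "y \<in> carrier_vec n"
  shows "(M *\<^sub>v x) \<bullet> y = x \<bullet> (M *\<^sub>v (y :: real vec))"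
  using assms transpose_vec_mult_scalar[of M n n y x] by (simp add: comm_scalar_prod[of _ n])

lemma symmetric_mat_ex_eigenvector:
  fixes M :: "real mat"
  assumes M: "M \<in> carrier_mat n n" "M\<^sup>T = M" and n: "0 < n"
  obtains v e where "eigenvector M v e"
proof -
  interpret c: comm_ring_hom complex_of_real by unfold_locales auto
  let ?M = "map_mat complex_of_real M"
  have cM: "?M \<in> carrier_mat n n" using M by simp
  have "degree (char_poly ?M) = n"
    using degree_monic_char_poly[OF cM] by simp
  with n have "\<not> constant (poly (char_poly ?M))"
    by (simp add: constant_degree)
  then obtain z where "poly (char_poly ?M) z = 0"
    using fundamental_theorem_of_algebra by blast
  then obtain v where v: "v \<in> carrier_vec n" "v \<noteq> 0\<^sub>v n" "?M *\<^sub>v v = z \<cdot>\<^sub>v v"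
    using eigenvalue_root_char_poly[OF cM] M by (auto simp: eigenvalue_def eigenvector_def)
  \<comment> \<open>Symmetry of \<open>M\<close> forces \<open>Im z = 0\<close>, so the real and imaginary parts of \<open>v\<close> are real eigenvectors.\<close>
  define x y where "x = map_vec Re v" and "y = map_vec Im v"
  have x: "x \<in> carrier_vec n" and y: "y \<in> carrier_vec n"
    using v by (auto simp: x_def y_def)
  have Mx: "(M *\<^sub>v x) $ i = Re z * x $ i - Im z * y $ i"
    and My: "(M *\<^sub>v y) $ i = Re z * y $ i + Im z * x $ i" if i: "i < n" for i
  proof -
    have "(\<Sum>j<n. complex_of_real (M $$ (i, j)) * v $ j) = z * v $ i"
      using arg_cong[OF v(3), of "\<lambda>v. v $ i"] i v(1) M by (simp add: scalar_prod_def lessThan_atLeast0)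
    from arg_cong[OF this, of Re] arg_cong[OF this, of Im]
    show "(M *\<^sub>v x) $ i = Re z * x $ i - Im z * y $ i" "(M *\<^sub>v y) $ i = Re z * y $ i + Im z * x $ i"
      using i v(1) M by (simp_all add: scalar_prod_def lessThan_atLeast0 x_def y_def)
  qed
  have "(M *\<^sub>v x) \<bullet> y = x \<bullet> (M *\<^sub>v y)"
    using M x y by (rule symmetric_mat_scalar_prod)
  then have "(\<Sum>i<n. (Re z * x $ i - Im z * y $ i) * y $ i) = (\<Sum>i<n. x $ i * (Re z * y $ i + Im z * x $ i))"
    using M x y Mx My by (simp add: scalar_prod_def lessThan_atLeast0)
  \<comment> \<open>The \<open>Re z\<close> terms agree on both sides. What is left is
    \<open>Im z\<close> times the squared norm of the complex vector \<open>v\<close>.\<close>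
  then have "Im z * ((\<Sum>i<n. x $ i * x $ i) + (\<Sum>i<n. y $ i * y $ i)) = 0"
    by (simp add: algebra_simps sum.distrib sum_subtractf sum_distrib_left)
  then have "Im z * (x \<bullet> x + y \<bullet> y) = 0"
    using x y by (simp add: scalar_prod_def lessThan_atLeast0)
  moreover have nz: "x \<noteq> 0\<^sub>v n \<or> y \<noteq> 0\<^sub>v n"
    using v(1,2) by (auto simp: x_def y_def vec_eq_iff complex_eq_iff)
  then have "x \<bullet> x + y \<bullet> y > 0"
    using scalar_prod_self_pos[OF x] scalar_prod_self_pos[OF y]
      scalar_prod_self_nonneg[of x] scalar_prod_self_nonneg[of y] by fastforce
  ultimately have "Im z = 0" by auto
  then have "M *\<^sub>v x = Re z \<cdot>\<^sub>v x" "M *\<^sub>v y = Re z \<cdot>\<^sub>v y"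
    using M x y Mx My by (auto simp: vec_eq_iff simp del: index_mult_mat_vec)
  then have "eigenvector M x (Re z) \<or> eigenvector M y (Re z)"
    using M x y nz by (auto simp: eigenvector_def)
  with that show ?thesis by blast
qed

lemma vec_subspaceI:
  assumes "T \<subseteq> carrier_vec m" "0\<^sub>v m \<in> T" "\<And>x y. x \<in> T \<Longrightarrow> y \<in> T \<Longrightarrow> x + y \<in> T"
    "\<And>x c. x \<in> T \<Longrightarrow> c \<cdot>\<^sub>v x \<in> T"
  shows "vec_subspace m T"
  using assms vec_vs[of m] vec_module[of m]
  by (auto simp: subspace_def submodule_def class_ring_simps module_vec_simps)

lemma vec_subspace_zero:
  assumes "vec_subspace m T"
  shows "0\<^sub>v m \<in> T"
  using assms submodule.zero_closed[of _ T] by (fastforce simp: subspace_def module_vec_simps)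

text \<open>In an orthonormal basis of \<open>T\<close> the restriction of \<open>M\<close> becomes
  the symmetric matrix \<open>B M B\<^sup>T\<close>. An eigenvector \<open>x\<close> of it lifts to
  \<open>B\<^sup>T x\<close>; invariance ensures that projecting \<open>M (B\<^sup>T x)\<close> back
  onto \<open>T\<close> changes nothing.\<close>

lemma invariant_subspace_ex_eigenvector:
  assumes M: "M \<in> carrier_mat m m" "M\<^sup>T = M" and T: "vec_subspace m T"
    and inv: "\<And>x. x \<in> T \<Longrightarrow> M *\<^sub>v x \<in> T" and t: "t \<in> T" "t \<noteq> 0\<^sub>v m"
  shows "\<exists>w\<in>T. \<exists>e. eigenvector M w e"
proof -
  obtain vs where vs: "orthonormal_list m vs" "vec_span m (set vs) = T"
    using T by (rule subspace_orthonormal_basis)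
  define n where "n = length vs"
  define B where "B = mat_of_rows m vs"
  have B: "orthonormal_rows n m B"
    using orthonormal_rows_mat_of_rows[OF vs(1)] by (simp add: B_def n_def)
  have Bc: "B \<in> carrier_mat n m" using B by (simp add: orthonormal_rows_def)
  have inT: "x \<in> T \<longleftrightarrow> x \<in> carrier_vec m \<and> B\<^sup>T *\<^sub>v (B *\<^sub>v x) = x" for x
    using in_vec_span_orthonormal_iff[OF vs(1)] by (simp add: B_def vs(2))
  have "n \<noteq> 0"
  proof
    assume "n = 0"
    then have "dim_row B = 0" "dim_col B = m" using Bc by auto
    then have "B\<^sup>T *\<^sub>v (B *\<^sub>v t) = 0\<^sub>v m"
      by (intro eq_vecI) (simp_all add: scalar_prod_def)
    moreover have "B\<^sup>T *\<^sub>v (B *\<^sub>v t) = t" using inT[of t] t(1) by blast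
    ultimately show False using t(2) by simp
  qed
  let ?M = "B * (M * B\<^sup>T)"
  have "?M\<^sup>T = (M * B\<^sup>T)\<^sup>T * B\<^sup>T"
    using Bc M by (intro transpose_mult) auto
  also have "(M * B\<^sup>T)\<^sup>T = B * M"
    using Bc M by (subst transpose_mult[of _ m m _ n]) auto
  also have "B * M * B\<^sup>T = ?M"
    using Bc M by (intro assoc_mult_mat) auto
  finally have sym: "?M\<^sup>T = ?M" .
  obtain x e where x: "eigenvector ?M x e"
  proof (rule symmetric_mat_ex_eigenvector)
    show "?M \<in> carrier_mat n n" using Bc M by auto
    show "?M\<^sup>T = ?M" by (fact sym)
    show "0 < n" using \<open>n \<noteq> 0\<close> by simp
  qed
  then have xc: "x \<in> carrier_vec n" and x0: "x \<noteq> 0\<^sub>v n" and Mx: "?M *\<^sub>v x = e \<cdot>\<^sub>v x"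
    using Bc M by (auto simp: eigenvector_def)
  let ?w = "B\<^sup>T *\<^sub>v x"
  have wc: "?w \<in> carrier_vec m" using Bc xc by simp
  have Bw: "B *\<^sub>v ?w = x" using B xc by (rule mult_mat_vec_transpose_cancel)
  have "B *\<^sub>v (M *\<^sub>v ?w) = ?M *\<^sub>v x"
    using Bc M xc by (simp add: assoc_mult_mat_vec[of _ n m _ n] assoc_mult_mat_vec[of _ m m _ n])
  then have "B\<^sup>T *\<^sub>v (B *\<^sub>v (M *\<^sub>v ?w)) = B\<^sup>T *\<^sub>v (e \<cdot>\<^sub>v x)"
    using Mx by simp
  also have "\<dots> = e \<cdot>\<^sub>v ?w"
    using Bc xc by (intro mult_mat_vec[of _ m n]) auto
  also have "B\<^sup>T *\<^sub>v (B *\<^sub>v (M *\<^sub>v ?w)) = M *\<^sub>v ?w"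
    using inT[of "M *\<^sub>v ?w"] inv[of ?w] inT[of ?w] Bw wc by simp
  finally have "M *\<^sub>v ?w = e \<cdot>\<^sub>v ?w" .
  moreover have "?w \<noteq> 0\<^sub>v m"
  proof
    assume "?w = 0\<^sub>v m"
    then have "x = B *\<^sub>v 0\<^sub>v m" using Bw by simp
    also have "\<dots> = 0\<^sub>v n" using Bc by (auto simp: vec_eq_iff)
    finally show False using x0 by simp
  qed
  ultimately have "eigenvector M ?w e"
    using wc M by (auto simp: eigenvector_def)
  moreover have "?w \<in> T" using inT[of ?w] wc Bw by simp
  ultimately show ?thesis by blast
qed

text \<open>By symmetry of \<open>M\<close>, the vectors of \<open>T\<close> orthogonal to the
  eigenvectors found so far form an invariant subspace again, so a further orthogonal eigenvector
  exists as long as that subspace is nonzero.\<close>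

lemma invariant_subspace_eigenbasis:
  assumes M: "M \<in> carrier_mat m m" "M\<^sup>T = M" and T: "vec_subspace m T"
    and inv: "\<And>x. x \<in> T \<Longrightarrow> M *\<^sub>v x \<in> T"
  obtains vs where "orthonormal_list m vs" "vec_span m (set vs) = T" "length vs = vec_dim m T"
    "\<forall>v\<in>set vs. \<exists>e. eigenvector M v e"
proof -
  let ?P = "\<lambda>v. \<exists>e. eigenvector M v e"
  show ?thesis
  proof (rule subspace_orthonormal_basis_such_that[OF T, where P = ?P])
  fix x :: "real vec" and c :: real
  assume "\<exists>e. eigenvector M x e" "c \<noteq> 0"
  then obtain e where x: "x \<in> carrier_vec m" "x \<noteq> 0\<^sub>v m" "M *\<^sub>v x = e \<cdot>\<^sub>v x"
    using M by (auto simp: eigenvector_def)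
  have "M *\<^sub>v (c \<cdot>\<^sub>v x) = e \<cdot>\<^sub>v (c \<cdot>\<^sub>v x)"
    using mult_mat_vec[OF M(1) x(1), of c] x(3) by (simp add: smult_smult_assoc mult.commute)
  moreover have "c \<cdot>\<^sub>v x \<noteq> 0\<^sub>v m"
    using x(1,2) \<open>c \<noteq> 0\<close> by (auto simp: vec_eq_iff)
  ultimately show "\<exists>e. eigenvector M (c \<cdot>\<^sub>v x) e"
    using M x(1) by (auto simp: eigenvector_def)
next
  fix vs
  assume vs: "orthonormal_list m vs" "set vs \<subseteq> T" and ev: "\<forall>v\<in>set vs. \<exists>e. eigenvector M v e"
    and ex: "\<exists>x\<in>T. x \<noteq> 0\<^sub>v m \<and> (\<forall>v\<in>set vs. v \<bullet> x = 0)"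
  have Tc: "T \<subseteq> carrier_vec m" using T by (rule vec_subspace_closed)
  have vc: "v \<in> carrier_vec m" if "v \<in> set vs" for v using that vs by (auto simp: orthonormal_list_def)
  let ?T = "{x \<in> T. \<forall>v\<in>set vs. v \<bullet> x = 0}"
  have "vec_subspace m ?T"
    using Tc vec_subspace_closed[OF T] vec_subspace_zero[OF T] vc
    by (intro vec_subspaceI) (auto simp: scalar_prod_add_distrib[of _ m] subset_iff)
  moreover have "M *\<^sub>v x \<in> ?T" if x: "x \<in> ?T" for x
  proof -
    have "v \<bullet> (M *\<^sub>v x) = 0" if v: "v \<in> set vs" for v
    proof -
      obtain e where e: "M *\<^sub>v v = e \<cdot>\<^sub>v v" using ev v by (auto simp: eigenvector_def)
      have "v \<bullet> (M *\<^sub>v x) = (M *\<^sub>v v) \<bullet> x"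
        using x Tc vc[OF v] M by (intro symmetric_mat_scalar_prod[symmetric]) auto
      then show ?thesis using x v vc[OF v] Tc e by auto
    qed
    with inv x show ?thesis by auto
  qed
  moreover obtain x where "x \<in> ?T" "x \<noteq> 0\<^sub>v m" using ex by auto
  ultimately have "\<exists>w\<in>?T. \<exists>e. eigenvector M w e"
    by (rule invariant_subspace_ex_eigenvector[OF M])
  then show "\<exists>x\<in>T. x \<noteq> 0\<^sub>v m \<and> (\<forall>v\<in>set vs. v \<bullet> x = 0) \<and> (\<exists>e. eigenvector M x e)"
    using M by (auto simp: eigenvector_def)
  qed (rule that)
qed

section \<open>Orthogonal complements and recognition of PCA pairs\<close>

text \<open>This form is insensitive to the order of the list; sorting and concatenation are handled
  through it.\<close>

lemma orthonormal_list_iff: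
  "orthonormal_list m vs \<longleftrightarrow> distinct vs \<and> set vs \<subseteq> carrier_vec m \<and>
     (\<forall>x\<in>set vs. \<forall>y\<in>set vs. x \<bullet> y = (if x = y then 1 else 0))"
proof
  assume vs: "orthonormal_list m vs"
  note d = orthonormal_list_distinct[OF vs]
  with vs show "distinct vs \<and> set vs \<subseteq> carrier_vec m \<and>
     (\<forall>x\<in>set vs. \<forall>y\<in>set vs. x \<bullet> y = (if x = y then 1 else 0))"
    by (auto simp: orthonormal_list_def in_set_conv_nth nth_eq_iff_index_eq)
qed (auto simp: orthonormal_list_def nth_eq_iff_index_eq)

lemma orthonormal_list_append_iff:
  "orthonormal_list m (us @ ws) \<longleftrightarrow> orthonormal_list m us \<and> orthonormal_list m ws \<and>
     (\<forall>u\<in>set us. \<forall>w\<in>set ws. u \<bullet> w = 0)" (is "?L \<longleftrightarrow> ?R")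
proof
  assume ?L
  then show ?R unfolding orthonormal_list_iff by auto
next
  assume R: ?R
  have us: "distinct us" "\<And>u. u \<in> set us \<Longrightarrow> u \<in> carrier_vec m"
    "\<And>x y. x \<in> set us \<Longrightarrow> y \<in> set us \<Longrightarrow> x \<bullet> y = (if x = y then 1 else 0)"
    and ws: "distinct ws" "\<And>u. u \<in> set ws \<Longrightarrow> u \<in> carrier_vec m"
    "\<And>x y. x \<in> set ws \<Longrightarrow> y \<in> set ws \<Longrightarrow> x \<bullet> y = (if x = y then 1 else 0)"
    using R by (auto simp: orthonormal_list_iff)
  have uw: "u \<bullet> w = 0" "w \<bullet> u = 0" "u \<noteq> w" "w \<noteq> u" if "u \<in> set us" "w \<in> set ws" for u w
  proof -
    show 1: "u \<bullet> w = 0" using R that by blast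
    then show "w \<bullet> u = 0" using that us(2) ws(2) comm_scalar_prod[of w m u] by simp
    show "u \<noteq> w" "w \<noteq> u" using us(3)[OF that(1,1)] 1 by auto
  qed
  show ?L
    unfolding orthonormal_list_iff set_append
  proof (intro conjI ballI)
    fix x y assume "x \<in> set us \<union> set ws" "y \<in> set us \<union> set ws"
    then show "x \<bullet> y = (if x = y then 1 else 0)"
      using us(3) ws(3) uw by (elim UnE) simp_all
  qed (use us(1,2) ws(1,2) uw(3) in auto)
qed

text \<open>Parseval's identity: a square matrix with orthonormal rows also satisfies
  \<open>V\<^sup>T V = 1\<close>.\<close>

lemma orthonormal_basis_scalar_prod:
  assumes vs: "orthonormal_list m vs" "length vs = m" and x: "x \<in> carrier_vec m" and y: "y \<in> carrier_vec m"
  shows "x \<bullet> y = (\<Sum>j<m. (vs ! j \<bullet> x) * (vs ! j \<bullet> y))"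
proof -
  let ?V = "mat_of_rows m vs"
  have V: "orthonormal_rows m m ?V" using orthonormal_rows_mat_of_rows[OF vs(1)] vs(2) by simp
  then have Vc: "?V \<in> carrier_mat m m" by (simp add: orthonormal_rows_def)
  have ent: "(?V *\<^sub>v z) $ j = vs ! j \<bullet> z" if "j < m" for j z
    using that vs by (intro mat_of_rows_mult_vec_index) (auto simp: orthonormal_list_def)
  have "x \<bullet> y = ((?V\<^sup>T * ?V) *\<^sub>v x) \<bullet> y"
    using x orthonormal_rows_square[OF V] by simp
  also have "\<dots> = (?V\<^sup>T *\<^sub>v (?V *\<^sub>v x)) \<bullet> y"
    using Vc x by (subst assoc_mult_mat_vec[of _ m m _ m]) auto
  also have "\<dots> = (?V *\<^sub>v x) \<bullet> (?V *\<^sub>v y)"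
    using Vc x y by (intro transpose_vec_mult_scalar) auto
  also have "\<dots> = (\<Sum>j<m. (vs ! j \<bullet> x) * (vs ! j \<bullet> y))"
    using Vc vs(2) unfolding scalar_prod_def[of "?V *\<^sub>v x"]
    by (intro sum.cong) (auto simp: ent simp del: index_mult_mat_vec)
  finally show ?thesis .
qed

lemma principal_directionsD:
  assumes "principal_directions m M vs"
  shows "orthonormal_list m vs" "length vs = m"
  using assms by (auto simp: principal_directions_def orthonormal_list_def)

lemma principal_directionsE:
  assumes "principal_directions m M vs" "M \<in> carrier_mat m m"
  obtains ev where "\<And>j. j < m \<Longrightarrow> M *\<^sub>v vs ! j = ev j \<cdot>\<^sub>v vs ! j"
    "\<And>i j. i \<le> j \<Longrightarrow> j < m \<Longrightarrow> ev j \<le> ev i"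
  using assms by (auto simp: principal_directions_def eigenvector_def)

lemma eigenbasis_scalar_prod:
  fixes ev :: "nat \<Rightarrow> real"
  assumes M: "M \<in> carrier_mat m m" "M\<^sup>T = M" and vs: "orthonormal_list m vs" "length vs = m"
    and ev: "\<And>j. j < m \<Longrightarrow> M *\<^sub>v vs ! j = ev j \<cdot>\<^sub>v vs ! j"
    and x: "x \<in> carrier_vec m" and y: "y \<in> carrier_vec m"
  shows "x \<bullet> (M *\<^sub>v y) = (\<Sum>j<m. ev j * ((vs ! j \<bullet> x) * (vs ! j \<bullet> y)))"
proof -
  have "vs ! j \<bullet> (M *\<^sub>v y) = ev j * (vs ! j \<bullet> y)" if j: "j < m" for j
  proof -
    have vj: "vs ! j \<in> carrier_vec m" using vs j by (auto simp: orthonormal_list_def)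
    have "vs ! j \<bullet> (M *\<^sub>v y) = (M *\<^sub>v vs ! j) \<bullet> y"
      using M vj y by (rule symmetric_mat_scalar_prod[symmetric])
    then show ?thesis using vj y by (simp add: ev[OF j])
  qed
  then show ?thesis
    using M y by (subst orthonormal_basis_scalar_prod[OF vs x]) (auto intro!: sum.cong)
qed

text \<open>For a unit eigenvector the eigenvalue equals \<open>v \<bullet> (M v)\<close>, so the
  ordering can be demanded of the vectors without naming eigenvalues.\<close>

lemma principal_directionsI:
  assumes vs: "orthonormal_list m vs" "length vs = m" and M: "M \<in> carrier_mat m m"
    and ev: "\<forall>v\<in>set vs. \<exists>e. eigenvector M v e"
    and sorted: "sorted_wrt (\<lambda>u v. v \<bullet> (M *\<^sub>v v) \<le> u \<bullet> (M *\<^sub>v u)) vs"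
  shows "principal_directions m M vs"
proof -
  let ?ev = "\<lambda>i. vs ! i \<bullet> (M *\<^sub>v vs ! i)"
  have "eigenvector M (vs ! i) (?ev i)" if i: "i < m" for i
  proof -
    obtain e where e: "eigenvector M (vs ! i) e" using ev i vs(2) nth_mem by metis
    have v: "vs ! i \<in> carrier_vec m" using vs i by (auto simp: orthonormal_list_def)
    have "?ev i = e"
      using e v vs i by (simp add: eigenvector_def orthonormal_list_def)
    with e show ?thesis by simp
  qed
  moreover have "?ev j \<le> ?ev i" if "i \<le> j" "j < m" for i j
    using sorted_wrt_nth_less[OF sorted, of i j] that vs(2) by (cases "i = j") auto
  ultimately show ?thesis
    using vs unfolding principal_directions_def orthonormal_list_def
    by (intro conjI exI[of _ ?ev]) simp_all
qed

lemma orthonormal_list_permute: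
  assumes "orthonormal_list m vs" "mset vs = mset ws"
  shows "orthonormal_list m ws"
  using assms mset_eq_setD[OF assms(2)] mset_eq_imp_distinct_iff[OF assms(2)]
  by (simp add: orthonormal_list_iff)

lemma invariant_subspace_sorted_eigenbasis:
  assumes M: "M \<in> carrier_mat m m" "M\<^sup>T = M" and T: "vec_subspace m T"
    and inv: "\<And>x. x \<in> T \<Longrightarrow> M *\<^sub>v x \<in> T"
  obtains vs where "orthonormal_list m vs" "vec_span m (set vs) = T" "length vs = vec_dim m T"
    "\<forall>v\<in>set vs. \<exists>e. eigenvector M v e" "sorted_wrt (\<lambda>u v. v \<bullet> (M *\<^sub>v v) \<le> u \<bullet> (M *\<^sub>v u)) vs"
proof -
  obtain us where us: "orthonormal_list m us" "vec_span m (set us) = T" "length us = vec_dim m T"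
    "\<forall>v\<in>set us. \<exists>e. eigenvector M v e"
    using M T inv by (rule invariant_subspace_eigenbasis)
  \<comment> \<open>The key is negated because \<open>sort_key\<close> sorts upwards, whereas
    eigenvalues have to decrease.\<close>
  let ?vs = "sort_key (\<lambda>v. - (v \<bullet> (M *\<^sub>v v))) us"
  have "sorted (map (\<lambda>v. - (v \<bullet> (M *\<^sub>v v))) ?vs)" by (rule sorted_sort_key)
  then have "sorted_wrt (\<lambda>u v. v \<bullet> (M *\<^sub>v v) \<le> u \<bullet> (M *\<^sub>v u)) ?vs"
    by (simp add: sorted_wrt_map)
  moreover have "orthonormal_list m ?vs"
    by (rule orthonormal_list_permute[OF us(1)]) simp
  ultimately show ?thesis using us by (intro that[of ?vs]) auto
qed

lemma vec_dim_carrier: "vec_dim m (carrier_vec m) = m"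
proof -
  interpret V: vec_space "TYPE(real)" m .
  have *: "(module_vec TYPE(real) m)\<lparr>carrier := carrier_vec m\<rparr> = module_vec TYPE(real) m"
    by (simp add: module_vec_def)
  show ?thesis unfolding * by (rule V.dim_is_n)
qed

lemma ex_principal_directions:
  assumes M: "M \<in> carrier_mat m m" "M\<^sup>T = M"
  obtains vs where "principal_directions m M vs"
proof -
  have sub: "vec_subspace m (carrier_vec m)" by (rule vec_subspaceI) auto
  have inv: "M *\<^sub>v x \<in> carrier_vec m" if "x \<in> carrier_vec m" for x using M that by simp
  obtain vs where "orthonormal_list m vs" "length vs = vec_dim m (carrier_vec m)"
    "\<forall>v\<in>set vs. \<exists>e. eigenvector M v e" "sorted_wrt (\<lambda>u v. v \<bullet> (M *\<^sub>v v) \<le> u \<bullet> (M *\<^sub>v u)) vs"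
    by (rule invariant_subspace_sorted_eigenbasis[OF M sub inv])
  with M show ?thesis
    by (intro that principal_directionsI) (simp_all add: vec_dim_carrier)
qed

lemma orthonormal_list_subset_span:
  assumes "orthonormal_list m vs"
  shows "set vs \<subseteq> vec_span m (set vs)"
proof -
  interpret V: vec_space "TYPE(real)" m .
  show ?thesis using assms V.in_own_span by (auto simp: orthonormal_list_def)
qed

lemma orthogonal_pairsE:
  assumes "(S, T) \<in> orthogonal_pairs m p q"
  obtains us ws where "orthonormal_list m (us @ ws)" "length us = p" "length ws = q"
    "vec_span m (set us) = S" "vec_span m (set ws) = T"
proof -
  have ST: "vec_subspace m S" "vec_subspace m T" "vec_dim m S = p" "vec_dim m T = q"
    "\<And>x y. x \<in> S \<Longrightarrow> y \<in> T \<Longrightarrow> x \<bullet> y = 0"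
    using assms by (auto simp: orthogonal_pairs_def)
  obtain us where us: "orthonormal_list m us" "vec_span m (set us) = S" "length us = p"
    using ST(3) by (auto elim: subspace_orthonormal_basis[OF ST(1)])
  obtain ws where ws: "orthonormal_list m ws" "vec_span m (set ws) = T" "length ws = q"
    using ST(4) by (auto elim: subspace_orthonormal_basis[OF ST(2)])
  have "set us \<subseteq> S" "set ws \<subseteq> T"
    using orthonormal_list_subset_span[OF us(1)] orthonormal_list_subset_span[OF ws(1)] us(2) ws(2)
    by simp_all
  then have "orthonormal_list m (us @ ws)"
    using us ws ST(5) by (auto simp: orthonormal_list_append_iff)
  with us ws that show ?thesis by blast
qed

lemma scalar_prod_span_eq_0:
  assumes A: "A \<subseteq> carrier_vec m" and x: "x \<in> carrier_vec m"
    and orth: "\<And>a. a \<in> A \<Longrightarrow> a \<bullet> x = 0" and y: "y \<in> vec_span m A"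
  shows "y \<bullet> (x :: real vec) = 0"
proof -
  have "vec_span m A \<subseteq> {y \<in> carrier_vec m. y \<bullet> x = 0}"
    using A x orth
    by (intro vec_span_subset_subspace vec_subspaceI) (auto simp: add_scalar_prod_distrib[of _ m])
  with y show ?thesis by auto
qed

text \<open>The two halves of an orthonormal basis span mutual orthogonal complements. If
  \<open>x\<close> is orthogonal to \<open>ws\<close>, then \<open>x\<close> minus its projection
  onto \<open>us\<close> is orthogonal to the whole basis, and Parseval makes it zero. The second
  claim follows by exchanging the halves.\<close>

lemma orthonormal_list_append_in_span_iff:
  assumes "orthonormal_list m (us @ ws)" "length (us @ ws) = m"
  shows "x \<in> vec_span m (set us) \<longleftrightarrow> x \<in> carrier_vec m \<and> (\<forall>w\<in>set ws. w \<bullet> x = 0)"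
    and "x \<in> vec_span m (set ws) \<longleftrightarrow> x \<in> carrier_vec m \<and> (\<forall>u\<in>set us. u \<bullet> x = 0)"
proof -
  have *: "x \<in> vec_span m (set us) \<longleftrightarrow> x \<in> carrier_vec m \<and> (\<forall>w\<in>set ws. w \<bullet> x = 0)"
    if L: "orthonormal_list m (us @ ws)" "length (us @ ws) = m" for us ws x
  proof
    have u: "orthonormal_list m us" and w: "orthonormal_list m ws"
      and uw: "\<And>u w. u \<in> set us \<Longrightarrow> w \<in> set ws \<Longrightarrow> u \<bullet> w = 0"
      using L(1) by (auto simp: orthonormal_list_append_iff)
    have uc: "set us \<subseteq> carrier_vec m" "set ws \<subseteq> carrier_vec m"
      using u w by (auto simp: orthonormal_list_def)
    {
      assume x: "x \<in> vec_span m (set us)"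
      then have xc: "x \<in> carrier_vec m"
        using in_vec_span_orthonormal_iff[OF u] by simp
      have "w \<bullet> x = 0" if "w \<in> set ws" for w
        using scalar_prod_span_eq_0[OF uc(1) _ uw x, of w] that uc xc comm_scalar_prod[of w m x] by auto
      with xc show "x \<in> carrier_vec m \<and> (\<forall>w\<in>set ws. w \<bullet> x = 0)" by simp
    next
      assume x: "x \<in> carrier_vec m \<and> (\<forall>w\<in>set ws. w \<bullet> x = 0)"
      let ?U = "mat_of_rows m us"
      define z where "z = ?U\<^sup>T *\<^sub>v (?U *\<^sub>v x)"
      have U: "orthonormal_rows (length us) m ?U" using u by (rule orthonormal_rows_mat_of_rows)
      have Ux: "?U *\<^sub>v x \<in> carrier_vec (length us)"
        using x by (intro mult_mat_vec_carrier[of _ _ m]) auto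
      then have zspan: "z \<in> vec_span m (set us)"
        unfolding z_def by (subst vec_span_set[OF uc(1)]) (rule imageI)
      then have zc: "z \<in> carrier_vec m" using in_vec_span_orthonormal_iff[OF u] by simp
      have "?U *\<^sub>v z = ?U *\<^sub>v x"
        unfolding z_def using U Ux by (rule mult_mat_vec_transpose_cancel)
      have "v \<bullet> (x - z) = 0" if v: "v \<in> set (us @ ws)" for v
      proof -
        have vc: "v \<in> carrier_vec m" using v uc by auto
        have "v \<bullet> x = v \<bullet> z"
        proof (cases "v \<in> set us")
          case True
          then obtain i where i: "i < length us" "v = us ! i" by (auto simp: in_set_conv_nth)
          then have "(?U *\<^sub>v y) $ i = v \<bullet> y" for y
            using uc by (simp add: mat_of_rows_mult_vec_index del: index_mult_mat_vec)
          with \<open>?U *\<^sub>v z = ?U *\<^sub>v x\<close> show ?thesis by metis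
        next
          case False
          with v have "v \<in> set ws" by simp
          moreover have "z \<bullet> v = 0"
            using scalar_prod_span_eq_0[OF uc(1) vc uw zspan] \<open>v \<in> set ws\<close> by auto
          ultimately show ?thesis using x vc zc comm_scalar_prod[of v m z] by auto
        qed
        then show ?thesis using vc x zc by (simp add: scalar_prod_minus_distrib[of _ m])
      qed
      then have "(us @ ws) ! j \<bullet> (x - z) = 0" if "j < m" for j
        using that L(2) nth_mem[of j "us @ ws"] by auto
      then have "(x - z) \<bullet> (x - z) = 0"
        using x zc by (subst orthonormal_basis_scalar_prod[OF L]) auto
      then have "x - z = 0\<^sub>v m"
        using x zc scalar_prod_self_eq_0[of "x - z" m] by auto
      then have "x = z"
        using x zc by (auto simp: vec_eq_iff)
      with zspan show "x \<in> vec_span m (set us)" by simp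
    }
  qed
  show "x \<in> vec_span m (set us) \<longleftrightarrow> x \<in> carrier_vec m \<and> (\<forall>w\<in>set ws. w \<bullet> x = 0)"
    using assms by (rule *)
  have "orthonormal_list m (ws @ us)"
    using assms(1) by (rule orthonormal_list_permute) simp
  moreover have "length (ws @ us) = m" using assms(2) by simp
  ultimately show "x \<in> vec_span m (set ws) \<longleftrightarrow> x \<in> carrier_vec m \<and> (\<forall>u\<in>set us. u \<bullet> x = 0)"
    by (rule *)
qed

lemma orthogonal_pairsI:
  assumes "orthonormal_list m (us @ ws)"
  shows "(vec_span m (set us), vec_span m (set ws)) \<in> orthogonal_pairs m (length us) (length ws)"
proof -
  have u: "orthonormal_list m us" and w: "orthonormal_list m ws"
    and uw: "\<And>u w. u \<in> set us \<Longrightarrow> w \<in> set ws \<Longrightarrow> u \<bullet> w = 0"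
    using assms by (auto simp: orthonormal_list_append_iff)
  have c: "set us \<subseteq> carrier_vec m" "set ws \<subseteq> carrier_vec m"
    using u w by (auto simp: orthonormal_list_def)
  have "x \<bullet> y = 0" if x: "x \<in> vec_span m (set us)" and y: "y \<in> vec_span m (set ws)" for x y
  proof (rule scalar_prod_span_eq_0[OF c(1) _ _ x])
    show yc: "y \<in> carrier_vec m" using y in_vec_span_orthonormal_iff[OF w] by simp
    fix a assume a: "a \<in> set us"
    then have "w \<bullet> a = 0" if "w \<in> set ws" for w
      using c uw that comm_scalar_prod[of w m a] by auto
    then have "y \<bullet> a = 0"
      using a c by (intro scalar_prod_span_eq_0[OF c(2) _ _ y]) auto
    then show "a \<bullet> y = 0" using a c yc comm_scalar_prod[of a m y] by auto
  qed
  then show ?thesis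
    using c vec_dim_span_orthonormal[OF u] vec_dim_span_orthonormal[OF w]
    by (auto simp: orthogonal_pairs_def vec_subspace_span)
qed

text \<open>Eigenvector-free criterion. Orthogonality for the form of \<open>M\<close> makes
  \<open>S\<close> and \<open>T\<close> invariant, so each has its own sorted eigenbasis. Since
  \<theta> separates the two sets of eigenvalues, concatenating these bases keeps the order.\<close>

lemma pca_pairI:
  assumes M: "M \<in> carrier_mat m m" "M\<^sup>T = M" and ST: "(S, T) \<in> orthogonal_pairs m p q" and pq: "p + q = m"
    and cross: "\<And>s t. s \<in> S \<Longrightarrow> t \<in> T \<Longrightarrow> s \<bullet> (M *\<^sub>v t) = 0"
    and lower: "\<And>s. s \<in> S \<Longrightarrow> \<theta> * (s \<bullet> s) \<le> s \<bullet> (M *\<^sub>v s)"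
    and upper: "\<And>t. t \<in> T \<Longrightarrow> t \<bullet> (M *\<^sub>v t) \<le> \<theta> * (t \<bullet> t)"
  shows "pca_pair m p M (S, T)"
proof -
  have sub: "vec_subspace m S" "vec_subspace m T" and dim: "vec_dim m S = p" "vec_dim m T = q"
    and orth: "\<And>x y. x \<in> S \<Longrightarrow> y \<in> T \<Longrightarrow> x \<bullet> y = 0"
    using ST by (auto simp: orthogonal_pairs_def)
  have c: "x \<in> carrier_vec m" if "x \<in> S \<or> x \<in> T" for x
    using that vec_subspace_closed(1)[OF sub(1)] vec_subspace_closed(1)[OF sub(2)] by auto
  obtain us ws where uw: "orthonormal_list m (us @ ws)" "length us = p" "length ws = q"
    "vec_span m (set us) = S" "vec_span m (set ws) = T"
    using ST by (rule orthogonal_pairsE)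
  have "orthonormal_list m us" "orthonormal_list m ws"
    using uw(1) by (auto simp: orthonormal_list_append_iff)
  then have uS: "set us \<subseteq> S" "set ws \<subseteq> T"
    using orthonormal_list_subset_span uw(4,5) by fastforce+
  have len: "length (us @ ws) = m" using uw pq by simp
  note span = orthonormal_list_append_in_span_iff[OF uw(1) len, unfolded uw(4,5)]
  \<comment> \<open>\<open>T\<close> is the orthogonal complement of \<open>S\<close>, so
    orthogonality of \<open>M t\<close> to \<open>S\<close> is membership in
    \<open>T\<close>.\<close>
  have invT: "M *\<^sub>v t \<in> T" if "t \<in> T" for t
    using that c M cross uS(1) by (auto simp: span(2))
  have invS: "M *\<^sub>v s \<in> S" if s: "s \<in> S" for s
  proof -
    have "w \<bullet> (M *\<^sub>v s) = 0" if "w \<in> set ws" for w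
    proof -
      have w: "w \<in> T" using that uS by auto
      have "w \<bullet> (M *\<^sub>v s) = (M *\<^sub>v w) \<bullet> s"
        using M c w s by (intro symmetric_mat_scalar_prod[symmetric]) auto
      also have "\<dots> = s \<bullet> (M *\<^sub>v w)"
        using M c w s by (intro comm_scalar_prod[of _ m]) auto
      finally show ?thesis using cross s w by simp
    qed
    with s c M show ?thesis by (auto simp: span(1))
  qed
  define R where "R = (\<lambda>u v. v \<bullet> (M *\<^sub>v v) \<le> u \<bullet> (M *\<^sub>v u))"
  obtain xs where xs: "orthonormal_list m xs" "vec_span m (set xs) = S" "length xs = vec_dim m S"
    "\<forall>v\<in>set xs. \<exists>e. eigenvector M v e" "sorted_wrt R xs"
    unfolding R_def by (rule invariant_subspace_sorted_eigenbasis[OF M sub(1) invS])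
  obtain ys where ys: "orthonormal_list m ys" "vec_span m (set ys) = T" "length ys = vec_dim m T"
    "\<forall>v\<in>set ys. \<exists>e. eigenvector M v e" "sorted_wrt R ys"
    unfolding R_def by (rule invariant_subspace_sorted_eigenbasis[OF M sub(2) invT])
  have sub': "set xs \<subseteq> S" "set ys \<subseteq> T"
    using orthonormal_list_subset_span[OF xs(1)] orthonormal_list_subset_span[OF ys(1)] xs(2) ys(2)
    by simp_all
  have "R x y" if x: "x \<in> set xs" and y: "y \<in> set ys" for x y
  proof -
    have "y \<bullet> (M *\<^sub>v y) \<le> \<theta>"
      using upper[of y] y sub' ys(1) by (auto simp: orthonormal_list_iff)
    also have "\<theta> \<le> x \<bullet> (M *\<^sub>v x)"
      using lower[of x] x sub' xs(1) by (auto simp: orthonormal_list_iff)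
    finally show ?thesis by (simp add: R_def)
  qed
  then have "sorted_wrt R (xs @ ys)"
    using xs ys by (simp add: sorted_wrt_append)
  moreover have "orthonormal_list m (xs @ ys)"
    unfolding orthonormal_list_append_iff using xs(1) ys(1) sub' orth by blast
  moreover have "length (xs @ ys) = m" using xs ys dim pq by simp
  moreover have "\<forall>v\<in>set (xs @ ys). \<exists>e. eigenvector M v e" using xs(4) ys(4) by auto
  ultimately have "principal_directions m M (xs @ ys)"
    using M by (intro principal_directionsI) (auto simp: R_def)
  then show ?thesis
    unfolding pca_pair_def using xs ys dim by (auto intro!: exI[of _ "xs @ ys"])
qed

section \<open>Extremal determinants of compressions\<close>

text \<open>Jensen's inequality obtained from \<open>ln t \<le> t - 1\<close> at
  \<open>t = l i / a\<close>, with \<open>a\<close> the weighted mean: the right-hand sides average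
  to zero.\<close>

lemma sum_weighted_ln_le:
  fixes w l :: "'a \<Rightarrow> real"
  assumes "finite I" and w: "\<And>i. i \<in> I \<Longrightarrow> 0 \<le> w i" "sum w I = 1" and l: "\<And>i. i \<in> I \<Longrightarrow> 0 < l i"
  shows "(\<Sum>i\<in>I. w i * ln (l i)) \<le> ln (\<Sum>i\<in>I. w i * l i)"
proof -
  define a where "a = (\<Sum>i\<in>I. w i * l i)"
  have "a \<noteq> 0"
  proof
    assume "a = 0"
    then have "\<forall>i\<in>I. w i * l i = 0"
      unfolding a_def using assms by (subst (asm) sum_nonneg_eq_0_iff) (auto intro: mult_nonneg_nonneg less_imp_le)
    then have "\<forall>i\<in>I. w i = 0" using l by force
    with w(2) show False by simp
  qed
  moreover have "0 \<le> a"
    unfolding a_def using assms by (intro sum_nonneg mult_nonneg_nonneg) (auto intro: less_imp_le)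
  ultimately have a: "0 < a" by simp
  have "(\<Sum>i\<in>I. w i * (ln (l i) - ln a)) \<le> (\<Sum>i\<in>I. w i * (l i / a - 1))"
  proof (intro sum_mono mult_left_mono w)
    fix i assume i: "i \<in> I"
    have "ln (l i) - ln a = ln (l i / a)" using l[OF i] a by (simp add: ln_div)
    also have "\<dots> \<le> l i / a - 1" using l[OF i] a by (intro ln_le_minus_one) simp
    finally show "ln (l i) - ln a \<le> l i / a - 1" .
  qed
  also have "\<dots> = (\<Sum>i\<in>I. w i * l i) / a - sum w I"
    by (simp add: right_diff_distrib sum_subtractf sum_divide_distrib)
  also have "\<dots> = a / a - sum w I" by (simp add: a_def)
  also have "\<dots> = 0" using a w(2) by simp
  finally have "(\<Sum>i\<in>I. w i * ln (l i)) - sum w I * ln a \<le> 0"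
    by (simp add: right_diff_distrib sum_subtractf sum_distrib_right)
  with w(2) show ?thesis by (simp add: a_def)
qed

text \<open>
  Linear programming over \<open>{w \<in> [0, 1]\<^sup>m. \<Sum>\<^sub>j w\<^sub>j = p}\<close>.  In case of ties the optimal \<open>w\<close> is not unique,
  but it is determined where \<open>l\<close> differs from the threshold value \<open>l p\<close>.
\<close>

lemma weighted_sum_le_top:
  fixes w l :: "nat \<Rightarrow> real"
  assumes p: "p < m" and l: "\<And>i j. i \<le> j \<Longrightarrow> j < m \<Longrightarrow> l j \<le> l i"
    and w: "\<And>j. j < m \<Longrightarrow> 0 \<le> w j" "\<And>j. j < m \<Longrightarrow> w j \<le> 1" "(\<Sum>j<m. w j) = p"
  shows "(\<Sum>j<m. w j * l j) \<le> (\<Sum>j<p. l j)"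
    and "(\<Sum>j<m. w j * l j) = (\<Sum>j<p. l j) \<Longrightarrow> j < m \<Longrightarrow> l p < l j \<Longrightarrow> w j = 1"
    and "(\<Sum>j<m. w j * l j) = (\<Sum>j<p. l j) \<Longrightarrow> j < m \<Longrightarrow> l j < l p \<Longrightarrow> w j = 0"
proof -
  \<comment> \<open>\<open>g\<close> collects the loss of each index. Both factors change sign at
    \<open>p\<close>, so every loss is nonnegative. Subtracting \<open>l p\<close> leaves the total
    unchanged, because the indicator and \<open>w\<close> have the same sum. A total of zero forces
    each loss to vanish.\<close>
  define g where "g j = (of_bool (j < p) - w j) * (l j - l p)" for j
  have g: "0 \<le> g j" if j: "j < m" for j
  proof (cases "j < p")
    case True
    with l[of j p] p w(2)[OF j] show ?thesis by (simp add: g_def)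
  next
    case False
    with l[of p j] j w(1)[OF j] show ?thesis by (simp add: g_def mult_nonneg_nonpos)
  qed
  have top: "(\<Sum>j<m. of_bool (j < p) * f j) = (\<Sum>j<p. f j)" for f :: "nat \<Rightarrow> real"
    using p by (intro sum.mono_neutral_cong_right) auto
  have "(\<Sum>j<m. g j) = (\<Sum>j<m. of_bool (j < p) * l j) - (\<Sum>j<m. w j * l j)
      - l p * ((\<Sum>j<m. of_bool (j < p) * 1) - (\<Sum>j<m. w j))"
    by (simp add: g_def algebra_simps sum.distrib sum_subtractf sum_distrib_left)
  then have sum_g: "(\<Sum>j<m. g j) = (\<Sum>j<p. l j) - (\<Sum>j<m. w j * l j)"
    unfolding top w(3) by simp
  have "0 \<le> (\<Sum>j<m. g j)" using g by (intro sum_nonneg) auto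
  with sum_g show "(\<Sum>j<m. w j * l j) \<le> (\<Sum>j<p. l j)" by simp
  assume eq: "(\<Sum>j<m. w j * l j) = (\<Sum>j<p. l j)" and j: "j < m"
  have "(\<Sum>j<m. g j) = 0" using sum_g eq by simp
  then have gj: "g j = 0" using g j by (subst (asm) sum_nonneg_eq_0_iff) auto
  show "w j = 1" if "l p < l j"
  proof -
    have "j < p" using l[of p j] j that by (cases "j < p") auto
    with gj that show ?thesis by (simp add: g_def)
  qed
  show "w j = 0" if "l j < l p"
  proof -
    have "\<not> j < p" using l[of j p] p that by (cases "j < p") auto
    with gj that show ?thesis by (simp add: g_def)
  qed
qed

text \<open>The complementary weights \<open>1 - w j\<close> sum to \<open>p\<close> and are
  admissible for the preceding lemma.\<close>

lemma weighted_sum_ge_bottom: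
  fixes w l :: "nat \<Rightarrow> real"
  assumes p: "p < m" and l: "\<And>i j. i \<le> j \<Longrightarrow> j < m \<Longrightarrow> l j \<le> l i"
    and w: "\<And>j. j < m \<Longrightarrow> 0 \<le> w j" "\<And>j. j < m \<Longrightarrow> w j \<le> 1" "(\<Sum>j<m. w j) = real m - real p"
  shows "(\<Sum>j=p..<m. l j) \<le> (\<Sum>j<m. w j * l j)"
    and "(\<Sum>j<m. w j * l j) = (\<Sum>j=p..<m. l j) \<Longrightarrow> j < m \<Longrightarrow> l p < l j \<Longrightarrow> w j = 0"
    and "(\<Sum>j<m. w j * l j) = (\<Sum>j=p..<m. l j) \<Longrightarrow> j < m \<Longrightarrow> l j < l p \<Longrightarrow> w j = 1"
proof -
  have split: "(\<Sum>j<m. l j) = (\<Sum>j<p. l j) + (\<Sum>j=p..<m. l j)"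
    using p by (simp add: lessThan_atLeast0 sum.atLeastLessThan_concat)
  have eq: "(\<Sum>j<m. (1 - w j) * l j) = (\<Sum>j<m. l j) - (\<Sum>j<m. w j * l j)"
    by (simp add: algebra_simps sum_subtractf)
  have w': "0 \<le> 1 - w j" "1 - w j \<le> 1" if "j < m" for j
    using w(1,2)[OF that] by auto
  have s: "(\<Sum>j<m. 1 - w j) = p" using w(3) by (simp add: sum_subtractf)
  note top = weighted_sum_le_top[of p m l "\<lambda>j. 1 - w j", OF p l w' s, unfolded eq split]
  show "(\<Sum>j=p..<m. l j) \<le> (\<Sum>j<m. w j * l j)" using top(1) by simp
  show "(\<Sum>j<m. w j * l j) = (\<Sum>j=p..<m. l j) \<Longrightarrow> j < m \<Longrightarrow> l p < l j \<Longrightarrow> w j = 0"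
    using top(2)[of j] by simp
  show "(\<Sum>j<m. w j * l j) = (\<Sum>j=p..<m. l j) \<Longrightarrow> j < m \<Longrightarrow> l j < l p \<Longrightarrow> w j = 1"
    using top(3)[of j] by simp
qed

section \<open>Bessel's inequality and diagonal compressions\<close>

text \<open>With \<open>z\<close> the projection of \<open>x\<close> onto the row space, the defect
  in the inequality is the squared norm of \<open>x - z\<close>. Equality puts \<open>x\<close> into
  the row space, which is orthogonal to the kernel of \<open>B\<close>.\<close>

lemma bessel_inequality:
  assumes B: "orthonormal_rows n m B" and x: "x \<in> carrier_vec m"
  shows "(B *\<^sub>v x) \<bullet> (B *\<^sub>v x) \<le> x \<bullet> x"
    and "(B *\<^sub>v x) \<bullet> (B *\<^sub>v x) = x \<bullet> x \<Longrightarrow> y \<in> carrier_vec m \<Longrightarrow> B *\<^sub>v y = 0\<^sub>v n \<Longrightarrow> x \<bullet> y = 0"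
proof -
  have Bc: "B \<in> carrier_mat n m" using B by (simp add: orthonormal_rows_def)
  have Bx: "B *\<^sub>v x \<in> carrier_vec n" using Bc x by (rule mult_mat_vec_carrier)
  define z where "z = B\<^sup>T *\<^sub>v (B *\<^sub>v x)"
  have z: "z \<in> carrier_vec m" unfolding z_def using Bc Bx by (intro mult_mat_vec_carrier[of _ m n]) auto
  have zy: "z \<bullet> y = (B *\<^sub>v x) \<bullet> (B *\<^sub>v y)" if "y \<in> carrier_vec m" for y
    unfolding z_def using Bc Bx that by (intro transpose_vec_mult_scalar)
  have Bz: "B *\<^sub>v z = B *\<^sub>v x"
    unfolding z_def using B Bx by (rule mult_mat_vec_transpose_cancel)
  have "x \<bullet> z = z \<bullet> x" using x z by (rule comm_scalar_prod)
  then have *: "(x - z) \<bullet> (x - z) = x \<bullet> x - (B *\<^sub>v x) \<bullet> (B *\<^sub>v x)"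
    using x z zy[OF x] zy[OF z] Bz
    by (simp add: scalar_prod_minus_distrib[of _ m] minus_scalar_prod_distrib[of _ m])
  with scalar_prod_self_nonneg[of "x - z"] show "(B *\<^sub>v x) \<bullet> (B *\<^sub>v x) \<le> x \<bullet> x" by simp
  assume eq: "(B *\<^sub>v x) \<bullet> (B *\<^sub>v x) = x \<bullet> x" and y: "y \<in> carrier_vec m" and By: "B *\<^sub>v y = 0\<^sub>v n"
  have "(x - z) \<bullet> (x - z) = 0" using * eq by simp
  then have xz: "x - z = 0\<^sub>v m"
    using x z scalar_prod_self_eq_0[of "x - z" m] by simp
  have "x $ i = z $ i" if "i < m" for i
    using arg_cong[OF xz, of "\<lambda>v. v $ i"] x z that by simp
  then have "x = z" using x z by (intro eq_vecI) auto
  then have "x \<bullet> y = z \<bullet> y" by simp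
  also have "\<dots> = 0" using zy[OF y] By Bx by simp
  finally show "x \<bullet> y = 0" .
qed

lemma mult_mat_zero_vec: "A \<in> carrier_mat r c \<Longrightarrow> A *\<^sub>v 0\<^sub>v c = (0\<^sub>v r :: real vec)"
  by (auto simp: vec_eq_iff)

lemma congruence_index:
  fixes B M :: "real mat"
  assumes "B \<in> carrier_mat n m" "M \<in> carrier_mat m m" "i < n" "k < n"
  shows "(B * M * B\<^sup>T) $$ (i, k) = row B i \<bullet> (M *\<^sub>v row B k)"
proof -
  have "B * M * B\<^sup>T = B * (M * B\<^sup>T)"
    using assms by (intro assoc_mult_mat) auto
  moreover have "col (M * B\<^sup>T) k = M *\<^sub>v row B k"
    using assms by (subst col_mult2[of _ m m _ n]) auto
  ultimately show ?thesis using assms by simp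
qed

lemma det_congruence_orthogonal:
  fixes N U :: "real mat"
  assumes N: "N \<in> carrier_mat n n" and U: "orthonormal_rows n n U"
  shows "det (U * N * U\<^sup>T) = det N"
proof -
  have Uc: "U \<in> carrier_mat n n" using U by (simp add: orthonormal_rows_def)
  have "det U * det U\<^sup>T = det (U * U\<^sup>T)"
    using Uc by (subst det_mult[of _ n]) auto
  also have "\<dots> = 1" using U by (simp add: orthonormal_rows_def)
  finally have "det U * det U\<^sup>T = 1" .
  moreover have "det (U * N * U\<^sup>T) = det U * det N * det U\<^sup>T"
    using Uc N by (simp add: det_mult[of _ n])
  ultimately show ?thesis by (simp add: mult.commute mult.left_commute)
qed

lemma congruence_mult:
  fixes U B M :: "real mat"
  assumes "U \<in> carrier_mat l n" "B \<in> carrier_mat n m" "M \<in> carrier_mat m m"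
  shows "(U * B) * M * (U * B)\<^sup>T = U * (B * M * B\<^sup>T) * U\<^sup>T"
proof -
  have "(U * B)\<^sup>T = B\<^sup>T * U\<^sup>T" using assms by (intro transpose_mult) auto
  then have "(U * B) * M * (U * B)\<^sup>T = (U * B) * M * (B\<^sup>T * U\<^sup>T)" by simp
  also have "(U * B) * M * (B\<^sup>T * U\<^sup>T) = U * (B * M) * (B\<^sup>T * U\<^sup>T)"
    using assms by (subst assoc_mult_mat[of U l n B m M m]) auto
  also have "U * (B * M) * (B\<^sup>T * U\<^sup>T) = U * (B * M * (B\<^sup>T * U\<^sup>T))"
    using assms by (intro assoc_mult_mat) auto
  also have "B * M * (B\<^sup>T * U\<^sup>T) = (B * M * B\<^sup>T) * U\<^sup>T"
    using assms by (intro assoc_mult_mat[symmetric]) auto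
  also have "U * \<dots> = U * (B * M * B\<^sup>T) * U\<^sup>T"
    using assms by (intro assoc_mult_mat[symmetric]) auto
  finally show ?thesis .
qed

lemma transpose_congruence:
  fixes B M :: "real mat"
  assumes "B \<in> carrier_mat n m" "M \<in> carrier_mat m m" "M\<^sup>T = M"
  shows "(B * M * B\<^sup>T)\<^sup>T = B * M * B\<^sup>T"
proof -
  have "(B * M * B\<^sup>T)\<^sup>T = B * (B * M)\<^sup>T"
    using assms by (subst transpose_mult[of _ n m _ n]) auto
  also have "(B * M)\<^sup>T = M * B\<^sup>T"
    using assms by (subst transpose_mult[of _ n m _ m]) auto
  also have "B * (M * B\<^sup>T) = B * M * B\<^sup>T"
    using assms by (intro assoc_mult_mat[symmetric]) auto
  finally show ?thesis .
qed

lemma orthonormal_rows_mult: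
  assumes U: "orthonormal_rows l n U" and B: "orthonormal_rows n m B"
  shows "orthonormal_rows l m (U * B)"
proof -
  have c: "U \<in> carrier_mat l n" "B \<in> carrier_mat n m" using U B by (auto simp: orthonormal_rows_def)
  have "(U * B) * (U * B)\<^sup>T = (U * B) * 1\<^sub>m m * (U * B)\<^sup>T" using c by simp
  also have "\<dots> = U * (B * 1\<^sub>m m * B\<^sup>T) * U\<^sup>T" using c by (intro congruence_mult) auto
  also have "\<dots> = 1\<^sub>m l" using c U B by (simp add: orthonormal_rows_def)
  finally show ?thesis using c by (auto simp: orthonormal_rows_def)
qed

lemma orthogonal_mult_vec_eq_0_iff:
  assumes U: "orthonormal_rows n n U" and y: "y \<in> carrier_vec n"
  shows "U *\<^sub>v y = 0\<^sub>v n \<longleftrightarrow> y = 0\<^sub>v n"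
proof
  have Uc: "U \<in> carrier_mat n n" using U by (simp add: orthonormal_rows_def)
  assume "U *\<^sub>v y = 0\<^sub>v n"
  then have "U\<^sup>T *\<^sub>v (U *\<^sub>v y) = 0\<^sub>v n" using Uc by (simp add: mult_mat_zero_vec)
  moreover have "U\<^sup>T *\<^sub>v (U *\<^sub>v y) = (U\<^sup>T * U) *\<^sub>v y"
    using Uc y by (intro assoc_mult_mat_vec[symmetric]) auto
  ultimately show "y = 0\<^sub>v n" using orthonormal_rows_square[OF U] y by simp
next
  have Uc: "U \<in> carrier_mat n n" using U by (simp add: orthonormal_rows_def)
  assume "y = 0\<^sub>v n"
  then show "U *\<^sub>v y = 0\<^sub>v n" using Uc by (simp add: mult_mat_zero_vec)
qed

text \<open>The rows of \<open>B\<close> are rotated by an orthogonal eigenvector matrix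
  \<open>U\<close> of \<open>B M B\<^sup>T\<close>. This changes neither the determinant nor the
  kernel, so it suffices to study compressions that are diagonal.\<close>

lemma compression_diagonalize:
  assumes M: "M \<in> carrier_mat m m" "M\<^sup>T = M" and B: "orthonormal_rows n m B"
  obtains C where "orthonormal_rows n m C"
    "\<And>i k. i < n \<Longrightarrow> k < n \<Longrightarrow> i \<noteq> k \<Longrightarrow> row C i \<bullet> (M *\<^sub>v row C k) = 0"
    "det (B * M * B\<^sup>T) = (\<Prod>i<n. row C i \<bullet> (M *\<^sub>v row C i))"
    "\<And>x. x \<in> carrier_vec m \<Longrightarrow> C *\<^sub>v x = 0\<^sub>v n \<longleftrightarrow> B *\<^sub>v x = 0\<^sub>v n"
proof -
  let ?N = "B * M * B\<^sup>T"
  have Bc: "B \<in> carrier_mat n m" using B by (simp add: orthonormal_rows_def)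
  have N: "?N \<in> carrier_mat n n" "?N\<^sup>T = ?N"
    using Bc M transpose_congruence[OF Bc M] by auto
  obtain us where us: "principal_directions n ?N us" using N by (rule ex_principal_directions)
  then have o: "orthonormal_list n us" "length us = n" by (auto dest: principal_directionsD)
  obtain ev :: "nat \<Rightarrow> real" where ev: "\<And>j. j < n \<Longrightarrow> ?N *\<^sub>v us ! j = ev j \<cdot>\<^sub>v us ! j"
    using us N(1) by (rule principal_directionsE) auto
  let ?U = "mat_of_rows n us"
  let ?C = "?U * B"
  have U: "orthonormal_rows n n ?U" using orthonormal_rows_mat_of_rows[OF o(1)] o(2) by simp
  then have Uc: "?U \<in> carrier_mat n n" by (simp add: orthonormal_rows_def)
  have C: "orthonormal_rows n m ?C" using U B by (rule orthonormal_rows_mult)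
  then have Cc: "?C \<in> carrier_mat n m" by (simp add: orthonormal_rows_def)
  have CU: "?C * M * ?C\<^sup>T = ?U * ?N * ?U\<^sup>T" using Uc Bc M(1) by (rule congruence_mult)
  have ent: "(?C * M * ?C\<^sup>T) $$ (i, k) = ev k * (if i = k then 1 else 0)" if "i < n" "k < n" for i k
  proof -
    have r: "row ?U j = us ! j" "us ! j \<in> carrier_vec n" if "j < n" for j
      using that o by (auto simp: orthonormal_list_def intro!: mat_of_rows_row)
    have "(?C * M * ?C\<^sup>T) $$ (i, k) = us ! i \<bullet> (?N *\<^sub>v us ! k)"
      unfolding CU using congruence_index[OF Uc N(1) that] r that by simp
    also have "\<dots> = ev k * (if i = k then 1 else 0)"
      using ev[OF that(2)] r(2)[OF that(1)] r(2)[OF that(2)] that o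
      by (simp add: orthonormal_list_def scalar_prod_smult_distrib[of _ n])
    finally show ?thesis .
  qed
  note idx = congruence_index[OF Cc M(1)]
  have "row ?C i \<bullet> (M *\<^sub>v row ?C k) = 0" if "i < n" "k < n" "i \<noteq> k" for i k
    using ent[of i k] idx[of i k] that by simp
  moreover have "det ?N = (\<Prod>i<n. row ?C i \<bullet> (M *\<^sub>v row ?C i))"
  proof -
    define D where "D = ?C * M * ?C\<^sup>T"
    have Dc: "D \<in> carrier_mat n n" unfolding D_def using Cc M by auto
    have "det ?N = det D"
      unfolding D_def CU using det_congruence_orthogonal[OF N(1) U] by simp
    also have "\<dots> = prod_list (diag_mat D)"
      using Dc ent unfolding D_def[symmetric] by (intro det_upper_triangular[of _ n]) auto
    also have "\<dots> = (\<Prod>i<n. D $$ (i, i))"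
      using Dc by (simp add: prod_list_diag_prod lessThan_atLeast0)
    also have "\<dots> = (\<Prod>i<n. row ?C i \<bullet> (M *\<^sub>v row ?C i))"
      unfolding D_def using idx by (intro prod.cong) auto
    finally show ?thesis .
  qed
  moreover have "?C *\<^sub>v x = 0\<^sub>v n \<longleftrightarrow> B *\<^sub>v x = 0\<^sub>v n" if x: "x \<in> carrier_vec m" for x
  proof -
    have "?C *\<^sub>v x = ?U *\<^sub>v (B *\<^sub>v x)" using Uc Bc x by (intro assoc_mult_mat_vec) auto
    moreover have "B *\<^sub>v x \<in> carrier_vec n" using Bc x by (rule mult_mat_vec_carrier)
    ultimately show ?thesis using orthogonal_mult_vec_eq_0_iff[OF U] by simp
  qed
  ultimately show ?thesis using C by (intro that[of ?C]) auto
qed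

text \<open>Two orthonormal bases of one space differ by the orthogonal matrix
  \<open>U = B C\<^sup>T\<close>. This makes the arbitrary choice in \<open>basis_mat\<close>
  harmless.\<close>

lemma det_congruence_cong_span:
  assumes M: "M \<in> carrier_mat m m"
    and B: "orthonormal_rows n m B" and C: "orthonormal_rows n m C"
    and span: "vec_span m (set (rows B)) = vec_span m (set (rows C))"
  shows "det (B * M * B\<^sup>T) = det (C * M * C\<^sup>T)"
proof -
  have Bc: "B \<in> carrier_mat n m" "orthonormal_list m (rows B)"
    using B by (auto simp: orthonormal_rows_iff_orthonormal_list)
  have Cc: "C \<in> carrier_mat n m" "orthonormal_list m (rows C)"
    using C by (auto simp: orthonormal_rows_iff_orthonormal_list)
  have mr: "mat_of_rows m (rows C) = C" using Cc(1) mat_of_rows_rows[of C] by simp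
  define U where "U = B * C\<^sup>T"
  have Uc: "U \<in> carrier_mat n n" unfolding U_def using Bc Cc by auto
  have "B = U * C"
  proof (rule eq_rowI)
    fix i assume "i < dim_row (U * C)"
    then have i: "i < n" using Uc by simp
    have ri: "row B i \<in> carrier_vec m" using Bc i by simp
    have "row B i \<in> vec_span m (set (rows C))"
      using orthonormal_list_subset_span[OF Bc(2)] Bc(1) i
      unfolding span[symmetric] by (auto simp: rows_def)
    then have *: "C\<^sup>T *\<^sub>v (C *\<^sub>v row B i) = row B i"
      using in_vec_span_orthonormal_iff[OF Cc(2)] mr by simp
    have "row (U * C) i = C\<^sup>T *\<^sub>v row U i"
      using Uc Cc i by (intro eq_vecI) (auto simp: comm_scalar_prod[of _ n])
    also have "row U i = C *\<^sub>v row B i"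
      unfolding U_def using Bc Cc i by (intro eq_vecI) (auto simp: comm_scalar_prod[of _ m])
    finally show "row B i = row (U * C) i" using * by simp
  qed (use Bc Cc Uc in auto)
  then have *: "B * M * B\<^sup>T = U * (C * M * C\<^sup>T) * U\<^sup>T"
    using congruence_mult[OF Uc Cc(1) M] by simp
  have "U * U\<^sup>T = 1\<^sub>m n"
  proof -
    have "U * U\<^sup>T = U * (C * 1\<^sub>m m * C\<^sup>T) * U\<^sup>T"
      using C Cc Uc by (simp add: orthonormal_rows_def)
    also have "\<dots> = (U * C) * 1\<^sub>m m * (U * C)\<^sup>T"
      using congruence_mult[OF Uc Cc(1), of "1\<^sub>m m"] by simp
    also have "\<dots> = 1\<^sub>m n"
      unfolding \<open>B = U * C\<close>[symmetric] using B Bc by (simp add: orthonormal_rows_def)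
    finally show ?thesis .
  qed
  then have "orthonormal_rows n n U" using Uc by (simp add: orthonormal_rows_def)
  moreover have "C * M * C\<^sup>T \<in> carrier_mat n n" using Cc M by auto
  ultimately show ?thesis unfolding * by (intro det_congruence_orthogonal)
qed

section \<open>Determinant bounds for positive definite matrices\<close>

locale positive_definite =
  fixes m :: nat and M :: "real mat"
  assumes M: "M \<in> carrier_mat m m" "M\<^sup>T = M"
    and pos: "\<And>x. x \<in> carrier_vec m \<Longrightarrow> x \<noteq> 0\<^sub>v m \<Longrightarrow> 0 < x \<bullet> (M *\<^sub>v x)"
begin

lemma orthonormal_rows_row:
  assumes C: "orthonormal_rows n m C" and i: "i < n"
  shows "row C i \<in> carrier_vec m" "row C i \<bullet> row C i = 1" "0 < row C i \<bullet> (M *\<^sub>v row C i)"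
proof -
  have Cc: "C \<in> carrier_mat n m" and o: "orthonormal_list m (rows C)"
    using C by (auto simp: orthonormal_rows_iff_orthonormal_list)
  show c: "row C i \<in> carrier_vec m" using Cc i by simp
  show 1: "row C i \<bullet> row C i = 1" using o Cc i by (simp add: orthonormal_list_def)
  then have "row C i \<noteq> 0\<^sub>v m" by auto
  with c show "0 < row C i \<bullet> (M *\<^sub>v row C i)" by (rule pos)
qed

lemma det_compression_pos:
  assumes B: "orthonormal_rows n m B"
  shows "0 < det (B * M * B\<^sup>T)"
proof -
  obtain C where C: "orthonormal_rows n m C"
    "det (B * M * B\<^sup>T) = (\<Prod>i<n. row C i \<bullet> (M *\<^sub>v row C i))"
    by (rule compression_diagonalize[OF M B]) (rule that)
  show ?thesis unfolding C(2) using orthonormal_rows_row(3)[OF C(1)] by (intro prod_pos) auto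
qed

text \<open>These squared norms are the weights of the linear program. Adding the squared
  coefficients row by row gives \<open>n\<close>, since rows are unit vectors; each column is
  bounded by Bessel. The basis \<open>us\<close> is free because both the eigenvectors and the
  standard unit vectors will be inserted.\<close>

lemma sum_norm_mult_basis:
  assumes D: "orthonormal_rows n m D" and vs': "orthonormal_list m us" "length us = m"
  shows "(\<Sum>j<m. (D *\<^sub>v us ! j) \<bullet> (D *\<^sub>v us ! j)) = real n"
    and "j < m \<Longrightarrow> 0 \<le> (D *\<^sub>v us ! j) \<bullet> (D *\<^sub>v us ! j)"
    and "j < m \<Longrightarrow> (D *\<^sub>v us ! j) \<bullet> (D *\<^sub>v us ! j) \<le> 1"
    and "(D *\<^sub>v us ! j) \<bullet> (D *\<^sub>v us ! j) = (\<Sum>i<n. (row D i \<bullet> us ! j)\<^sup>2)"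
proof -
  have Dc: "D \<in> carrier_mat n m" using D by (simp add: orthonormal_rows_def)
  have uc: "us ! j \<in> carrier_vec m" if "j < m" for j
    using vs' that by (auto simp: orthonormal_list_def)
  show expand: "(D *\<^sub>v us ! j) \<bullet> (D *\<^sub>v us ! j) = (\<Sum>i<n. (row D i \<bullet> us ! j)\<^sup>2)" for j
    using Dc by (simp add: scalar_prod_def[of "D *\<^sub>v us ! j"] lessThan_atLeast0 power2_eq_square)
  have "(\<Sum>j<m. (D *\<^sub>v us ! j) \<bullet> (D *\<^sub>v us ! j)) = (\<Sum>i<n. \<Sum>j<m. (row D i \<bullet> us ! j)\<^sup>2)"
    unfolding expand by (rule sum.swap)
  also have "\<dots> = (\<Sum>i<n. row D i \<bullet> row D i)"
  proof (intro sum.cong refl)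
    fix i assume "i \<in> {..<n}"
    then have r: "row D i \<in> carrier_vec m" using Dc by simp
    have "row D i \<bullet> us ! j = us ! j \<bullet> row D i" if "j < m" for j
      using r uc[OF that] by (rule comm_scalar_prod)
    then show "(\<Sum>j<m. (row D i \<bullet> us ! j)\<^sup>2) = row D i \<bullet> row D i"
      unfolding orthonormal_basis_scalar_prod[OF vs' r r]
      by (intro sum.cong) (auto simp: power2_eq_square)
  qed
  also have "\<dots> = real n" using orthonormal_rows_row(2)[OF D] by simp
  finally show "(\<Sum>j<m. (D *\<^sub>v us ! j) \<bullet> (D *\<^sub>v us ! j)) = real n" .
  show "0 \<le> (D *\<^sub>v us ! j) \<bullet> (D *\<^sub>v us ! j)" by (rule scalar_prod_self_nonneg)
  show "(D *\<^sub>v us ! j) \<bullet> (D *\<^sub>v us ! j) \<le> 1" if j: "j < m"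
    using bessel_inequality(1)[OF D uc[OF j]] vs' j by (simp add: orthonormal_list_def)
qed

end

text \<open>\<open>l p\<close> is the largest eigenvalue left out of the first \<open>p\<close>; it
  is the threshold at which ties may occur. The condition \<open>p < m\<close> ensures that it
  exists.\<close>

locale positive_definite_eigenbasis = positive_definite +
  fixes p :: nat and vs :: "real vec list" and l :: "nat \<Rightarrow> real"
  assumes vs: "orthonormal_list m vs" "length vs = m"
    and eig: "\<And>j. j < m \<Longrightarrow> M *\<^sub>v vs ! j = l j \<cdot>\<^sub>v vs ! j"
    and mono: "\<And>i j. i \<le> j \<Longrightarrow> j < m \<Longrightarrow> l j \<le> l i"
    and p: "p < m"
begin

lemma eigenbasis_carrier: "j < m \<Longrightarrow> vs ! j \<in> carrier_vec m"
  using vs by (auto simp: orthonormal_list_def)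

lemma eigenvalue_pos:
  assumes j: "j < m"
  shows "0 < l j"
proof -
  have 1: "vs ! j \<bullet> vs ! j = 1" using vs j by (simp add: orthonormal_list_def)
  then have "vs ! j \<noteq> 0\<^sub>v m" by auto
  then have "0 < vs ! j \<bullet> (M *\<^sub>v vs ! j)" using eigenbasis_carrier[OF j] by (intro pos)
  then show ?thesis using 1 eigenbasis_carrier[OF j] by (simp add: eig[OF j] scalar_prod_smult_distrib[of _ m])
qed

lemma eigenvalue_neq_0: "j < m \<Longrightarrow> l j \<noteq> 0"
  using eigenvalue_pos[of j] by simp

lemma quadratic_form_expand:
  "x \<in> carrier_vec m \<Longrightarrow> y \<in> carrier_vec m \<Longrightarrow>
    x \<bullet> (M *\<^sub>v y) = (\<Sum>j<m. l j * ((vs ! j \<bullet> x) * (vs ! j \<bullet> y)))"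
  by (rule eigenbasis_scalar_prod[OF M vs eig])

text \<open>The equality cases are expressed through the kernel of \<open>B\<close>:
  \<open>B v = 0\<close> means orthogonality to the row space, and orthogonality to the whole kernel
  means membership in it. The kernel survives the rotation from \<open>B\<close> to
  \<open>C\<close>.\<close>

lemma det_compression_ge:
  assumes B: "orthonormal_rows (m - p) m B"
  shows "(\<Prod>j=p..<m. l j) \<le> det (B * M * B\<^sup>T)"
    and "det (B * M * B\<^sup>T) = (\<Prod>j=p..<m. l j) \<Longrightarrow> j < m \<Longrightarrow> l p < l j \<Longrightarrow> B *\<^sub>v vs ! j = 0\<^sub>v (m - p)"
    and "det (B * M * B\<^sup>T) = (\<Prod>j=p..<m. l j) \<Longrightarrow> j < m \<Longrightarrow> l j < l p \<Longrightarrow>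
      x \<in> carrier_vec m \<Longrightarrow> B *\<^sub>v x = 0\<^sub>v (m - p) \<Longrightarrow> vs ! j \<bullet> x = 0"
proof -
  let ?n = "m - p"
  obtain C where C: "orthonormal_rows ?n m C"
    "\<And>i k. i < ?n \<Longrightarrow> k < ?n \<Longrightarrow> i \<noteq> k \<Longrightarrow> row C i \<bullet> (M *\<^sub>v row C k) = 0"
    "det (B * M * B\<^sup>T) = (\<Prod>i<?n. row C i \<bullet> (M *\<^sub>v row C i))"
    "\<And>x. x \<in> carrier_vec m \<Longrightarrow> C *\<^sub>v x = 0\<^sub>v ?n \<longleftrightarrow> B *\<^sub>v x = 0\<^sub>v ?n"
    by (rule compression_diagonalize[OF M B]) (rule that)
  note r = orthonormal_rows_row[OF C(1)]
  define w where "w j = (C *\<^sub>v vs ! j) \<bullet> (C *\<^sub>v vs ! j)" for j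
  note w = sum_norm_mult_basis[OF C(1) vs, folded w_def]
  \<comment> \<open>Jensen for a single row: the squared coordinates of a unit vector in the
    eigenbasis sum to 1, and they average the eigenvalues to its quadratic form.\<close>
  have ln: "ln (row C i \<bullet> (M *\<^sub>v row C i)) \<ge> (\<Sum>j<m. (row C i \<bullet> vs ! j)\<^sup>2 * ln (l j))" if i: "i < ?n" for i
  proof -
    have comm: "vs ! j \<bullet> row C i = row C i \<bullet> vs ! j" if "j < m" for j
      using eigenbasis_carrier[OF that] r(1)[OF i] by (rule comm_scalar_prod)
    have "(\<Sum>j<m. (row C i \<bullet> vs ! j)\<^sup>2) = 1"
      using orthonormal_basis_scalar_prod[OF vs r(1)[OF i] r(1)[OF i]] r(2)[OF i]
      by (simp add: comm power2_eq_square)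
    then have "(\<Sum>j<m. (row C i \<bullet> vs ! j)\<^sup>2 * ln (l j)) \<le> ln (\<Sum>j<m. (row C i \<bullet> vs ! j)\<^sup>2 * l j)"
      using eigenvalue_pos by (intro sum_weighted_ln_le) auto
    also have "(\<Sum>j<m. (row C i \<bullet> vs ! j)\<^sup>2 * l j) = row C i \<bullet> (M *\<^sub>v row C i)"
      unfolding quadratic_form_expand[OF r(1)[OF i] r(1)[OF i]]
      by (intro sum.cong) (auto simp: comm power2_eq_square)
    finally show ?thesis .
  qed
  have det: "0 < det (B * M * B\<^sup>T)" using B by (rule det_compression_pos)
  have prod: "0 < (\<Prod>j=p..<m. l j)" using eigenvalue_pos by (intro prod_pos) auto
  have lnprod: "ln (\<Prod>j=p..<m. l j) = (\<Sum>j=p..<m. ln (l j))"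
    using eigenvalue_neq_0 by (intro ln_prod) auto
  \<comment> \<open>Adding the row estimates and exchanging the sums gathers the coefficients of
    \<open>ln (l j)\<close> into the single weight \<open>w j\<close>.\<close>
  have "(\<Sum>j<m. w j * ln (l j)) = (\<Sum>i<?n. \<Sum>j<m. (row C i \<bullet> vs ! j)\<^sup>2 * ln (l j))"
    unfolding w(4) sum_distrib_right by (rule sum.swap)
  also have "\<dots> \<le> (\<Sum>i<?n. ln (row C i \<bullet> (M *\<^sub>v row C i)))"
    using ln by (intro sum_mono) auto
  also have "\<dots> = ln (det (B * M * B\<^sup>T))"
    unfolding C(3) by (intro ln_prod[symmetric]) (simp, metis r(3) lessThan_iff less_irrefl)
  finally have le: "(\<Sum>j<m. w j * ln (l j)) \<le> ln (det (B * M * B\<^sup>T))" .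
  have mono': "ln (l j) \<le> ln (l i)" if "i \<le> j" "j < m" for i j
    using mono[OF that] eigenvalue_pos that by simp
  have s: "(\<Sum>j<m. w j) = real m - real p" using w(1) p by simp
  note bottom = weighted_sum_ge_bottom[of p m "\<lambda>j. ln (l j)" w, OF p mono' w(2,3) s]
  have "ln (\<Prod>j=p..<m. l j) \<le> ln (det (B * M * B\<^sup>T))"
    using bottom(1) le lnprod by simp
  then show "(\<Prod>j=p..<m. l j) \<le> det (B * M * B\<^sup>T)"
    using det prod by simp
  assume "det (B * M * B\<^sup>T) = (\<Prod>j=p..<m. l j)" and j: "j < m"
  then have eq: "(\<Sum>j<m. w j * ln (l j)) = (\<Sum>j=p..<m. ln (l j))"
    using bottom(1) le lnprod by simp
  show "B *\<^sub>v vs ! j = 0\<^sub>v ?n" if "l p < l j"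
  proof -
    have "w j = 0" using that eq j p eigenvalue_pos by (intro bottom(2)) auto
    moreover have "C *\<^sub>v vs ! j \<in> carrier_vec ?n"
      using C(1) eigenbasis_carrier[OF j] by (auto simp: orthonormal_rows_def)
    ultimately have "C *\<^sub>v vs ! j = 0\<^sub>v ?n" by (simp add: w_def scalar_prod_self_eq_0)
    then show ?thesis using C(4)[OF eigenbasis_carrier[OF j]] by simp
  qed
  show "vs ! j \<bullet> x = 0" if "l j < l p" and x: "x \<in> carrier_vec m" "B *\<^sub>v x = 0\<^sub>v ?n"
  proof -
    \<comment> \<open>Weight 1 is the equality case of Bessel for the unit vector
      \<open>vs ! j\<close>.\<close>
    have "w j = 1" using that eq j p eigenvalue_pos by (intro bottom(3)) auto
    then show ?thesis
      using vs j x C(4)[OF x(1)]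
      by (intro bessel_inequality(2)[OF C(1) eigenbasis_carrier[OF j]])
        (simp_all add: w_def orthonormal_list_def)
  qed
qed

lemma det_compression_le:
  assumes B: "orthonormal_rows p m B"
  shows "det (B * M * B\<^sup>T) \<le> (\<Prod>j<p. l j)"
    and "det (B * M * B\<^sup>T) = (\<Prod>j<p. l j) \<Longrightarrow> j < m \<Longrightarrow> l j < l p \<Longrightarrow> B *\<^sub>v vs ! j = 0\<^sub>v p"
    and "det (B * M * B\<^sup>T) = (\<Prod>j<p. l j) \<Longrightarrow> j < m \<Longrightarrow> l p < l j \<Longrightarrow>
      x \<in> carrier_vec m \<Longrightarrow> B *\<^sub>v x = 0\<^sub>v p \<Longrightarrow> vs ! j \<bullet> x = 0"
proof -
  obtain C where C: "orthonormal_rows p m C"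
    "\<And>i k. i < p \<Longrightarrow> k < p \<Longrightarrow> i \<noteq> k \<Longrightarrow> row C i \<bullet> (M *\<^sub>v row C k) = 0"
    "det (B * M * B\<^sup>T) = (\<Prod>i<p. row C i \<bullet> (M *\<^sub>v row C i))"
    "\<And>x. x \<in> carrier_vec m \<Longrightarrow> C *\<^sub>v x = 0\<^sub>v p \<longleftrightarrow> B *\<^sub>v x = 0\<^sub>v p"
    by (rule compression_diagonalize[OF M B]) (rule that)
  note r = orthonormal_rows_row[OF C(1)]
  have Cc: "C \<in> carrier_mat p m" using C(1) by (simp add: orthonormal_rows_def)
  define \<nu> where "\<nu> i = row C i \<bullet> (M *\<^sub>v row C i)" for i
  have \<nu>: "0 < \<nu> i" if "i < p" for i using r(3)[OF that] by (simp add: \<nu>_def)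
  define c where "c i j = vs ! j \<bullet> row C i" for i j
  have comm: "row C i \<bullet> vs ! j = c i j" if "i < p" "j < m" for i j
    unfolding c_def using r(1)[OF that(1)] eigenbasis_carrier[OF that(2)] by (rule comm_scalar_prod)
  \<comment> \<open>In the coordinates \<open>vs\<close>, the rows of \<open>D\<close> are the vectors \<open>M\<^sup>1\<^sup>/\<^sup>2 (row C i)\<close>, normalised.  They are
    orthonormal and diagonalise \<open>M\<^sup>-\<^sup>1\<close> with values \<open>1 / \<nu> i\<close>, so concavity of \<open>ln\<close> now bounds \<open>\<nu> i\<close> from above.\<close>
  define D where "D = mat p m (\<lambda>(i, j). sqrt (l j) * c i j / sqrt (\<nu> i))"
  have Dc: "D \<in> carrier_mat p m" by (simp add: D_def)
  have "(\<Sum>j<m. D $$ (i, j) * D $$ (k, j)) = (if i = k then 1 else 0)" if ik: "i < p" "k < p" for i k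
  proof -
    have "(\<Sum>j<m. D $$ (i, j) * D $$ (k, j)) = (\<Sum>j<m. l j * (c i j * c k j)) / (sqrt (\<nu> i) * sqrt (\<nu> k))"
      unfolding sum_divide_distrib
    proof (intro sum.cong refl)
      fix j assume "j \<in> {..<m}"
      then have j: "j < m" by simp
      have "sqrt (l j) * sqrt (l j) = l j" using eigenvalue_pos[OF j] by simp
      then show "D $$ (i, j) * D $$ (k, j) = l j * (c i j * c k j) / (sqrt (\<nu> i) * sqrt (\<nu> k))"
        using ik j by (simp add: D_def mult.assoc mult.left_commute)
    qed
    also have "(\<Sum>j<m. l j * (c i j * c k j)) = row C i \<bullet> (M *\<^sub>v row C k)"
      unfolding c_def quadratic_form_expand[OF r(1)[OF ik(1)] r(1)[OF ik(2)]] ..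
    also have "\<dots> / (sqrt (\<nu> i) * sqrt (\<nu> k)) = (if i = k then 1 else 0)"
      using \<nu>[OF ik(1)] C(2)[OF ik] by (auto simp: \<nu>_def)
    finally show ?thesis .
  qed
  then have D: "orthonormal_rows p m D"
    using Dc by (auto simp: orthonormal_rows_def mat_eq_iff scalar_prod_def lessThan_atLeast0)
  \<comment> \<open>The columns of \<open>D\<close> already refer to the eigenbasis, so the standard
    unit vectors now play the part of \<open>vs\<close>.\<close>
  define es :: "real vec list" where "es = unit_vecs m"
  have es: "orthonormal_list m es" "length es = m" "\<And>j. j < m \<Longrightarrow> es ! j = unit_vec m j"
    by (auto simp: es_def orthonormal_list_def unit_vecs_def)
  define w where "w j = (D *\<^sub>v es ! j) \<bullet> (D *\<^sub>v es ! j)" for j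
  note w = sum_norm_mult_basis[OF D es(1,2), folded w_def]
  have Dunit: "row D i \<bullet> es ! j = D $$ (i, j)" if "i < p" "j < m" for i j
    using that Dc es(3) by simp
  have ln: "ln (\<nu> i) \<le> (\<Sum>j<m. (D $$ (i, j))\<^sup>2 * ln (l j))" if i: "i < p" for i
  proof -
    have "(\<Sum>j<m. (D $$ (i, j))\<^sup>2) = 1"
      using orthonormal_rows_row(2)[OF D i] Dc i
      by (simp add: scalar_prod_def lessThan_atLeast0 power2_eq_square)
    then have "(\<Sum>j<m. (D $$ (i, j))\<^sup>2 * ln (1 / l j)) \<le> ln (\<Sum>j<m. (D $$ (i, j))\<^sup>2 * (1 / l j))"
      using eigenvalue_pos by (intro sum_weighted_ln_le) auto
    \<comment> \<open>The factor \<open>l j\<close> inside the squared entry cancels, leaving the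
      squared norm of \<open>row C i\<close>, which is 1, over \<open>\<nu> i\<close>.\<close>
    also have "(\<Sum>j<m. (D $$ (i, j))\<^sup>2 * (1 / l j)) = (\<Sum>j<m. c i j * c i j) / \<nu> i"
      unfolding sum_divide_distrib
    proof (intro sum.cong refl)
      fix j assume "j \<in> {..<m}"
      then have "0 < l j" "j < m" using eigenvalue_pos by auto
      then show "(D $$ (i, j))\<^sup>2 * (1 / l j) = c i j * c i j / \<nu> i"
        using i \<nu>[OF i] by (simp add: D_def power_divide power_mult_distrib) (simp add: power2_eq_square)
    qed
    also have "(\<Sum>j<m. c i j * c i j) = 1"
      using orthonormal_basis_scalar_prod[OF vs r(1)[OF i] r(1)[OF i]] r(2)[OF i] by (simp add: c_def)
    finally have "(\<Sum>j<m. (D $$ (i, j))\<^sup>2 * ln (1 / l j)) \<le> ln (1 / \<nu> i)" .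
    moreover have "(\<Sum>j<m. (D $$ (i, j))\<^sup>2 * ln (1 / l j)) = - (\<Sum>j<m. (D $$ (i, j))\<^sup>2 * ln (l j))"
      unfolding sum_negf[symmetric] using eigenvalue_pos by (intro sum.cong) (auto simp: ln_div)
    ultimately show ?thesis using \<nu>[OF i] by (simp add: ln_div)
  qed
  have det: "0 < det (B * M * B\<^sup>T)" using B by (rule det_compression_pos)
  have prod: "0 < (\<Prod>j<p. l j)" using eigenvalue_pos p by (intro prod_pos) auto
  have lnprod: "ln (\<Prod>j<p. l j) = (\<Sum>j<p. ln (l j))"
    using eigenvalue_neq_0 p by (intro ln_prod) auto
  have "ln (det (B * M * B\<^sup>T)) = (\<Sum>i<p. ln (\<nu> i))"
    unfolding C(3) \<nu>_def by (intro ln_prod) (simp, metis r(3) lessThan_iff less_irrefl)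
  also have "\<dots> \<le> (\<Sum>i<p. \<Sum>j<m. (D $$ (i, j))\<^sup>2 * ln (l j))"
    using ln by (intro sum_mono) auto
  also have "\<dots> = (\<Sum>j<m. w j * ln (l j))"
    unfolding w(4) sum_distrib_right
    by (subst sum.swap) (auto intro!: sum.cong simp: Dunit)
  finally have le: "ln (det (B * M * B\<^sup>T)) \<le> (\<Sum>j<m. w j * ln (l j))" .
  have mono': "ln (l j) \<le> ln (l i)" if "i \<le> j" "j < m" for i j
    using mono[OF that] eigenvalue_pos that by simp
  note top = weighted_sum_le_top[of p m "\<lambda>j. ln (l j)" w, OF p mono' w(2,3,1)]
  have "ln (det (B * M * B\<^sup>T)) \<le> ln (\<Prod>j<p. l j)"
    using top(1) le lnprod by simp
  then show "det (B * M * B\<^sup>T) \<le> (\<Prod>j<p. l j)"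
    using det prod by simp
  assume "det (B * M * B\<^sup>T) = (\<Prod>j<p. l j)" and j: "j < m"
  then have eq: "(\<Sum>j<m. w j * ln (l j)) = (\<Sum>j<p. ln (l j))"
    using top(1) le lnprod by simp
  show "B *\<^sub>v vs ! j = 0\<^sub>v p" if "l j < l p"
  proof -
    have "w j = 0" using that eq j p eigenvalue_pos by (intro top(3)) auto
    then have "\<forall>i<p. (row D i \<bullet> es ! j)\<^sup>2 = 0"
      unfolding w(4) by (subst (asm) sum_nonneg_eq_0_iff) auto
    then have D0: "D $$ (i, j) = 0" if "i < p" for i
      using that Dunit[OF that j] by simp
    have "c i j = 0" if i: "i < p" for i
      using D0[OF i] i j \<nu>[OF i] eigenvalue_pos[OF j] by (simp add: D_def)
    then have "C *\<^sub>v vs ! j = 0\<^sub>v p"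
      using Cc comm[OF _ j] by (intro eq_vecI) simp_all
    then show ?thesis using C(4)[OF eigenbasis_carrier[OF j]] by simp
  qed
  show "vs ! j \<bullet> x = 0" if "l p < l j" and x: "x \<in> carrier_vec m" "B *\<^sub>v x = 0\<^sub>v p"
  proof -
    have wj: "w j = 1" using that eq j p eigenvalue_pos by (intro top(2)) auto
    \<comment> \<open>\<open>y\<close> holds the eigenbasis coordinates of
      \<open>M\<^sup>-\<^sup>1\<^sup>/\<^sup>2 x\<close>. The square roots cancel in
      \<open>D y\<close>, which is \<open>C x\<close> up to the row factors
      \<open>1 / sqrt (\<nu> i)\<close>, so \<open>x\<close> in the kernel of \<open>C\<close> gives
      \<open>y\<close> in the kernel of \<open>D\<close>.\<close>
    define y where "y = vec m (\<lambda>k. (vs ! k \<bullet> x) / sqrt (l k))"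
    have "(D *\<^sub>v y) $ i = 0" if i: "i < p" for i
    proof -
      have "(D *\<^sub>v y) $ i = (\<Sum>k<m. D $$ (i, k) * y $ k)"
        using Dc i by (simp add: y_def scalar_prod_def lessThan_atLeast0)
      also have "\<dots> = (\<Sum>k<m. c i k * (vs ! k \<bullet> x)) / sqrt (\<nu> i)"
        unfolding sum_divide_distrib using eigenvalue_pos i
        by (intro sum.cong) (auto simp: D_def y_def less_imp_neq[symmetric])
      also have "(\<Sum>k<m. c i k * (vs ! k \<bullet> x)) = row C i \<bullet> x"
        using orthonormal_basis_scalar_prod[OF vs r(1)[OF i] x(1)] by (simp add: c_def)
      also have "\<dots> = (C *\<^sub>v x) $ i" using Cc i by simp
      also have "\<dots> = 0" using C(4)[OF x(1)] x(2) i by simp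
      finally show ?thesis by simp
    qed
    then have "D *\<^sub>v y = 0\<^sub>v p" using Dc by (intro eq_vecI) auto
    then have "es ! j \<bullet> y = 0"
      using j es wj by (intro bessel_inequality(2)[OF D]) (auto simp: w_def y_def)
    then show ?thesis
      using j es(3)[OF j] eigenvalue_pos[OF j] by (simp add: y_def)
  qed
qed

end

section \<open>Triangular change of variables\<close>

text \<open>Gram-Schmidt for vectors that may be dependent: if \<open>r n\<close> adds nothing new,
  an arbitrary orthonormal direction is appended, for which \<open>n \<le> k\<close> leaves
  room.\<close>

lemma ex_orthonormal_flag:
  fixes r :: "nat \<Rightarrow> real vec"
  assumes "n \<le> k" and "\<And>i. i < n \<Longrightarrow> r i \<in> carrier_vec k"
  shows "\<exists>us. orthonormal_list k us \<and> length us = n \<and> (\<forall>i<n. r i \<in> vec_span k (set (take (Suc i) us)))"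
  using assms
proof (induction n)
  case 0
  then show ?case by (auto simp: orthonormal_list_def)
next
  case (Suc n)
  then obtain us where us: "orthonormal_list k us" "length us = n"
    "\<And>i. i < n \<Longrightarrow> r i \<in> vec_span k (set (take (Suc i) us))"
    by auto
  have rn: "r n \<in> carrier_vec k" using Suc.prems by simp
  have uc: "set us \<subseteq> carrier_vec k" using us(1) by (simp add: orthonormal_list_def)
  have "\<exists>u. orthonormal_list k (us @ [u]) \<and> r n \<in> vec_span k (set (us @ [u]))"
  proof (cases "r n \<in> vec_span k (set us)")
    case True
    obtain ws where ws: "orthonormal_list k (us @ ws)" "length (us @ ws) = k"
      using orthonormal_list_extend[OF us(1)] by blast
    then obtain u ws' where "ws = u # ws'" using us(2) Suc.prems(1) by (cases ws) auto
    then have o: "orthonormal_list k (us @ [u])"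
      using ws(1) orthonormal_list_append_iff[of k "us @ [u]" ws'] by simp
    then have "vec_subspace k (vec_span k (set (us @ [u])))"
      by (intro vec_subspace_span) (simp add: orthonormal_list_def)
    moreover have "set us \<subseteq> vec_span k (set (us @ [u]))"
      using orthonormal_list_subset_span[OF o] by simp
    ultimately have "r n \<in> vec_span k (set (us @ [u]))"
      using True vec_span_subset_subspace by blast
    with o show ?thesis by blast
  next
    case False
    have "vec_subspace k (carrier_vec k)" by (rule vec_subspaceI) auto
    then obtain x w where x: "x \<in> carrier_vec k" "w \<in> vec_span k (set us)" "x \<noteq> 0\<^sub>v k"
      "\<forall>v\<in>set us. v \<bullet> x = 0" "r n = w + x"
      using ex_orthogonal_residual[OF _ us(1) uc rn False] by blast
    let ?u = "(1 / sqrt (x \<bullet> x)) \<cdot>\<^sub>v x"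
    have o: "orthonormal_list k (us @ [?u])"
      using us x by (intro orthonormal_list_append1) auto
    then have sub: "vec_subspace k (vec_span k (set (us @ [?u])))"
      by (intro vec_subspace_span) (simp add: orthonormal_list_def)
    have in_span: "set us \<subseteq> vec_span k (set (us @ [?u]))" "?u \<in> vec_span k (set (us @ [?u]))"
      using orthonormal_list_subset_span[OF o] by simp_all
    have "w \<in> vec_span k (set (us @ [?u]))"
      using x(2) vec_span_subset_subspace[OF sub in_span(1)] by blast
    moreover have "x = sqrt (x \<bullet> x) \<cdot>\<^sub>v ?u"
      using scalar_prod_self_pos[OF x(1,3)] by (simp add: smult_smult_assoc)
    then have "x \<in> vec_span k (set (us @ [?u]))"
      using vec_subspace_closed(3)[OF sub in_span(2)] by metis
    ultimately have "r n \<in> vec_span k (set (us @ [?u]))"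
      unfolding x(5) by (rule vec_subspace_closed(2)[OF sub])
    with o show ?thesis by blast
  qed
  then obtain u where u: "orthonormal_list k (us @ [u])" "r n \<in> vec_span k (set (us @ [u]))"
    by blast
  have "r i \<in> vec_span k (set (take (Suc i) (us @ [u])))" if "i < Suc n" for i
  proof (cases "i = n")
    case False
    with that us show ?thesis by simp
  qed (use u us(2) in simp)
  with u us(2) show ?case by (intro exI[of _ "us @ [u]"]) auto
qed

text \<open>LQ factorisation. Row \<open>i\<close> of \<open>R\<close> lies in the span of the first
  \<open>i + 1\<close> vectors of the flag, so its coordinates \<open>L = R U\<^sup>T\<close> vanish
  above the diagonal. The condition \<open>inj\<close> says that the rows of \<open>R\<close> are
  independent; it forces \<open>n \<le> k\<close> and makes \<open>L\<close> nonsingular.\<close>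

lemma lower_triangular_orthonormal_decomposition:
  fixes R :: "real mat"
  assumes R: "R \<in> carrier_mat n k"
    and inj: "\<And>y. y \<in> carrier_vec n \<Longrightarrow> R\<^sup>T *\<^sub>v y = 0\<^sub>v k \<Longrightarrow> y = 0\<^sub>v n"
  obtains L us where "L \<in> carrier_mat n n" "orthonormal_list k us" "length us = n"
    "R = L * mat_of_rows k us" "\<And>i j. i < j \<Longrightarrow> j < n \<Longrightarrow> L $$ (i, j) = 0" "det L \<noteq> 0"
proof -
  have "n \<le> k"
  proof (rule ccontr)
    assume "\<not> n \<le> k"
    then obtain v where "v \<in> carrier_vec n" "v \<noteq> 0\<^sub>v n" "R\<^sup>T *\<^sub>v v = 0\<^sub>v k"
      using ex_kernel_vec[of "R\<^sup>T" k n] R by auto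
    with inj show False by blast
  qed
  then obtain us where us: "orthonormal_list k us" "length us = n"
    "\<And>i. i < n \<Longrightarrow> row R i \<in> vec_span k (set (take (Suc i) us))"
    using ex_orthonormal_flag[of n k "row R"] R by auto
  define U where "U = mat_of_rows k us"
  define L where "L = R * U\<^sup>T"
  have U: "orthonormal_rows n k U" using orthonormal_rows_mat_of_rows[OF us(1)] us(2) by (simp add: U_def)
  then have Uc: "U \<in> carrier_mat n k" by (simp add: orthonormal_rows_def)
  have Lc: "L \<in> carrier_mat n n" unfolding L_def using R Uc by auto
  have uc: "us ! j \<in> carrier_vec k" if "j < n" for j
    using us that by (auto simp: orthonormal_list_def)
  have rowU: "row U j = us ! j" if "j < n" for j
    unfolding U_def using us(2) uc that by (intro mat_of_rows_row) auto
  have rc: "row R i \<in> carrier_vec k" if "i < n" for i using R that by simp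
  have L0: "L $$ (i, j) = 0" if ij: "i < j" "j < n" for i j
  proof -
    have "us = take (Suc i) us @ drop (Suc i) us" by simp
    then have *: "\<forall>u\<in>set (take (Suc i) us). \<forall>w\<in>set (drop (Suc i) us). u \<bullet> w = 0"
      using us(1) orthonormal_list_append_iff[of k "take (Suc i) us" "drop (Suc i) us"] by simp
    have "us ! j \<in> set (drop (Suc i) us)"
      using nth_mem[of "j - Suc i" "drop (Suc i) us"] ij us(2) by simp
    moreover have "set (take (Suc i) us) \<subseteq> carrier_vec k"
      using us(1) set_take_subset[of "Suc i" us] by (auto simp: orthonormal_list_def)
    ultimately have "row R i \<bullet> us ! j = 0"
      using us(3)[of i] uc[OF ij(2)] * less_trans[OF ij] by (blast intro: scalar_prod_span_eq_0[of "set (take (Suc i) us)" k "us ! j" "row R i"])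
    then show ?thesis
      using ij R Uc rowU by (simp add: L_def)
  qed
  have RLU: "R = L * U"
  proof (rule eq_rowI)
    fix i assume "i < dim_row (L * U)"
    then have i: "i < n" using Lc by simp
    have "set (take (Suc i) us) \<subseteq> vec_span k (set us)"
      using orthonormal_list_subset_span[OF us(1)] set_take_subset[of "Suc i" us] by blast
    moreover have "vec_subspace k (vec_span k (set us))"
      using us(1) by (intro vec_subspace_span) (simp add: orthonormal_list_def)
    ultimately have "row R i \<in> vec_span k (set us)"
      using us(3)[OF i] vec_span_subset_subspace by blast
    then have *: "U\<^sup>T *\<^sub>v (U *\<^sub>v row R i) = row R i"
      using in_vec_span_orthonormal_iff[OF us(1)] by (simp add: U_def)
    have "row (L * U) i = U\<^sup>T *\<^sub>v row L i"
      using Lc Uc i by (intro eq_vecI) (auto simp: comm_scalar_prod[of _ n])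
    also have "row L i = U *\<^sub>v row R i"
      unfolding L_def using R Uc i by (intro eq_vecI) (auto simp: comm_scalar_prod[of _ k])
    finally show "row R i = row (L * U) i" using * by simp
  qed (use R Lc Uc in auto)
  have "det L\<^sup>T \<noteq> 0"
  proof
    assume "det L\<^sup>T = 0"
    then obtain v where v: "v \<in> carrier_vec n" "v \<noteq> 0\<^sub>v n" "L\<^sup>T *\<^sub>v v = 0\<^sub>v n"
      using Lc det_0_iff_vec_prod_zero[of "L\<^sup>T" n] by auto
    have "R\<^sup>T *\<^sub>v v = (U\<^sup>T * L\<^sup>T) *\<^sub>v v"
      unfolding RLU using Lc Uc by (subst transpose_mult[of _ n n _ k]) auto
    also have "\<dots> = U\<^sup>T *\<^sub>v (L\<^sup>T *\<^sub>v v)"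
      using Lc Uc v by (intro assoc_mult_mat_vec) auto
    also have "\<dots> = 0\<^sub>v k" unfolding v(3) using Uc by (intro mult_mat_zero_vec) auto
    finally show False using inj v by blast
  qed
  then have "det L \<noteq> 0" using Lc by (simp add: det_transpose)
  with that[of L us] Lc us RLU L0 show ?thesis by (simp add: U_def)
qed

text \<open>
  Here \<open>f\<close> is arbitrary: depth functions are not assumed measurable, and the lower integral of a
  non-measurable function is still compatible with a bimeasurable bijection.
\<close>

lemma nn_integral_bij_scaled:
  assumes T: "T \<in> M \<rightarrow>\<^sub>M M" and S: "S \<in> M \<rightarrow>\<^sub>M M"
    and TS: "\<And>x. x \<in> space M \<Longrightarrow> T (S x) = x" and ST: "\<And>x. x \<in> space M \<Longrightarrow> S (T x) = x"
    and c: "0 < c" and scale: "\<And>g. g \<in> borel_measurable M \<Longrightarrow> (\<integral>\<^sup>+x. g x \<partial>M) = ennreal c * (\<integral>\<^sup>+x. g (T x) \<partial>M)"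
  shows "(\<integral>\<^sup>+x. f x \<partial>M) = ennreal c * (\<integral>\<^sup>+x. f (T x) \<partial>M)"
proof -
  \<comment> \<open>Half of the claim for arbitrary \<open>h\<close>: a simple function below
    \<open>h\<close> is measurable and obeys the scaling rule, and its composition with
    \<open>R\<close> stays below that of \<open>h\<close>.\<close>
  have le: "(\<integral>\<^sup>+x. h x \<partial>M) \<le> ennreal a * (\<integral>\<^sup>+x. h (R x) \<partial>M)"
    if "\<And>g. g \<in> borel_measurable M \<Longrightarrow> (\<integral>\<^sup>+x. g x \<partial>M) = ennreal a * (\<integral>\<^sup>+x. g (R x) \<partial>M)"
    for a R and h :: "_ \<Rightarrow> ennreal"
    unfolding nn_integral_def[of M h]
  proof (rule SUP_least, clarify)
    fix g assume g: "simple_function M g" "g \<le> h"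
    have "integral\<^sup>S M g = (\<integral>\<^sup>+x. g x \<partial>M)" using g(1) by (rule nn_integral_eq_simple_integral[symmetric])
    also have "\<dots> = ennreal a * (\<integral>\<^sup>+x. g (R x) \<partial>M)"
      using g(1) by (intro that borel_measurable_simple_function)
    also have "\<dots> \<le> ennreal a * (\<integral>\<^sup>+x. h (R x) \<partial>M)"
      using g(2) by (intro mult_left_mono nn_integral_mono) (auto simp: le_fun_def)
    finally show "integral\<^sup>S M g \<le> ennreal a * (\<integral>\<^sup>+x. h (R x) \<partial>M)" .
  qed
  have inv: "ennreal c * (ennreal (1 / c) * t) = t" "ennreal (1 / c) * (ennreal c * t) = t" for t
    using c by (simp_all add: mult.assoc[symmetric] ennreal_mult[symmetric])
  \<comment> \<open>The inverse map obeys the scaling rule with factor \<open>1 / c\<close>, so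
    \<open>le\<close> applies to it as well and yields the opposite inequality.\<close>
  have "(\<integral>\<^sup>+x. g x \<partial>M) = ennreal (1 / c) * (\<integral>\<^sup>+x. g (S x) \<partial>M)" if g: "g \<in> borel_measurable M" for g
  proof -
    have "(\<integral>\<^sup>+x. g (S x) \<partial>M) = ennreal c * (\<integral>\<^sup>+x. g (S (T x)) \<partial>M)"
      using measurable_compose[OF S g] by (rule scale)
    also have "(\<integral>\<^sup>+x. g (S (T x)) \<partial>M) = (\<integral>\<^sup>+x. g x \<partial>M)"
      using ST by (intro nn_integral_cong) simp
    finally show ?thesis by (simp add: inv)
  qed
  from le[of "1 / c" S "\<lambda>x. f (T x)", OF this]
  have "(\<integral>\<^sup>+x. f (T x) \<partial>M) \<le> ennreal (1 / c) * (\<integral>\<^sup>+x. f (T (S x)) \<partial>M)" .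
  also have "(\<integral>\<^sup>+x. f (T (S x)) \<partial>M) = (\<integral>\<^sup>+x. f x \<partial>M)"
    using TS by (intro nn_integral_cong) simp
  finally have "ennreal c * (\<integral>\<^sup>+x. f (T x) \<partial>M) \<le> ennreal c * (ennreal (1 / c) * (\<integral>\<^sup>+x. f x \<partial>M))"
    by (intro mult_left_mono) auto
  then have "ennreal c * (\<integral>\<^sup>+x. f (T x) \<partial>M) \<le> (\<integral>\<^sup>+x. f x \<partial>M)" by (simp add: inv)
  moreover have "(\<integral>\<^sup>+x. f x \<partial>M) \<le> ennreal c * (\<integral>\<^sup>+x. f (T x) \<partial>M)"
    using scale by (rule le)
  ultimately show ?thesis by (rule antisym[rotated])
qed

section \<open>Lebesgue measure under triangular affine maps\<close>

lemma nn_integral_lborel_vec: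
  assumes "f \<in> borel_measurable (lborel_vec k)"
  shows "(\<integral>\<^sup>+x. f x \<partial>lborel_vec k) = (\<integral>\<^sup>+g. f (vec k g) \<partial>(\<Pi>\<^sub>M i\<in>{..<k}. lborel))"
  using assms inj_on_vec unfolding lborel_vec_def by (intro nn_integral_embed_measure')

interpretation lborel_product: product_sigma_finite "\<lambda>_ :: nat. lborel :: real measure"
  by (simp add: product_sigma_finite_def sigma_finite_lborel)

text \<open>Fubini splits off the last coordinate. Triangularity means that the rows before it do
  not see this coordinate, while in its own row the earlier coordinates only produce a translation,
  so the substitution is one-dimensional.\<close>

lemma nn_integral_PiM_triangular:
  fixes L :: "nat \<Rightarrow> nat \<Rightarrow> real" and b :: "nat \<Rightarrow> real"
  assumes "\<And>i. i < k \<Longrightarrow> L i i \<noteq> 0" and "f \<in> borel_measurable (\<Pi>\<^sub>M i\<in>{..<k}. lborel)"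
  shows "(\<integral>\<^sup>+g. f g \<partial>(\<Pi>\<^sub>M i\<in>{..<k}. lborel)) =
    ennreal (\<Prod>i<k. \<bar>L i i\<bar>) *
      (\<integral>\<^sup>+g. f (\<lambda>i\<in>{..<k}. b i + (\<Sum>j<Suc i. L i j * g j)) \<partial>(\<Pi>\<^sub>M i\<in>{..<k}. lborel))"
  using assms
proof (induction k arbitrary: f)
  case 0
  \<comment> \<open>The empty product space has one point, the constant \<open>undefined\<close>;
    both sides evaluate \<open>f\<close> there.\<close>
  have eq: "(\<lambda>i\<in>{}. b i + (\<Sum>j<Suc i. L i j * g j)) = (\<lambda>_. undefined)" for g by auto
  show ?case
    by (simp only: lessThan_0 eq lborel_product.nn_integral_empty[OF zero_le]) simp
next
  case (Suc k)
  let ?P = "\<lambda>k. \<Pi>\<^sub>M i\<in>{..<k}. (lborel :: real measure)"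
  let ?A = "\<lambda>k g. \<lambda>i\<in>{..<k}. b i + (\<Sum>j<Suc i. L i j * g j)"
  have ins: "insert k {..<k} = {..<Suc k}" by auto
  have f: "f \<in> borel_measurable (\<Pi>\<^sub>M i\<in>insert k {..<k}. lborel)" using Suc.prems(2) by (simp add: ins)
  have A: "?A k \<in> ?P k \<rightarrow>\<^sub>M ?P k" for k
    by (intro measurable_restrict) (auto intro!: borel_measurable_add borel_measurable_sum borel_measurable_times
        borel_measurable_const simp: measurable_component_singleton)
  have split: "(\<integral>\<^sup>+g. h g \<partial>?P (Suc k)) = (\<integral>\<^sup>+x. \<integral>\<^sup>+y. h (x(k := y)) \<partial>lborel \<partial>?P k)"
    if "h \<in> borel_measurable (?P (Suc k))" for h
    using lborel_product.product_nn_integral_insert[of "{..<k}" k h] that by (simp add: ins)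
  have upd: "(\<lambda>(x, y). x(k := y)) \<in> ?P k \<Otimes>\<^sub>M lborel \<rightarrow>\<^sub>M ?P (Suc k)"
    using measurable_add_dim[of k "{..<k}" "\<lambda>_. lborel"] by (simp add: ins)
  have updx: "(\<lambda>y. x(k := y)) \<in> borel \<rightarrow>\<^sub>M ?P (Suc k)" if "x \<in> space (?P k)" for x
    using measurable_compose[OF measurable_Pair1'[OF that] upd] by simp
  define H where "H x = (\<integral>\<^sup>+y. f (x(k := y)) \<partial>lborel)" for x
  have H: "H \<in> borel_measurable (?P k)"
    unfolding H_def using measurable_compose[OF upd Suc.prems(2)]
    by (intro lborel.borel_measurable_nn_integral) (simp add: case_prod_beta' fun_upd_def)
  have inner: "(\<integral>\<^sup>+y. f (?A (Suc k) (x(k := y))) \<partial>lborel) = ennreal (1 / \<bar>L k k\<bar>) * H (?A k x)"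
    if x: "x \<in> space (?P k)" for x
  proof -
    \<comment> \<open>With the earlier coordinates fixed, the last row maps \<open>y\<close> to
      \<open>?t + L k k * y\<close>.\<close>
    let ?t = "b k + (\<Sum>j<k. L k j * x j)"
    have "?A (Suc k) (x(k := y)) = (?A k x)(k := ?t + L k k * y)" for y
      by (auto simp: fun_eq_iff less_Suc_eq intro!: sum.cong)
    moreover have "?A k x \<in> space (?P k)" using measurable_space[OF A x] .
    then have "(\<lambda>y. f ((?A k x)(k := y))) \<in> borel_measurable borel"
      using measurable_compose[OF updx Suc.prems(2)] by blast
    then have "H (?A k x) = ennreal \<bar>L k k\<bar> * (\<integral>\<^sup>+y. f ((?A k x)(k := ?t + L k k * y)) \<partial>lborel)"
      unfolding H_def using Suc.prems(1) by (intro nn_integral_real_affine) auto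
    ultimately show ?thesis
      using Suc.prems(1)[of k] by (simp add: mult.assoc[symmetric] ennreal_mult[symmetric])
  qed
  have "(\<integral>\<^sup>+g. f g \<partial>?P (Suc k)) = (\<integral>\<^sup>+x. H x \<partial>?P k)"
    unfolding H_def using Suc.prems(2) by (rule split)
  also have "\<dots> = ennreal (\<Prod>i<k. \<bar>L i i\<bar>) * (\<integral>\<^sup>+x. H (?A k x) \<partial>?P k)"
    using Suc.prems(1) H by (intro Suc.IH) auto
  \<comment> \<open>The new diagonal factor is introduced together with its reciprocal, which
    \<open>inner\<close> then absorbs.\<close>
  also have "\<dots> = ennreal (\<Prod>i<Suc k. \<bar>L i i\<bar>) * (ennreal (1 / \<bar>L k k\<bar>) * (\<integral>\<^sup>+x. H (?A k x) \<partial>?P k))"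
    using Suc.prems(1)[of k]
    by (simp add: mult.assoc[symmetric] ennreal_mult[symmetric] prod_nonneg)
  also have "ennreal (1 / \<bar>L k k\<bar>) * (\<integral>\<^sup>+x. H (?A k x) \<partial>?P k)
      = (\<integral>\<^sup>+x. ennreal (1 / \<bar>L k k\<bar>) * H (?A k x) \<partial>?P k)"
    using measurable_compose[OF A H] by (intro nn_integral_cmult[symmetric])
  also have "\<dots> = (\<integral>\<^sup>+x. \<integral>\<^sup>+y. f (?A (Suc k) (x(k := y))) \<partial>lborel \<partial>?P k)"
    using inner by (intro nn_integral_cong) simp
  also have "\<dots> = (\<integral>\<^sup>+g. f (?A (Suc k) g) \<partial>?P (Suc k))"
    using measurable_compose[OF A Suc.prems(2)] by (rule split[symmetric])
  finally show ?case .
qed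

lemma det_lower_triangular_prod:
  fixes L :: "real mat"
  assumes "L \<in> carrier_mat n n" "\<And>i j. i < j \<Longrightarrow> j < n \<Longrightarrow> L $$ (i, j) = 0"
  shows "det L = (\<Prod>i<n. L $$ (i, i))"
  using det_lower_triangular[OF assms(2,1)] assms(1) by (simp add: prod_list_diag_prod lessThan_atLeast0)

lemma nn_integral_lborel_vec_triangular:
  fixes f :: "real vec \<Rightarrow> ennreal"
  assumes L: "L \<in> carrier_mat n n" "\<And>i j. i < j \<Longrightarrow> j < n \<Longrightarrow> L $$ (i, j) = 0" "det L \<noteq> 0"
    and b: "b \<in> carrier_vec n"
  shows "(\<integral>\<^sup>+x. f x \<partial>lborel_vec n) = ennreal \<bar>det L\<bar> * (\<integral>\<^sup>+x. f (L *\<^sub>v x + b) \<partial>lborel_vec n)"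
proof -
  have det: "det L = (\<Prod>i<n. L $$ (i, i))" using L(1,2) by (rule det_lower_triangular_prod)
  then have diag: "L $$ (i, i) \<noteq> 0" if "i < n" for i
    using L(3) that by auto
  obtain N where N: "N \<in> carrier_mat n n" "L * N = 1\<^sub>m n" "N * L = 1\<^sub>m n"
    using det_non_zero_imp_unit[OF L(1,3)] L(1)
    by (auto simp: Units_def ring_mat_def)
  have Nb: "- (N *\<^sub>v b) \<in> carrier_vec n" using N b by auto
  show ?thesis
  proof (rule nn_integral_bij_scaled[where S = "\<lambda>x. N *\<^sub>v x + - (N *\<^sub>v b)"])
    show "(\<lambda>x. L *\<^sub>v x + b) \<in> lborel_vec n \<rightarrow>\<^sub>M lborel_vec n" using L(1) b by (rule measurable_affine)
    show "(\<lambda>x. N *\<^sub>v x + - (N *\<^sub>v b)) \<in> lborel_vec n \<rightarrow>\<^sub>M lborel_vec n" using N(1) Nb by (rule measurable_affine)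
    show "0 < \<bar>det L\<bar>" using L(3) by simp
  next
    fix x :: "real vec" assume "x \<in> space (lborel_vec n)"
    then have x: "x \<in> carrier_vec n" by simp
    have NNb: "L *\<^sub>v (N *\<^sub>v y) = y" "N *\<^sub>v (L *\<^sub>v y) = y" if "y \<in> carrier_vec n" for y
      using L(1) N that by (simp_all add: assoc_mult_mat_vec[symmetric, of _ n n _ n])
    have m: "L *\<^sub>v (- (N *\<^sub>v b)) = - b"
    proof -
      have "- (N *\<^sub>v b) = (-1) \<cdot>\<^sub>v (N *\<^sub>v b)" by (auto simp: vec_eq_iff)
      then have "L *\<^sub>v (- (N *\<^sub>v b)) = (-1) \<cdot>\<^sub>v (L *\<^sub>v (N *\<^sub>v b))"
        using mult_mat_vec[OF L(1), of "N *\<^sub>v b" "-1"] N(1) b by simp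
      then show ?thesis unfolding NNb(1)[OF b] by (auto simp: vec_eq_iff)
    qed
    have "L *\<^sub>v (N *\<^sub>v x + - (N *\<^sub>v b)) = x + - b"
      using L(1) N(1) x b Nb NNb(1)[OF x] m by (subst mult_add_distrib_mat_vec[of _ n n]) auto
    then show "L *\<^sub>v (N *\<^sub>v x + - (N *\<^sub>v b)) + b = x"
      using x b by (auto simp: vec_eq_iff)
    have "N *\<^sub>v (L *\<^sub>v x + b) = x + N *\<^sub>v b"
      using L(1) N(1) x b NNb(2)[OF x] by (subst mult_add_distrib_mat_vec[of _ n n]) auto
    then show "N *\<^sub>v (L *\<^sub>v x + b) + - (N *\<^sub>v b) = x"
      using x b N(1) by (auto simp: vec_eq_iff)
  next
    fix g :: "real vec \<Rightarrow> ennreal" assume g: "g \<in> borel_measurable (lborel_vec n)"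
    let ?P = "\<Pi>\<^sub>M i\<in>{..<n}. (lborel :: real measure)"
    let ?A = "\<lambda>h. \<lambda>i\<in>{..<n}. b $ i + (\<Sum>j<Suc i. L $$ (i, j) * h j)"
    have vm: "vec n \<in> ?P \<rightarrow>\<^sub>M lborel_vec n"
      unfolding lborel_vec_def by (rule measurable_embed_measure2'[OF inj_on_vec])
    have "(\<integral>\<^sup>+x. g x \<partial>lborel_vec n) = (\<integral>\<^sup>+h. g (vec n h) \<partial>?P)"
      using g by (rule nn_integral_lborel_vec)
    also have "\<dots> = ennreal (\<Prod>i<n. \<bar>L $$ (i, i)\<bar>) * (\<integral>\<^sup>+h. g (vec n (?A h)) \<partial>?P)"
      using diag measurable_compose[OF vm g] by (intro nn_integral_PiM_triangular[where L = "\<lambda>i j. L $$ (i, j)"]) auto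
    also have "(\<Prod>i<n. \<bar>L $$ (i, i)\<bar>) = \<bar>det L\<bar>" unfolding det by (simp add: abs_prod)
    also have "(\<integral>\<^sup>+h. g (vec n (?A h)) \<partial>?P) = (\<integral>\<^sup>+h. g (L *\<^sub>v vec n h + b) \<partial>?P)"
    proof (rule nn_integral_cong)
      fix h
      have "vec n (?A h) = L *\<^sub>v vec n h + b"
      proof (rule eq_vecI)
        fix i assume "i < dim_vec (L *\<^sub>v vec n h + b)"
        then have i: "i < n" using b by simp
        have "(\<Sum>j<n. L $$ (i, j) * h j) = (\<Sum>j<Suc i. L $$ (i, j) * h j)"
          using L(2)[of i] i by (intro sum.mono_neutral_right) auto
        then show "vec n (?A h) $ i = (L *\<^sub>v vec n h + b) $ i"
          using i L(1) b by (simp add: scalar_prod_def lessThan_atLeast0)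
      qed (use b in auto)
      then show "g (vec n (?A h)) = g (L *\<^sub>v vec n h + b)" by simp
    qed
    also have "\<dots> = (\<integral>\<^sup>+x. g (L *\<^sub>v x + b) \<partial>lborel_vec n)"
      using measurable_compose[OF measurable_affine[OF L(1) b] g] by (rule nn_integral_lborel_vec[symmetric])
    finally show "(\<integral>\<^sup>+x. g x \<partial>lborel_vec n) = ennreal \<bar>det L\<bar> * (\<integral>\<^sup>+x. g (L *\<^sub>v x + b) \<partial>lborel_vec n)" .
  qed
qed

text \<open>By Fubini in a coordinate \<open>j\<close> with \<open>a $ j \<noteq> 0\<close>: once
  the other coordinates are fixed, the equation determines the \<open>j\<close>-th one, so every
  fibre has at most one point.\<close>

lemma hyperplane_null_set:
  assumes a: "a \<in> carrier_vec m" "a \<noteq> 0\<^sub>v m"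
  shows "{x \<in> carrier_vec m. a \<bullet> x = c} \<in> null_sets (lborel_vec m)"
proof -
  let ?H = "{x \<in> carrier_vec m. a \<bullet> x = c}"
  let ?P = "\<lambda>I :: nat set. \<Pi>\<^sub>M i\<in>I. (lborel :: real measure)"
  have eq: "a \<bullet> x = (\<Sum>i<m. a $ i * x $ i)" if "x \<in> carrier_vec m" for x
    using that by (simp add: scalar_prod_def lessThan_atLeast0)
  have "(\<lambda>x. \<Sum>i<m. a $ i * x $ i) \<in> borel_measurable (lborel_vec m)"
    by (intro borel_measurable_sum borel_measurable_times borel_measurable_const measurable_vec_index) auto
  then have "{x \<in> space (lborel_vec m). (\<Sum>i<m. a $ i * x $ i) = c} \<in> sets (lborel_vec m)"
    by (intro borel_measurable_eq) auto
  also have "{x \<in> space (lborel_vec m). (\<Sum>i<m. a $ i * x $ i) = c} = ?H"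
    by (auto simp: eq)
  finally have H: "?H \<in> sets (lborel_vec m)" .
  obtain j where j: "j < m" "a $ j \<noteq> 0" using a by (auto simp: vec_eq_iff)
  let ?I = "{..<m} - {j}"
  have ins: "insert j ?I = {..<m}" using j by auto
  have vm: "vec m \<in> ?P {..<m} \<rightarrow>\<^sub>M lborel_vec m"
    unfolding lborel_vec_def by (rule measurable_embed_measure2'[OF inj_on_vec])
  have ind: "indicator ?H \<in> borel_measurable (lborel_vec m)" using H by simp
  have "emeasure (lborel_vec m) ?H = (\<integral>\<^sup>+x. indicator ?H x \<partial>lborel_vec m)" using H by simp
  also have "\<dots> = (\<integral>\<^sup>+g. indicator ?H (vec m g) \<partial>?P {..<m})"
    using ind by (rule nn_integral_lborel_vec)
  also have "\<dots> = (\<integral>\<^sup>+x. \<integral>\<^sup>+y. indicator ?H (vec m (x(j := y))) \<partial>lborel \<partial>?P ?I)"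
    using lborel_product.product_nn_integral_insert[of ?I j "\<lambda>g. indicator ?H (vec m g)", unfolded ins]
      measurable_compose[OF vm ind] by simp
  also have "\<dots> \<le> (\<integral>\<^sup>+x. 0 \<partial>?P ?I)"
  proof (rule nn_integral_mono)
    fix x
    let ?y = "(c - (\<Sum>i\<in>?I. a $ i * x i)) / a $ j"
    have "indicator ?H (vec m (x(j := y))) \<le> (indicator {?y} y :: ennreal)" for y
    proof (cases "vec m (x(j := y)) \<in> ?H")
      case True
      then have "(\<Sum>i\<in>insert j ?I. a $ i * (x(j := y)) i) = c"
        unfolding ins using eq[of "vec m (x(j := y))"] by simp
      moreover have "(\<Sum>i\<in>?I. a $ i * (x(j := y)) i) = (\<Sum>i\<in>?I. a $ i * x i)"
        by (intro sum.cong) auto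
      ultimately have "a $ j * y + (\<Sum>i\<in>?I. a $ i * x i) = c"
        by (subst (asm) sum.insert) auto
      then have "y = ?y" using j by (simp add: field_simps)
      then show ?thesis by (simp add: indicator_def)
    qed simp
    then have "(\<integral>\<^sup>+y. indicator ?H (vec m (x(j := y))) \<partial>lborel) \<le> (\<integral>\<^sup>+y. indicator {?y} y \<partial>lborel)"
      by (intro nn_integral_mono)
    then show "(\<integral>\<^sup>+y. indicator ?H (vec m (x(j := y))) \<partial>lborel) \<le> 0" by simp
  qed
  finally show ?thesis using H by (auto intro: null_setsI)
qed

section \<open>Dispersion of projections of elliptical distributions\<close>

lemma measurable_linear:
  assumes "A \<in> carrier_mat k m"
  shows "(\<lambda>x. A *\<^sub>v x) \<in> lborel_vec m \<rightarrow>\<^sub>M lborel_vec k"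
proof -
  have "(\<lambda>x. A *\<^sub>v x + 0\<^sub>v k) \<in> lborel_vec m \<rightarrow>\<^sub>M lborel_vec k"
    using assms by (intro measurable_affine) auto
  then show ?thesis
    using assms by (subst measurable_cong[of _ _ "\<lambda>x. A *\<^sub>v x + 0\<^sub>v k"]) auto
qed

lemma spherically_symmetric_distr:
  assumes G: "spherically_symmetric k G (0\<^sub>v k)" and U: "orthonormal_rows k k U"
  shows "distr G (lborel_vec k) (\<lambda>y. U *\<^sub>v y) = G"
proof -
  have s: "sets G = sets (lborel_vec k)"
    using G by (simp add: spherically_symmetric_def distribution_def)
  have sp: "space G = carrier_vec k" using sets_eq_imp_space_eq[OF s] by simp
  have "distr G (lborel_vec k) (\<lambda>y. U *\<^sub>v y) = distr G (lborel_vec k) (\<lambda>y. U *\<^sub>v (y - 0\<^sub>v k))"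
    by (intro distr_cong) (auto simp: sp)
  also have "\<dots> = distr G (lborel_vec k) (\<lambda>y. y - 0\<^sub>v k)"
    using G U unfolding spherically_symmetric_def orthonormal_rows_def by metis
  also have "\<dots> = distr G (lborel_vec k) (\<lambda>y. y)"
    by (intro distr_cong) (auto simp: sp)
  also have "\<dots> = G" using s by (intro distr_id2) simp
  finally show ?thesis .
qed

lemma measurable_scalar_prod:
  assumes "w \<in> carrier_vec k"
  shows "(\<lambda>y. w \<bullet> y) \<in> borel_measurable (lborel_vec k)"
proof -
  have "(\<lambda>y. \<Sum>i<k. w $ i * y $ i) \<in> borel_measurable (lborel_vec k)"
    by (intro borel_measurable_sum borel_measurable_times borel_measurable_const measurable_vec_index) auto
  then show ?thesis
    by (subst measurable_cong[of _ _ "\<lambda>y. \<Sum>i<k. w $ i * y $ i"]) (auto simp: scalar_prod_def lessThan_atLeast0)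
qed

text \<open>The normalised \<open>w\<close> is completed to the first row of an orthogonal matrix
  \<open>U\<close>. Then \<open>w \<bullet> y\<close> is the norm of \<open>w\<close> times
  coordinate 0 of \<open>U y\<close>, and \<open>U\<close> preserves the law. Both sides may still
  be infinite here.\<close>

lemma spherically_symmetric_second_moment:
  assumes G: "spherically_symmetric k G (0\<^sub>v k)" and k: "0 < k" and w: "w \<in> carrier_vec k"
  shows "(\<integral>\<^sup>+y. ennreal ((w \<bullet> y)\<^sup>2) \<partial>G) = ennreal (w \<bullet> w) * (\<integral>\<^sup>+y. ennreal ((y $ 0)\<^sup>2) \<partial>G)"
proof (cases "w = 0\<^sub>v k")
  case True
  have sp: "space G = carrier_vec k"
    using G sets_eq_imp_space_eq[of G "lborel_vec k"] by (simp add: spherically_symmetric_def distribution_def)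
  have "(\<integral>\<^sup>+y. ennreal ((w \<bullet> y)\<^sup>2) \<partial>G) = (\<integral>\<^sup>+y. 0 \<partial>G)"
    using True by (intro nn_integral_cong) (simp add: sp)
  then show ?thesis using True by simp
next
  case False
  let ?r = "sqrt (w \<bullet> w)"
  let ?u = "(1 / ?r) \<cdot>\<^sub>v w"
  have ww: "0 < w \<bullet> w" using w False by (rule scalar_prod_self_pos)
  have "orthonormal_list k ([] @ [?u])"
    using w False by (intro orthonormal_list_append1) (auto simp: orthonormal_list_def)
  then obtain ws where ws: "orthonormal_list k (?u # ws)" "length (?u # ws) = k"
    using orthonormal_list_extend[of k "[?u]"] by auto
  define U where "U = mat_of_rows k (?u # ws)"
  have U: "orthonormal_rows k k U"
    using orthonormal_rows_mat_of_rows[OF ws(1)] ws(2) by (simp add: U_def)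
  then have Uc: "U \<in> carrier_mat k k" by (simp add: orthonormal_rows_def)
  have sets: "sets G = sets (lborel_vec k)"
    using G by (simp add: spherically_symmetric_def distribution_def)
  have sp: "space G = carrier_vec k" using sets_eq_imp_space_eq[OF sets] by simp
  have U0: "(U *\<^sub>v y) $ 0 = ?u \<bullet> y" for y
    unfolding U_def using ws by (subst mat_of_rows_mult_vec_index) (auto simp: orthonormal_list_def)
  have mU: "(\<lambda>y. U *\<^sub>v y) \<in> G \<rightarrow>\<^sub>M lborel_vec k"
    using measurable_linear[OF Uc] by (simp cong: measurable_cong_sets add: sets)
  have m0: "(\<lambda>y. ennreal ((y $ 0)\<^sup>2)) \<in> borel_measurable (lborel_vec k)"
    using measurable_vec_index[OF k] by simp
  have "(\<integral>\<^sup>+y. ennreal ((y $ 0)\<^sup>2) \<partial>G) = (\<integral>\<^sup>+y. ennreal ((y $ 0)\<^sup>2) \<partial>distr G (lborel_vec k) (\<lambda>y. U *\<^sub>v y))"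
    using spherically_symmetric_distr[OF G U] by simp
  also have "\<dots> = (\<integral>\<^sup>+y. ennreal ((?u \<bullet> y)\<^sup>2) \<partial>G)"
    using mU m0 by (subst nn_integral_distr) (simp_all add: U0 del: index_mult_mat_vec)
  finally have *: "(\<integral>\<^sup>+y. ennreal ((y $ 0)\<^sup>2) \<partial>G) = (\<integral>\<^sup>+y. ennreal ((?u \<bullet> y)\<^sup>2) \<partial>G)" .
  have meas: "(\<lambda>y. ennreal ((?u \<bullet> y)\<^sup>2)) \<in> borel_measurable G"
    using measurable_scalar_prod[of ?u k] w by (simp cong: measurable_cong_sets add: sets)
  have "(\<integral>\<^sup>+y. ennreal ((w \<bullet> y)\<^sup>2) \<partial>G) = (\<integral>\<^sup>+y. ennreal (w \<bullet> w) * ennreal ((?u \<bullet> y)\<^sup>2) \<partial>G)"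
  proof (rule nn_integral_cong)
    fix y assume "y \<in> space G"
    then have y: "y \<in> carrier_vec k" by (simp add: sp)
    have "(w \<bullet> y)\<^sup>2 = (w \<bullet> w) * (?u \<bullet> y)\<^sup>2"
      using w y ww by (simp add: smult_scalar_prod_distrib[of _ k] power_divide)
    then show "ennreal ((w \<bullet> y)\<^sup>2) = ennreal (w \<bullet> w) * ennreal ((?u \<bullet> y)\<^sup>2)"
      using ww by (simp add: ennreal_mult)
  qed
  also have "\<dots> = ennreal (w \<bullet> w) * (\<integral>\<^sup>+y. ennreal ((?u \<bullet> y)\<^sup>2) \<partial>G)"
    using meas by (rule nn_integral_cmult)
  finally show ?thesis unfolding * .
qed

text \<open>Identifies the centre of symmetry with the mean. Minus the identity is orthogonal, so
  each linear functional has the same integral as its negative, hence integral zero.\<close>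

lemma spherically_symmetric_affine_mean:
  assumes G: "spherically_symmetric k G (0\<^sub>v k)" and A: "A \<in> carrier_mat m k" and b: "b \<in> carrier_vec m"
    and mean: "has_mean m (affine_image m A b G) \<mu>"
  shows "\<mu> = b"
proof (rule eq_vecI)
  show "dim_vec \<mu> = dim_vec b" using mean b by (simp add: has_mean_def)
  fix i assume "i < dim_vec b"
  then have i: "i < m" using b by simp
  have ps: "prob_space G" and sets: "sets G = sets (lborel_vec k)"
    using G by (auto simp: spherically_symmetric_def distribution_def)
  interpret prob_space G by (fact ps)
  have sp: "space G = carrier_vec k" using sets_eq_imp_space_eq[OF sets] by simp
  have mA: "(\<lambda>y. A *\<^sub>v y + b) \<in> G \<rightarrow>\<^sub>M lborel_vec m"
    using measurable_affine[OF A b] by (simp cong: measurable_cong_sets add: sets)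
  have int: "integrable G (\<lambda>y. (A *\<^sub>v y + b) $ i)"
    and mu: "\<mu> $ i = (\<integral>y. (A *\<^sub>v y + b) $ i \<partial>G)"
    using mean i mA measurable_vec_index[OF i]
    by (auto simp: has_mean_def affine_image_def integrable_distr_eq integral_distr simp del: index_add_vec)
  let ?h = "\<lambda>y. row A i \<bullet> y"
  have ent: "(A *\<^sub>v y + b) $ i = ?h y + b $ i" for y using A b i by simp
  have inth: "integrable G ?h"
    using Bochner_Integration.integrable_diff[OF int integrable_const[of "b $ i"]] unfolding ent by simp
  define U :: "real mat" where "U = (-1) \<cdot>\<^sub>m 1\<^sub>m k"
  have U: "orthonormal_rows k k U"
    by (auto simp: U_def orthonormal_rows_def)
  have Uy: "U *\<^sub>v y = - y" if "y \<in> carrier_vec k" for y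
    using that by (auto simp: U_def vec_eq_iff)
  have Uc: "U \<in> carrier_mat k k" by (simp add: U_def)
  have mU: "(\<lambda>y. U *\<^sub>v y) \<in> G \<rightarrow>\<^sub>M lborel_vec k"
    using measurable_linear[OF Uc] by (simp cong: measurable_cong_sets add: sets)
  have ri: "row A i \<in> carrier_vec k" using A i by simp
  have "(\<integral>y. ?h y \<partial>G) = (\<integral>y. ?h y \<partial>distr G (lborel_vec k) (\<lambda>y. U *\<^sub>v y))"
    using spherically_symmetric_distr[OF G U] by simp
  also have "\<dots> = (\<integral>y. ?h (U *\<^sub>v y) \<partial>G)"
    using mU measurable_scalar_prod[OF ri] by (rule integral_distr)
  also have "\<dots> = (\<integral>y. - ?h y \<partial>G)"
  proof (intro Bochner_Integration.integral_cong refl)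
    fix y assume "y \<in> space G"
    then have y: "y \<in> carrier_vec k" by (simp add: sp)
    then show "?h (U *\<^sub>v y) = - ?h y"
      unfolding Uy[OF y]
      by (intro scalar_prod_uminus_right) (simp only: carrier_vecD[OF ri] carrier_vecD[OF y])
  qed
  finally have "(\<integral>y. ?h y \<partial>G) = 0" by simp
  then show "\<mu> $ i = b $ i"
    unfolding mu ent using inth by (simp add: prob_space)
qed

text \<open>The quadratic form of \<Sigma> is the variance of the functional
  \<open>a \<bullet> x\<close>. An extended integral is used so that it can be compared with moments
  of the spherical generator, whose finiteness is not yet known.\<close>

lemma covariance_quadratic_form:
  assumes F: "distribution m F" and cov: "has_covariance m F \<mu> \<Sigma>" and \<mu>: "\<mu> \<in> carrier_vec m"
    and a: "a \<in> carrier_vec m"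
  shows "(\<integral>\<^sup>+x. ennreal ((a \<bullet> (x - \<mu>))\<^sup>2) \<partial>F) = ennreal (a \<bullet> (\<Sigma> *\<^sub>v a))"
    and "0 \<le> a \<bullet> (\<Sigma> *\<^sub>v a)"
proof -
  have sp: "space F = carrier_vec m"
    using F sets_eq_imp_space_eq[of F "lborel_vec m"] by (simp add: distribution_def)
  have S: "\<Sigma> \<in> carrier_mat m m" using cov by (simp add: has_covariance_def)
  let ?X = "\<lambda>x i j. (x $ i - \<mu> $ i) * (x $ j - \<mu> $ j)"
  let ?f = "\<lambda>x. \<Sum>i<m. \<Sum>j<m. a $ i * a $ j * ?X x i j"
  have int: "integrable F (\<lambda>x. ?X x i j)" and S_eq: "\<Sigma> $$ (i, j) = (\<integral>x. ?X x i j \<partial>F)"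
    if "i < m" "j < m" for i j
    using cov that by (auto simp: has_covariance_def)
  have sq: "(a \<bullet> (x - \<mu>))\<^sup>2 = ?f x" if "x \<in> carrier_vec m" for x
  proof -
    have "a \<bullet> (x - \<mu>) = (\<Sum>i<m. a $ i * (x $ i - \<mu> $ i))"
      using that \<mu> by (simp add: scalar_prod_def lessThan_atLeast0)
    then show ?thesis by (simp add: power2_eq_square sum_product mult_ac)
  qed
  have intf: "integrable F ?f"
    using int by (intro Bochner_Integration.integrable_sum integrable_mult_right) auto
  have "(\<integral>x. ?f x \<partial>F) = (\<Sum>i<m. \<Sum>j<m. a $ i * a $ j * \<Sigma> $$ (i, j))"
  proof -
    have "(\<integral>x. ?f x \<partial>F) = (\<Sum>i<m. \<integral>x. (\<Sum>j<m. a $ i * a $ j * ?X x i j) \<partial>F)"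
      using int
      by (intro Bochner_Integration.integral_sum Bochner_Integration.integrable_sum integrable_mult_right) auto
    also have "\<dots> = (\<Sum>i<m. \<Sum>j<m. \<integral>x. a $ i * a $ j * ?X x i j \<partial>F)"
      using int by (intro sum.cong refl Bochner_Integration.integral_sum integrable_mult_right) auto
    also have "\<dots> = (\<Sum>i<m. \<Sum>j<m. a $ i * a $ j * \<Sigma> $$ (i, j))"
      using S_eq by (intro sum.cong refl) simp
    finally show ?thesis .
  qed
  also have "\<dots> = a \<bullet> (\<Sigma> *\<^sub>v a)"
    using a S by (simp add: scalar_prod_def lessThan_atLeast0 sum_distrib_left mult_ac)
  finally have val: "(\<integral>x. ?f x \<partial>F) = a \<bullet> (\<Sigma> *\<^sub>v a)" .
  have nn: "0 \<le> ?f x" if "x \<in> space F" for x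
  proof -
    have "x \<in> carrier_vec m" using that sp by simp
    then have "?f x = (a \<bullet> (x - \<mu>))\<^sup>2" by (rule sq[symmetric])
    then show ?thesis by (simp only: zero_le_power2)
  qed
  have "(\<integral>\<^sup>+x. ennreal ((a \<bullet> (x - \<mu>))\<^sup>2) \<partial>F) = (\<integral>\<^sup>+x. ennreal (?f x) \<partial>F)"
    using sq sp by (intro nn_integral_cong) simp
  also have "\<dots> = ennreal (\<integral>x. ?f x \<partial>F)"
    using intf nn by (intro nn_integral_eq_integral AE_I2)
  finally show "(\<integral>\<^sup>+x. ennreal ((a \<bullet> (x - \<mu>))\<^sup>2) \<partial>F) = ennreal (a \<bullet> (\<Sigma> *\<^sub>v a))"
    unfolding val .
  have "0 \<le> (\<integral>x. ?f x \<partial>F)" using nn by (intro integral_nonneg_AE AE_I2)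
  then show "0 \<le> a \<bullet> (\<Sigma> *\<^sub>v a)" unfolding val .
qed

text \<open>Zero variance in direction \<open>a\<close> would concentrate \<open>F\<close> on a
  hyperplane, which has Lebesgue measure zero.\<close>

lemma covariance_positive_definite:
  assumes F: "distribution m F" and ac: "absolutely_continuous (lborel_vec m) F"
    and cov: "has_covariance m F \<mu> \<Sigma>" and \<mu>: "\<mu> \<in> carrier_vec m"
    and a: "a \<in> carrier_vec m" "a \<noteq> 0\<^sub>v m"
  shows "0 < a \<bullet> (\<Sigma> *\<^sub>v a)"
proof (rule ccontr)
  assume "\<not> 0 < a \<bullet> (\<Sigma> *\<^sub>v a)"
  then have "a \<bullet> (\<Sigma> *\<^sub>v a) = 0" using covariance_quadratic_form(2)[OF F cov \<mu> a(1)] by simp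
  then have 0: "(\<integral>\<^sup>+x. ennreal ((a \<bullet> (x - \<mu>))\<^sup>2) \<partial>F) = 0"
    using covariance_quadratic_form(1)[OF F cov \<mu> a(1)] by simp
  have sets: "sets F = sets (lborel_vec m)" and ps: "prob_space F" using F by (auto simp: distribution_def)
  interpret prob_space F by (fact ps)
  have sp: "space F = carrier_vec m" using sets_eq_imp_space_eq[OF sets] by simp
  have eq: "a \<bullet> (x - \<mu>) = a \<bullet> x - a \<bullet> \<mu>" if "x \<in> carrier_vec m" for x
    using a(1) that \<mu> by (rule scalar_prod_minus_distrib)
  have "(\<lambda>x. ennreal ((a \<bullet> x - a \<bullet> \<mu>)\<^sup>2)) \<in> borel_measurable F"
    using measurable_scalar_prod[OF a(1)] by (simp cong: measurable_cong_sets add: sets)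
  moreover have "(\<integral>\<^sup>+x. ennreal ((a \<bullet> x - a \<bullet> \<mu>)\<^sup>2) \<partial>F) = 0"
    using 0 by (subst nn_integral_cong[of F _ "\<lambda>x. ennreal ((a \<bullet> (x - \<mu>))\<^sup>2)"]) (auto simp: sp eq)
  ultimately have "AE x in F. ennreal ((a \<bullet> x - a \<bullet> \<mu>)\<^sup>2) = 0"
    by (subst (asm) nn_integral_0_iff_AE)
  moreover have "{x \<in> carrier_vec m. a \<bullet> x = a \<bullet> \<mu>} \<in> null_sets F"
    using hyperplane_null_set[OF a, of "a \<bullet> \<mu>"] ac by (auto simp: absolutely_continuous_def)
  then have "AE x in F. x \<notin> {x \<in> carrier_vec m. a \<bullet> x = a \<bullet> \<mu>}" by (rule AE_not_in)
  ultimately have "AE x in F. False"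
    using AE_space by eventually_elim (auto simp: sp)
  then show False by (simp add: AE_False)
qed

text \<open>Polarisation: the form at the sum of two unit vectors reveals the entry
  \<open>(i, j)\<close>.\<close>

lemma symmetric_mat_eqI:
  fixes M N :: "real mat"
  assumes M: "M \<in> carrier_mat n n" "M\<^sup>T = M" and N: "N \<in> carrier_mat n n" "N\<^sup>T = N"
    and eq: "\<And>a. a \<in> carrier_vec n \<Longrightarrow> a \<bullet> (M *\<^sub>v a) = a \<bullet> (N *\<^sub>v a)"
  shows "M = N"
proof (rule eq_matI)
  fix i j assume "i < dim_row N" "j < dim_col N"
  then have ij: "i < n" "j < n" using N by auto
  let ?x = "unit_vec n i :: real vec" and ?y = "unit_vec n j :: real vec"
  have expand: "(?x + ?y) \<bullet> (K *\<^sub>v (?x + ?y)) = ?x \<bullet> (K *\<^sub>v ?x) + 2 * K $$ (i, j) + ?y \<bullet> (K *\<^sub>v ?y)"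
    if K: "K \<in> carrier_mat n n" "K\<^sup>T = K" for K :: "real mat"
  proof -
    have "?y \<bullet> (K *\<^sub>v ?x) = (K *\<^sub>v ?y) \<bullet> ?x"
      using K by (intro symmetric_mat_scalar_prod[symmetric]) auto
    also have "\<dots> = ?x \<bullet> (K *\<^sub>v ?y)" using K by (intro comm_scalar_prod[of _ n]) auto
    also have "\<dots> = K $$ (i, j)" using K ij by simp
    finally have "?y \<bullet> (K *\<^sub>v ?x) = K $$ (i, j)" .
    moreover have "?x \<bullet> (K *\<^sub>v ?y) = K $$ (i, j)" using K ij by simp
    moreover have "K *\<^sub>v (?x + ?y) = K *\<^sub>v ?x + K *\<^sub>v ?y"
      using K by (intro mult_add_distrib_mat_vec) auto
    ultimately show ?thesis
      using K by (simp add: add_scalar_prod_distrib[of _ n] scalar_prod_add_distrib[of _ n])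
  qed
  show "M $$ (i, j) = N $$ (i, j)"
    using eq[of "?x + ?y"] eq[of ?x] eq[of ?y] expand[OF M] expand[OF N] by simp
qed (use M N in auto)

lemma covariance_symmetric:
  assumes "has_covariance m F \<mu> \<Sigma>"
  shows "\<Sigma> \<in> carrier_mat m m" "\<Sigma>\<^sup>T = \<Sigma>"
proof -
  show S: "\<Sigma> \<in> carrier_mat m m" using assms by (simp add: has_covariance_def)
  show "\<Sigma>\<^sup>T = \<Sigma>"
  proof (rule eq_matI)
    fix i j assume "i < dim_row \<Sigma>" "j < dim_col \<Sigma>"
    then have "i < m" "j < m" using S by auto
    then have "\<Sigma> $$ (j, i) = \<Sigma> $$ (i, j)"
      using assms by (simp add: has_covariance_def mult.commute)
    then show "\<Sigma>\<^sup>T $$ (i, j) = \<Sigma> $$ (i, j)" using S \<open>i < m\<close> \<open>j < m\<close> by simp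
  qed (use S in auto)
qed

lemma smult_mat_mult_vec:
  fixes A :: "real mat"
  assumes "A \<in> carrier_mat r n" "v \<in> carrier_vec n"
  shows "(c \<cdot>\<^sub>m A) *\<^sub>v v = c \<cdot>\<^sub>v (A *\<^sub>v v)"
  using assms by (intro eq_vecI) (simp_all add: scalar_prod_def sum_distrib_left mult.assoc)

text \<open>\<open>c\<close> is the second moment of one coordinate of the generator
  \<open>G\<close>. The variance of \<open>a \<bullet> x\<close> is \<open>c\<close> times the
  squared norm of \<open>A a\<close>; equality of these forms gives equality of the
  matrices.\<close>

lemma elliptical_covariance:
  assumes m: "0 < m" and A: "A \<in> carrier_mat k m" and G: "spherically_symmetric k G (0\<^sub>v k)"
    and F: "F = affine_image m A\<^sup>T \<mu> G" "distribution m F" "absolutely_continuous (lborel_vec m) F"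
    and cov: "has_covariance m F \<mu> \<Sigma>" and \<mu>: "\<mu> \<in> carrier_vec m"
  obtains c where "0 < c" "\<Sigma> = c \<cdot>\<^sub>m (A\<^sup>T * A)"
proof -
  note S = covariance_symmetric[OF cov]
  have sets: "sets G = sets (lborel_vec k)"
    using G by (simp add: spherically_symmetric_def distribution_def)
  have sp: "space G = carrier_vec k" using sets_eq_imp_space_eq[OF sets] by simp
  have AT: "A\<^sup>T \<in> carrier_mat m k" using A by simp
  have mA: "(\<lambda>y. A\<^sup>T *\<^sub>v y + \<mu>) \<in> G \<rightarrow>\<^sub>M lborel_vec m"
    using measurable_affine[OF AT \<mu>] by (simp cong: measurable_cong_sets add: sets)
  have quad: "ennreal (a \<bullet> (\<Sigma> *\<^sub>v a)) = (\<integral>\<^sup>+y. ennreal (((A *\<^sub>v a) \<bullet> y)\<^sup>2) \<partial>G)"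
    if a: "a \<in> carrier_vec m" for a
  proof -
    have "(\<lambda>x. a \<bullet> (x - \<mu>)) \<in> borel_measurable (lborel_vec m) \<longleftrightarrow>
        (\<lambda>x. a \<bullet> x - a \<bullet> \<mu>) \<in> borel_measurable (lborel_vec m)"
      using a \<mu> by (intro measurable_cong) (simp add: scalar_prod_minus_distrib[of _ m])
    then have meas: "(\<lambda>x. ennreal ((a \<bullet> (x - \<mu>))\<^sup>2)) \<in> borel_measurable (lborel_vec m)"
      using measurable_scalar_prod[OF a] by simp
    have "ennreal (a \<bullet> (\<Sigma> *\<^sub>v a)) = (\<integral>\<^sup>+x. ennreal ((a \<bullet> (x - \<mu>))\<^sup>2) \<partial>F)"
      using covariance_quadratic_form(1)[OF F(2) cov \<mu> a] by simp
    also have "\<dots> = (\<integral>\<^sup>+y. ennreal ((a \<bullet> (A\<^sup>T *\<^sub>v y + \<mu> - \<mu>))\<^sup>2) \<partial>G)"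
      unfolding F(1) affine_image_def
      using mA meas by (subst nn_integral_distr[OF mA]) simp_all
    also have "\<dots> = (\<integral>\<^sup>+y. ennreal (((A *\<^sub>v a) \<bullet> y)\<^sup>2) \<partial>G)"
    proof (rule nn_integral_cong)
      fix y assume "y \<in> space G"
      then have y: "y \<in> carrier_vec k" by (simp add: sp)
      have Ay: "A\<^sup>T *\<^sub>v y \<in> carrier_vec m" using AT y by (rule mult_mat_vec_carrier)
      have "z + \<mu> - \<mu> = z" if "z \<in> carrier_vec m" for z
        using that \<mu> by (intro eq_vecI) auto
      then have "A\<^sup>T *\<^sub>v y + \<mu> - \<mu> = A\<^sup>T *\<^sub>v y" using Ay .
      moreover have "a \<bullet> (A\<^sup>T *\<^sub>v y) = (A\<^sup>T *\<^sub>v y) \<bullet> a" using a Ay by (rule comm_scalar_prod)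
      moreover have "\<dots> = y \<bullet> (A *\<^sub>v a)" using A a y by (rule transpose_vec_mult_scalar)
      moreover have "\<dots> = (A *\<^sub>v a) \<bullet> y"
        using y A a by (intro comm_scalar_prod[of _ k] mult_mat_vec_carrier) auto
      ultimately show "ennreal ((a \<bullet> (A\<^sup>T *\<^sub>v y + \<mu> - \<mu>))\<^sup>2) = ennreal (((A *\<^sub>v a) \<bullet> y)\<^sup>2)" by simp
    qed
    finally show ?thesis .
  qed
  have pd: "0 < a \<bullet> (\<Sigma> *\<^sub>v a)" if "a \<in> carrier_vec m" "a \<noteq> 0\<^sub>v m" for a
    using F(2,3) cov \<mu> that by (rule covariance_positive_definite)
  let ?e = "unit_vec m 0 :: real vec"
  have e: "?e \<in> carrier_vec m" "?e \<noteq> 0\<^sub>v m" using m by auto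
  \<comment> \<open>For \<open>k = 0\<close> the generator lives on a single point and all variances
    would vanish.\<close>
  have k: "0 < k"
  proof (rule ccontr)
    assume "\<not> 0 < k"
    then have "(A *\<^sub>v ?e) \<bullet> y = 0" if "y \<in> space G" for y
      using that sp by (simp add: scalar_prod_def)
    then have "(\<integral>\<^sup>+y. ennreal (((A *\<^sub>v ?e) \<bullet> y)\<^sup>2) \<partial>G) = (\<integral>\<^sup>+y. 0 \<partial>G)"
      by (intro nn_integral_cong) simp
    with quad[OF e(1)] pd[OF e] show False by simp
  qed
  define C where "C = (\<integral>\<^sup>+y. ennreal ((y $ 0)\<^sup>2) \<partial>G)"
  have quad': "ennreal (a \<bullet> (\<Sigma> *\<^sub>v a)) = ennreal ((A *\<^sub>v a) \<bullet> (A *\<^sub>v a)) * C"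
    if a: "a \<in> carrier_vec m" for a
    unfolding C_def quad[OF a]
    using G k mult_mat_vec_carrier[OF A a] by (rule spherically_symmetric_second_moment)
  have e_pos: "0 < ennreal ((A *\<^sub>v ?e) \<bullet> (A *\<^sub>v ?e)) * C"
    unfolding quad'[OF e(1), symmetric] using pd[OF e] by (rule ennreal_less_zero_iff[THEN iffD2])
  \<comment> \<open>Since \<open>A ?e\<close> is nonzero, an infinite \<open>C\<close> would make
    the variance of the first coordinate infinite.\<close>
  have "C \<noteq> \<infinity>"
  proof
    assume "C = \<infinity>"
    with e_pos have "ennreal ((A *\<^sub>v ?e) \<bullet> (A *\<^sub>v ?e)) * C = \<infinity>"
      by (auto simp: ennreal_mult_top zero_less_iff_neq_zero)
    with quad'[OF e(1)] show False by simp
  qed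
  then obtain c where c: "C = ennreal c" "0 \<le> c" by (cases C) auto
  have c0: "0 < c" using e_pos c by (cases "c = 0") auto
  have quad'': "a \<bullet> (\<Sigma> *\<^sub>v a) = ((A *\<^sub>v a) \<bullet> (A *\<^sub>v a)) * c" if a: "a \<in> carrier_vec m" for a
  proof -
    have "0 \<le> a \<bullet> (\<Sigma> *\<^sub>v a)" using covariance_quadratic_form(2)[OF F(2) cov \<mu> a] .
    moreover have "0 \<le> ((A *\<^sub>v a) \<bullet> (A *\<^sub>v a)) * c"
      using c scalar_prod_self_nonneg by (intro mult_nonneg_nonneg) auto
    moreover have "ennreal (a \<bullet> (\<Sigma> *\<^sub>v a)) = ennreal (((A *\<^sub>v a) \<bullet> (A *\<^sub>v a)) * c)"
      using quad'[OF a] c scalar_prod_self_nonneg[of "A *\<^sub>v a"] by (simp add: ennreal_mult)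
    ultimately show ?thesis by simp
  qed
  have "\<Sigma> = c \<cdot>\<^sub>m (A\<^sup>T * A)"
  proof (rule symmetric_mat_eqI[OF S])
    show "c \<cdot>\<^sub>m (A\<^sup>T * A) \<in> carrier_mat m m" using A by auto
    have "(A\<^sup>T * A)\<^sup>T = A\<^sup>T * A" using A by (subst transpose_mult[of _ m k _ m]) auto
    moreover have "(c \<cdot>\<^sub>m (A\<^sup>T * A))\<^sup>T = c \<cdot>\<^sub>m (A\<^sup>T * A)\<^sup>T" by (auto simp: mat_eq_iff)
    ultimately show "(c \<cdot>\<^sub>m (A\<^sup>T * A))\<^sup>T = c \<cdot>\<^sub>m (A\<^sup>T * A)" by simp
    fix a :: "real vec" assume a: "a \<in> carrier_vec m"
    have Aa: "A *\<^sub>v a \<in> carrier_vec k" using A a by (rule mult_mat_vec_carrier)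
    have "(c \<cdot>\<^sub>m (A\<^sup>T * A)) *\<^sub>v a = c \<cdot>\<^sub>v ((A\<^sup>T * A) *\<^sub>v a)"
      using A a by (intro smult_mat_mult_vec) auto
    also have "(A\<^sup>T * A) *\<^sub>v a = A\<^sup>T *\<^sub>v (A *\<^sub>v a)" using AT A a by (rule assoc_mult_mat_vec)
    finally have "a \<bullet> ((c \<cdot>\<^sub>m (A\<^sup>T * A)) *\<^sub>v a) = c * (a \<bullet> (A\<^sup>T *\<^sub>v (A *\<^sub>v a)))"
      using a AT Aa by (simp add: scalar_prod_smult_distrib[of _ m])
    also have "a \<bullet> (A\<^sup>T *\<^sub>v (A *\<^sub>v a)) = (A\<^sup>T *\<^sub>v (A *\<^sub>v a)) \<bullet> a"
      using a AT Aa by (intro comm_scalar_prod[of _ m] mult_mat_vec_carrier) auto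
    also have "\<dots> = (A *\<^sub>v a) \<bullet> (A *\<^sub>v a)" using A a Aa by (rule transpose_vec_mult_scalar)
    finally show "a \<bullet> (\<Sigma> *\<^sub>v a) = a \<bullet> ((c \<cdot>\<^sub>m (A\<^sup>T * A)) *\<^sub>v a)"
      using quad''[OF a] by (simp add: mult.commute)
  qed
  with c0 that show ?thesis by blast
qed

section \<open>Dispersion as a determinant times a constant\<close>

text \<open>Affine invariance turns the depth at \<open>L x + b\<close> under the image law into the
  depth at \<open>x\<close> under \<open>H\<close>; only the Jacobian of the substitution
  remains.\<close>

lemma dispersion_affine_triangular:
  assumes d: "statistical_depth symm d" and H: "distribution n H"
    and L: "L \<in> carrier_mat n n" "\<And>i j. i < j \<Longrightarrow> j < n \<Longrightarrow> L $$ (i, j) = 0" "det L \<noteq> 0"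
    and b: "b \<in> carrier_vec n"
  shows "dispersion d n (affine_image n L b H) = ennreal \<bar>det L\<bar> * dispersion d n H"
proof -
  obtain N where "N \<in> carrier_mat n n" "L * N = 1\<^sub>m n" "N * L = 1\<^sub>m n"
    using det_non_zero_imp_unit[OF L(1,3)] L(1) by (auto simp: Units_def ring_mat_def)
  then have "invertible_mat L"
    unfolding invertible_mat_def inverts_mat_def using L(1) by (auto intro!: exI[of _ N])
  then have inv: "d x H = d (L *\<^sub>v x + b) (affine_image n L b H)" if "x \<in> carrier_vec n" for x
    using d H L(1) b that unfolding statistical_depth_def by blast
  have "dispersion d n (affine_image n L b H) =
      ennreal \<bar>det L\<bar> * (\<integral>\<^sup>+x. ennreal (d (L *\<^sub>v x + b) (affine_image n L b H)) \<partial>lborel_vec n)"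
    unfolding dispersion_def using L b by (rule nn_integral_lborel_vec_triangular)
  also have "(\<integral>\<^sup>+x. ennreal (d (L *\<^sub>v x + b) (affine_image n L b H)) \<partial>lborel_vec n) = dispersion d n H"
    unfolding dispersion_def using inv by (intro nn_integral_cong) simp
  finally show ?thesis .
qed

lemma dispersion_linear_image_elliptical:
  assumes d: "statistical_depth symm d" and A: "A \<in> carrier_mat k m" and b: "b \<in> carrier_vec m"
    and G: "spherically_symmetric k G (0\<^sub>v k)" and B: "B \<in> carrier_mat n m"
    and inj: "\<And>y. y \<in> carrier_vec n \<Longrightarrow> (B * A\<^sup>T)\<^sup>T *\<^sub>v y = 0\<^sub>v k \<Longrightarrow> y = 0\<^sub>v n"
  shows "dispersion d n (linear_image n B (affine_image m A\<^sup>T b G)) =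
    ennreal (sqrt (det (B * (A\<^sup>T * A) * B\<^sup>T))) *
    dispersion d n (distr G (lborel_vec n) (\<lambda>y. vec n (\<lambda>i. y $ i)))"
proof -
  have AT: "A\<^sup>T \<in> carrier_mat m k" using A by simp
  have BA: "B * A\<^sup>T \<in> carrier_mat n k" using B AT by (rule mult_carrier_mat)
  obtain L us where L: "L \<in> carrier_mat n n" and us: "orthonormal_list k us" "length us = n"
    and RL: "B * A\<^sup>T = L * mat_of_rows k us"
    and tri: "\<And>i j. i < j \<Longrightarrow> j < n \<Longrightarrow> L $$ (i, j) = 0" and det: "det L \<noteq> 0"
    using BA inj by (rule lower_triangular_orthonormal_decomposition) blast+
  \<comment> \<open>Completing \<open>us\<close> to a basis makes \<open>V y\<close> the first
    \<open>n\<close> coordinates of \<open>U y\<close> with \<open>U\<close> orthogonal, so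
    \<open>V Y\<close> has the law of the first \<open>n\<close> coordinates of \<open>Y\<close>,
    whatever \<open>B\<close> was.\<close>
  obtain ws where ws: "orthonormal_list k (us @ ws)" "length (us @ ws) = k"
    using us(1) by (rule orthonormal_list_extend)
  define V where "V = mat_of_rows k us"
  define U where "U = mat_of_rows k (us @ ws)"
  have V: "orthonormal_rows n k V" using orthonormal_rows_mat_of_rows[OF us(1)] us(2) by (simp add: V_def)
  then have Vc: "V \<in> carrier_mat n k" by (simp add: orthonormal_rows_def)
  have U: "orthonormal_rows k k U" using orthonormal_rows_mat_of_rows[OF ws(1)] ws(2) by (simp add: U_def)
  then have Uc: "U \<in> carrier_mat k k" by (simp add: orthonormal_rows_def)
  have nk: "n \<le> k" using ws us by simp
  have wc: "set (us @ ws) \<subseteq> carrier_vec k" using ws(1) by (simp add: orthonormal_list_def)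
  have VU: "V *\<^sub>v y = vec n (\<lambda>i. (U *\<^sub>v y) $ i)" for y
  proof (rule eq_vecI)
    fix i assume "i < dim_vec (vec n (\<lambda>i. (U *\<^sub>v y) $ i))"
    then have i: "i < n" by simp
    have "(V *\<^sub>v y) $ i = us ! i \<bullet> y"
      unfolding V_def using wc us i by (intro mat_of_rows_mult_vec_index) auto
    moreover have "(U *\<^sub>v y) $ i = (us @ ws) ! i \<bullet> y"
      unfolding U_def using wc us i by (intro mat_of_rows_mult_vec_index) auto
    ultimately show "(V *\<^sub>v y) $ i = vec n (\<lambda>i. (U *\<^sub>v y) $ i) $ i"
      using i us(2) by (simp add: nth_append del: index_mult_mat_vec)
  qed (use Vc in simp)
  have sets: "sets G = sets (lborel_vec k)" and ps: "prob_space G"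
    using G by (auto simp: spherically_symmetric_def distribution_def)
  have sp: "space G = carrier_vec k" using sets_eq_imp_space_eq[OF sets] by simp
  let ?E = "\<lambda>y :: real vec. vec n (\<lambda>i. y $ i)"
  let ?H = "distr G (lborel_vec n) ?E"
  let ?b = "B *\<^sub>v b"
  have bc: "?b \<in> carrier_vec n" using B b by (rule mult_mat_vec_carrier)
  have mE: "?E \<in> lborel_vec k \<rightarrow>\<^sub>M lborel_vec n"
    using nk by (intro measurable_into_lborel_vec) auto
  have mE': "?E \<in> G \<rightarrow>\<^sub>M lborel_vec n" using mE by (simp cong: measurable_cong_sets add: sets)
  have mU: "(\<lambda>y. U *\<^sub>v y) \<in> G \<rightarrow>\<^sub>M lborel_vec k"
    using measurable_linear[OF Uc] by (simp cong: measurable_cong_sets add: sets)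
  have mA: "(\<lambda>y. A\<^sup>T *\<^sub>v y + b) \<in> G \<rightarrow>\<^sub>M lborel_vec m"
    using measurable_affine[OF AT b] by (simp cong: measurable_cong_sets add: sets)
  note mL = measurable_affine[OF L bc]
  have H: "distribution n ?H"
    unfolding distribution_def using prob_space.prob_space_distr[OF ps mE'] by simp
  have "linear_image n B (affine_image m A\<^sup>T b G) = distr G (lborel_vec n) ((\<lambda>x. B *\<^sub>v x) \<circ> (\<lambda>y. A\<^sup>T *\<^sub>v y + b))"
    unfolding linear_image_def affine_image_def using measurable_linear[OF B] mA by (rule distr_distr)
  also have "\<dots> = distr G (lborel_vec n) (((\<lambda>z. L *\<^sub>v z + ?b) \<circ> ?E) \<circ> (\<lambda>y. U *\<^sub>v y))"
  proof (intro distr_cong refl)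
    fix y assume "y \<in> space G"
    then have y: "y \<in> carrier_vec k" by (simp add: sp)
    have "B *\<^sub>v (A\<^sup>T *\<^sub>v y + b) = B *\<^sub>v (A\<^sup>T *\<^sub>v y) + ?b"
      using B AT y b by (intro mult_add_distrib_mat_vec) auto
    also have "B *\<^sub>v (A\<^sup>T *\<^sub>v y) = (B * A\<^sup>T) *\<^sub>v y" using assoc_mult_mat_vec[OF B AT y] by simp
    also have "\<dots> = L *\<^sub>v (V *\<^sub>v y)" unfolding RL V_def[symmetric] using L Vc y by (rule assoc_mult_mat_vec)
    finally show "((\<lambda>x. B *\<^sub>v x) \<circ> (\<lambda>y. A\<^sup>T *\<^sub>v y + b)) y = (((\<lambda>z. L *\<^sub>v z + ?b) \<circ> ?E) \<circ> (\<lambda>y. U *\<^sub>v y)) y"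
      by (simp add: VU del: index_mult_mat_vec)
  qed
  also have "\<dots> = distr (distr G (lborel_vec k) (\<lambda>y. U *\<^sub>v y)) (lborel_vec n) ((\<lambda>z. L *\<^sub>v z + ?b) \<circ> ?E)"
    using measurable_comp[OF mE mL] mU by (rule distr_distr[symmetric])
  also have "\<dots> = distr G (lborel_vec n) ((\<lambda>z. L *\<^sub>v z + ?b) \<circ> ?E)"
    unfolding spherically_symmetric_distr[OF G U] ..
  also have "\<dots> = affine_image n L ?b ?H"
    unfolding affine_image_def using mL mE' by (rule distr_distr[symmetric])
  finally have eq: "linear_image n B (affine_image m A\<^sup>T b G) = affine_image n L ?b ?H" .
  \<comment> \<open>With an identity matrix inserted, \<open>congruence_mult\<close> reduces the
    product to \<open>L L\<^sup>T\<close>, whose determinant is the square of that of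
    \<open>L\<close>.\<close>
  have "B * (A\<^sup>T * A) * B\<^sup>T = B * (A\<^sup>T * 1\<^sub>m k * A\<^sup>T\<^sup>T) * B\<^sup>T" using AT by simp
  also have "\<dots> = (B * A\<^sup>T) * 1\<^sub>m k * (B * A\<^sup>T)\<^sup>T"
    using B AT by (intro congruence_mult[symmetric]) auto
  also have "\<dots> = L * (V * 1\<^sub>m k * V\<^sup>T) * L\<^sup>T"
    unfolding RL V_def[symmetric] using L Vc by (intro congruence_mult) auto
  also have "\<dots> = L * L\<^sup>T" using V Vc L by (simp add: orthonormal_rows_def)
  finally have "det (B * (A\<^sup>T * A) * B\<^sup>T) = det L * det L\<^sup>T"
    using L by (simp add: det_mult[of _ n])
  also have "\<dots> = (det L)\<^sup>2" using L by (simp add: det_transpose power2_eq_square)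
  finally have "sqrt (det (B * (A\<^sup>T * A) * B\<^sup>T)) = \<bar>det L\<bar>" by simp
  then show ?thesis
    unfolding eq using dispersion_affine_triangular[OF d H L tri det bc] by simp
qed

text \<open>\<kappa> is fixed before \<open>B\<close> is chosen, which is what allows dispersions of
  different subspaces to be compared. Its factor \<open>1 / sqrt (c ^ n)\<close> replaces the
  scatter \<open>A\<^sup>T A\<close> by the covariance inside an \<open>n\<close>-dimensional
  determinant.\<close>

lemma dispersion_linear_image_covariance:
  assumes m: "0 < m" and F: "distribution m F" "absolutely_continuous (lborel_vec m) F"
    "elliptically_symmetric m F \<mu>\<^sub>0 \<Sigma>\<^sub>0"
    and mean: "has_mean m F \<mu>" and cov: "has_covariance m F \<mu> \<Sigma>" and d: "statistical_depth symm d"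
  obtains \<kappa> where "\<And>B. orthonormal_rows n m B \<Longrightarrow>
    dispersion d n (linear_image n B F) = ennreal (sqrt (det (B * \<Sigma> * B\<^sup>T))) * \<kappa>"
proof -
  obtain k A G where A: "A \<in> carrier_mat k m" and G: "spherically_symmetric k G (0\<^sub>v k)"
    and FG0: "F = affine_image m A\<^sup>T \<mu>\<^sub>0 G" and \<mu>0: "\<mu>\<^sub>0 \<in> carrier_vec m"
    using F(3) by (auto simp: elliptically_symmetric_def)
  have AT: "A\<^sup>T \<in> carrier_mat m k" using A by simp
  have "\<mu> = \<mu>\<^sub>0" using G AT \<mu>0 mean unfolding FG0 by (rule spherically_symmetric_affine_mean)
  with FG0 \<mu>0 have FG: "F = affine_image m A\<^sup>T \<mu> G" and \<mu>: "\<mu> \<in> carrier_vec m" by simp_all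
  obtain c where c: "0 < c" "\<Sigma> = c \<cdot>\<^sub>m (A\<^sup>T * A)"
    using m A G FG F(1,2) cov \<mu> by (rule elliptical_covariance)
  let ?\<kappa> = "ennreal (1 / sqrt (c ^ n)) * dispersion d n (distr G (lborel_vec n) (\<lambda>y. vec n (\<lambda>i. y $ i)))"
  have "dispersion d n (linear_image n B F) = ennreal (sqrt (det (B * \<Sigma> * B\<^sup>T))) * ?\<kappa>"
    if B: "orthonormal_rows n m B" for B
  proof -
    have Bc: "B \<in> carrier_mat n m" using B by (simp add: orthonormal_rows_def)
    have BT: "B\<^sup>T \<in> carrier_mat m n" using Bc by simp
    \<comment> \<open>A dependence among the rows of \<open>B A\<^sup>T\<close> would be a nonzero
      direction \<open>B\<^sup>T y\<close> killed by \<open>A\<close>, hence one of zero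
      variance.\<close>
    have inj: "y = 0\<^sub>v n" if y: "y \<in> carrier_vec n" and 0: "(B * A\<^sup>T)\<^sup>T *\<^sub>v y = 0\<^sub>v k" for y
    proof (rule ccontr)
      assume "y \<noteq> 0\<^sub>v n"
      let ?a = "B\<^sup>T *\<^sub>v y"
      have a: "?a \<in> carrier_vec m" using BT y by (rule mult_mat_vec_carrier)
      have "(B * A\<^sup>T)\<^sup>T = A * B\<^sup>T" using Bc AT by (subst transpose_mult[of _ n m _ k]) auto
      then have Aa: "A *\<^sub>v ?a = 0\<^sub>v k" using assoc_mult_mat_vec[OF A BT y] 0 by simp
      have "\<Sigma> *\<^sub>v ?a = c \<cdot>\<^sub>v ((A\<^sup>T * A) *\<^sub>v ?a)"
        unfolding c(2) using A a by (intro smult_mat_mult_vec) auto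
      also have "(A\<^sup>T * A) *\<^sub>v ?a = A\<^sup>T *\<^sub>v (A *\<^sub>v ?a)" using AT A a by (rule assoc_mult_mat_vec)
      also have "\<dots> = 0\<^sub>v m" unfolding Aa using AT by (rule mult_mat_zero_vec)
      finally have "?a \<bullet> (\<Sigma> *\<^sub>v ?a) = 0" using a by simp
      moreover have "?a \<noteq> 0\<^sub>v m"
      proof
        assume "?a = 0\<^sub>v m"
        then have "y = B *\<^sub>v 0\<^sub>v m" using mult_mat_vec_transpose_cancel[OF B y] by simp
        with mult_mat_zero_vec[OF Bc] \<open>y \<noteq> 0\<^sub>v n\<close> show False by simp
      qed
      ultimately show False
        using covariance_positive_definite[OF F(1,2) cov \<mu> a] by simp
    qed
    have N: "B * (A\<^sup>T * A) * B\<^sup>T \<in> carrier_mat n n" using Bc A by auto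
    have "B * \<Sigma> * B\<^sup>T = c \<cdot>\<^sub>m (B * (A\<^sup>T * A) * B\<^sup>T)"
    proof -
      have AA: "A\<^sup>T * A \<in> carrier_mat m m" using A by auto
      have "B * \<Sigma> = c \<cdot>\<^sub>m (B * (A\<^sup>T * A))"
        unfolding c(2) using Bc AA by (rule mult_smult_distrib)
      moreover have "c \<cdot>\<^sub>m (B * (A\<^sup>T * A)) * B\<^sup>T = c \<cdot>\<^sub>m (B * (A\<^sup>T * A) * B\<^sup>T)"
        using Bc AA BT by (intro mult_smult_assoc_mat[of _ n m]) auto
      ultimately show ?thesis by simp
    qed
    then have "det (B * \<Sigma> * B\<^sup>T) = c ^ n * det (B * (A\<^sup>T * A) * B\<^sup>T)"
      using N Bc by simp
    then have "sqrt (det (B * (A\<^sup>T * A) * B\<^sup>T)) = sqrt (det (B * \<Sigma> * B\<^sup>T)) * (1 / sqrt (c ^ n))"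
      using c(1) by (simp add: real_sqrt_mult)
    then have "ennreal (sqrt (det (B * (A\<^sup>T * A) * B\<^sup>T))) = ennreal (sqrt (det (B * \<Sigma> * B\<^sup>T))) * ennreal (1 / sqrt (c ^ n))"
      using c(1) by (simp only:) (rule ennreal_mult'', simp)
    then show ?thesis
      unfolding FG using dispersion_linear_image_elliptical[OF d A \<mu> G Bc inj] by (simp add: mult.assoc)
  qed
  with that show ?thesis by blast
qed

section \<open>Optimality of principal subspaces\<close>

text \<open>Computes the determinants at a PCA pair and so shows that the bounds are
  attained.\<close>

lemma det_congruence_eigenrows:
  fixes M :: "real mat" and e :: "nat \<Rightarrow> real"
  assumes M: "M \<in> carrier_mat m m" and us: "orthonormal_list m us"
    and eig: "\<And>i. i < length us \<Longrightarrow> M *\<^sub>v us ! i = e i \<cdot>\<^sub>v us ! i"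
  shows "det (mat_of_rows m us * M * (mat_of_rows m us)\<^sup>T) = (\<Prod>i<length us. e i)"
proof -
  let ?n = "length us"
  define D where "D = mat_of_rows m us * M * (mat_of_rows m us)\<^sup>T"
  have Uc: "mat_of_rows m us \<in> carrier_mat ?n m" by simp
  have r: "row (mat_of_rows m us) i = us ! i" "us ! i \<in> carrier_vec m" if "i < ?n" for i
    using that us by (auto simp: orthonormal_list_def intro!: mat_of_rows_row)
  have Dc: "D \<in> carrier_mat ?n ?n" unfolding D_def using M by auto
  have D: "D $$ (i, j) = (if i = j then e j else 0)" if "i < ?n" "j < ?n" for i j
    using congruence_index[OF Uc M that] r[OF that(1)] r[OF that(2)] that us eig[OF that(2)]
    by (simp add: D_def orthonormal_list_def scalar_prod_smult_distrib[of _ m] del: index_mult_mat)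
  have "det D = prod_list (diag_mat D)"
    using Dc D by (intro det_upper_triangular[of _ ?n]) auto
  also have "\<dots> = (\<Prod>i<?n. e i)"
    using Dc D by (simp add: prod_list_diag_prod lessThan_atLeast0)
  finally show ?thesis by (simp add: D_def)
qed

lemma basis_mat_orthogonal_pair:
  assumes "(S, T) \<in> orthogonal_pairs m p q"
  shows "orthonormal_rows p m (basis_mat p m S)" "vec_span m (set (rows (basis_mat p m S))) = S"
    and "orthonormal_rows q m (basis_mat q m T)" "vec_span m (set (rows (basis_mat q m T))) = T"
proof -
  obtain us ws where uw: "orthonormal_list m (us @ ws)" "length us = p" "length ws = q"
    "vec_span m (set us) = S" "vec_span m (set ws) = T"
    using assms by (rule orthogonal_pairsE)
  then have o: "orthonormal_list m us" "orthonormal_list m ws"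
    by (auto simp: orthonormal_list_append_iff)
  then have c: "set us \<subseteq> carrier_vec m" "set ws \<subseteq> carrier_vec m"
    by (auto simp: orthonormal_list_def)
  have "\<exists>B. orthonormal_rows p m B \<and> vec_span m (set (rows B)) = S"
    using orthonormal_rows_mat_of_rows[OF o(1)] uw(2,4) c(1)
    by (intro exI[of _ "mat_of_rows m us"]) simp
  from someI_ex[OF this]
  show "orthonormal_rows p m (basis_mat p m S)" "vec_span m (set (rows (basis_mat p m S))) = S"
    unfolding basis_mat_def by auto
  have "\<exists>B. orthonormal_rows q m B \<and> vec_span m (set (rows B)) = T"
    using orthonormal_rows_mat_of_rows[OF o(2)] uw(3,5) c(2)
    by (intro exI[of _ "mat_of_rows m ws"]) simp
  from someI_ex[OF this]
  show "orthonormal_rows q m (basis_mat q m T)" "vec_span m (set (rows (basis_mat q m T))) = T"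
    unfolding basis_mat_def by auto
qed

lemma orthogonal_to_span_rows:
  assumes B: "B \<in> carrier_mat n m" "vec_span m (set (rows B)) = T" and x: "x \<in> carrier_vec m"
  shows "B *\<^sub>v x = 0\<^sub>v n \<longleftrightarrow> (\<forall>t\<in>T. t \<bullet> x = 0)"
proof -
  have c: "set (rows B) \<subseteq> carrier_vec m" using B(1) by (auto simp: rows_def)
  have B': "mat_of_rows m (rows B) = B" "length (rows B) = n" using B(1) mat_of_rows_rows[of B] by simp_all
  have "B *\<^sub>v x = 0\<^sub>v n \<longleftrightarrow> (\<forall>v\<in>set (rows B). v \<bullet> x = 0)"
    using mat_of_rows_mult_vec_eq_0_iff[OF c, of x] B' by simp
  moreover have "(\<forall>v\<in>set (rows B). v \<bullet> x = 0) \<longleftrightarrow> (\<forall>t\<in>T. t \<bullet> x = 0)"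
  proof
    assume "\<forall>v\<in>set (rows B). v \<bullet> x = 0"
    then show "\<forall>t\<in>T. t \<bullet> x = 0" using scalar_prod_span_eq_0[OF c x] B(2) by blast
  next
    interpret V: vec_space "TYPE(real)" m .
    assume "\<forall>t\<in>T. t \<bullet> x = 0"
    moreover have "set (rows B) \<subseteq> T" using V.in_own_span[OF c] B(2) by simp
    ultimately show "\<forall>v\<in>set (rows B). v \<bullet> x = 0" by blast
  qed
  ultimately show ?thesis by simp
qed

text \<open>This is where ties are resolved: only orthogonality to eigenvectors strictly on the
  wrong side of \<theta> is assumed, and nothing is said about those with eigenvalue
  \<theta>.\<close>

lemma pca_pairI_threshold:
  fixes l :: "nat \<Rightarrow> real"
  assumes M: "M \<in> carrier_mat m m" "M\<^sup>T = M" and vs: "orthonormal_list m vs" "length vs = m"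
    and eig: "\<And>j. j < m \<Longrightarrow> M *\<^sub>v vs ! j = l j \<cdot>\<^sub>v vs ! j"
    and ST: "(S, T) \<in> orthogonal_pairs m p q" and pq: "p + q = m"
    and S: "\<And>j s. j < m \<Longrightarrow> l j < \<theta> \<Longrightarrow> s \<in> S \<Longrightarrow> vs ! j \<bullet> s = 0"
    and T: "\<And>j t. j < m \<Longrightarrow> \<theta> < l j \<Longrightarrow> t \<in> T \<Longrightarrow> vs ! j \<bullet> t = 0"
  shows "pca_pair m p M (S, T)"
proof (rule pca_pairI[OF M ST pq])
  have sub: "S \<subseteq> carrier_vec m" "T \<subseteq> carrier_vec m" and orth: "\<And>s t. s \<in> S \<Longrightarrow> t \<in> T \<Longrightarrow> s \<bullet> t = 0"
    using ST vec_subspace_closed(1) by (auto simp: orthogonal_pairs_def)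
  have expand: "x \<bullet> (M *\<^sub>v y) = (\<Sum>j<m. l j * ((vs ! j \<bullet> x) * (vs ! j \<bullet> y)))"
    if "x \<in> carrier_vec m" "y \<in> carrier_vec m" for x y
    by (rule eigenbasis_scalar_prod[OF M vs]) (simp_all add: eig that)
  note inner = orthonormal_basis_scalar_prod[OF vs]
  {
    fix s t assume s: "s \<in> S" and t: "t \<in> T"
    then have c: "s \<in> carrier_vec m" "t \<in> carrier_vec m" using sub by auto
    \<comment> \<open>In each term, \<open>l j < \<theta>\<close> kills the coefficient of
      \<open>s\<close> and \<open>l j > \<theta>\<close> kills that of \<open>t\<close>. All
      surviving terms have eigenvalue \<theta>, so the form reduces to \<theta> times the inner
      product.\<close>
    have "s \<bullet> (M *\<^sub>v t) = (\<Sum>j<m. \<theta> * ((vs ! j \<bullet> s) * (vs ! j \<bullet> t)))"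
      unfolding expand[OF c]
    proof (intro sum.cong refl)
      fix j assume "j \<in> {..<m}"
      then have j: "j < m" by simp
      show "l j * ((vs ! j \<bullet> s) * (vs ! j \<bullet> t)) = \<theta> * ((vs ! j \<bullet> s) * (vs ! j \<bullet> t))"
        using S[OF j _ s] T[OF j _ t] by (cases "l j" \<theta> rule: linorder_cases) auto
    qed
    also have "\<dots> = \<theta> * (s \<bullet> t)" unfolding inner[OF c] by (simp add: sum_distrib_left)
    finally show "s \<bullet> (M *\<^sub>v t) = 0" using orth[OF s t] by simp
  next
    fix s assume s: "s \<in> S"
    then have c: "s \<in> carrier_vec m" using sub by auto
    show "\<theta> * (s \<bullet> s) \<le> s \<bullet> (M *\<^sub>v s)"
      unfolding expand[OF c c] inner[OF c c] sum_distrib_left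
    proof (intro sum_mono)
      fix j assume "j \<in> {..<m}"
      then have j: "j < m" by simp
      show "\<theta> * ((vs ! j \<bullet> s) * (vs ! j \<bullet> s)) \<le> l j * ((vs ! j \<bullet> s) * (vs ! j \<bullet> s))"
        using S[OF j _ s] by (cases "l j < \<theta>") (auto intro!: mult_right_mono)
    qed
  next
    fix t assume t: "t \<in> T"
    then have c: "t \<in> carrier_vec m" using sub by auto
    show "t \<bullet> (M *\<^sub>v t) \<le> \<theta> * (t \<bullet> t)"
      unfolding expand[OF c c] inner[OF c c] sum_distrib_left
    proof (intro sum_mono)
      fix j assume "j \<in> {..<m}"
      then have j: "j < m" by simp
      show "l j * ((vs ! j \<bullet> t) * (vs ! j \<bullet> t)) \<le> \<theta> * ((vs ! j \<bullet> t) * (vs ! j \<bullet> t))"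
        using T[OF j _ t] by (cases "\<theta> < l j") (auto intro!: mult_right_mono)
    qed
  }
qed

text \<open>For \<open>M\<close> the covariance this is the generalised variance of the projection
  onto a \<open>k\<close>-dimensional \<open>S\<close>. By \<open>det_congruence_cong_span\<close>
  it does not depend on the basis chosen.\<close>

definition compression_det :: "nat \<Rightarrow> real mat \<Rightarrow> nat \<Rightarrow> real vec set \<Rightarrow> real" where
  "compression_det m M k S = det (basis_mat k m S * M * (basis_mat k m S)\<^sup>T)"

context positive_definite
begin

lemma compression_det_pos:
  assumes "(S, T) \<in> orthogonal_pairs m p q"
  shows "0 < compression_det m M p S" "0 < compression_det m M q T"
  unfolding compression_det_def
  using det_compression_pos basis_mat_orthogonal_pair[OF assms] by auto

text \<open>The given PCA pair attains both eigenvalue products exactly. A competitor that does at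
  least as well therefore attains a bound too, and the equality cases supply the threshold
  criterion.\<close>

lemma pca_pair_optimal:
  assumes "pca_pair m p M (S, T)" and p: "p < m" and q: "q = m - p"
  shows "(S, T) \<in> orthogonal_pairs m p q"
    and "(S', T') \<in> orthogonal_pairs m p q \<Longrightarrow> compression_det m M q T \<le> compression_det m M q T'"
    and "(S', T') \<in> orthogonal_pairs m p q \<Longrightarrow> compression_det m M p S' \<le> compression_det m M p S"
    and "(S', T') \<in> orthogonal_pairs m p q \<Longrightarrow> compression_det m M q T' \<le> compression_det m M q T \<Longrightarrow>
      pca_pair m p M (S', T')"
    and "(S', T') \<in> orthogonal_pairs m p q \<Longrightarrow> compression_det m M p S \<le> compression_det m M p S' \<Longrightarrow>
      pca_pair m p M (S', T')"
proof -
  obtain vs where pd: "principal_directions m M vs"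
    and ST: "S = vec_span m (set (take p vs))" "T = vec_span m (set (drop p vs))"
    using assms(1) by (auto simp: pca_pair_def)
  note vs = principal_directionsD[OF pd]
  obtain l :: "nat \<Rightarrow> real" where eig: "\<And>j. j < m \<Longrightarrow> M *\<^sub>v vs ! j = l j \<cdot>\<^sub>v vs ! j"
    and mono: "\<And>i j. i \<le> j \<Longrightarrow> j < m \<Longrightarrow> l j \<le> l i"
    using pd M(1) by (rule principal_directionsE) blast
  have o: "orthonormal_list m (take p vs)" "orthonormal_list m (drop p vs)"
    using vs(1) orthonormal_list_append_iff[of m "take p vs" "drop p vs"] by simp_all
  have len: "length (take p vs) = p" "length (drop p vs) = q" using vs(2) p q by simp_all
  show pair: "(S, T) \<in> orthogonal_pairs m p q"
    using orthogonal_pairsI[of m "take p vs" "drop p vs"] vs(1) len by (simp add: ST)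
  note bas = basis_mat_orthogonal_pair[OF pair]
  have rows: "rows (mat_of_rows m (take p vs)) = take p vs" "rows (mat_of_rows m (drop p vs)) = drop p vs"
    using o by (simp_all add: orthonormal_list_def)
  have or: "orthonormal_rows p m (mat_of_rows m (take p vs))" "orthonormal_rows q m (mat_of_rows m (drop p vs))"
    using orthonormal_rows_mat_of_rows[OF o(1)] orthonormal_rows_mat_of_rows[OF o(2)] len by simp_all
  have valS: "compression_det m M p S = (\<Prod>j<p. l j)"
  proof -
    have "compression_det m M p S = det (mat_of_rows m (take p vs) * M * (mat_of_rows m (take p vs))\<^sup>T)"
      unfolding compression_det_def using bas(2) rows(1) ST(1)
      by (intro det_congruence_cong_span[OF M(1) bas(1) or(1)]) simp
    also have "\<dots> = (\<Prod>j<p. l j)"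
      using p eig vs(2) by (subst det_congruence_eigenrows[OF M(1) o(1), of l]) simp_all
    finally show ?thesis .
  qed
  have valT: "compression_det m M q T = (\<Prod>j=p..<m. l j)"
  proof -
    have "compression_det m M q T = det (mat_of_rows m (drop p vs) * M * (mat_of_rows m (drop p vs))\<^sup>T)"
      unfolding compression_det_def using bas(4) rows(2) ST(2)
      by (intro det_congruence_cong_span[OF M(1) bas(3) or(2)]) simp
    also have "\<dots> = (\<Prod>i<q. l (p + i))"
      using p q eig vs(2) by (subst det_congruence_eigenrows[OF M(1) o(2), of "\<lambda>i. l (p + i)"]) simp_all
    also have "\<dots> = (\<Prod>j=p..<m. l j)"
      using p q by (intro prod.reindex_bij_witness[of _ "\<lambda>j. j - p" "\<lambda>i. p + i"]) auto
    finally show ?thesis .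
  qed
  assume pair': "(S', T') \<in> orthogonal_pairs m p q"
  note bas' = basis_mat_orthogonal_pair[OF pair']
  have sub': "S' \<subseteq> carrier_vec m" "T' \<subseteq> carrier_vec m" and orth': "\<And>s t. s \<in> S' \<Longrightarrow> t \<in> T' \<Longrightarrow> s \<bullet> t = 0"
    using pair' vec_subspace_closed(1) by (auto simp: orthogonal_pairs_def)
  have Bc: "basis_mat p m S' \<in> carrier_mat p m" "basis_mat q m T' \<in> carrier_mat q m"
    using bas' by (auto simp: orthonormal_rows_def)
  note orthS = orthogonal_to_span_rows[OF Bc(1) bas'(2)]
  note orthT = orthogonal_to_span_rows[OF Bc(2) bas'(4)]
  have vc: "vs ! j \<in> carrier_vec m" if "j < m" for j using vs that by (auto simp: orthonormal_list_def)
  interpret positive_definite_eigenbasis m M p vs l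
    by unfold_locales (fact vs eig mono p)+
  note ge = det_compression_ge[folded q, OF bas'(3), folded compression_det_def]
  note le = det_compression_le[OF bas'(1), folded compression_det_def]
  show "compression_det m M q T \<le> compression_det m M q T'"
    unfolding valT by (rule ge(1))
  show "compression_det m M p S' \<le> compression_det m M p S"
    unfolding valS by (rule le(1))
  \<comment> \<open>Equality for \<open>T'\<close> restricts \<open>T'\<close> directly above the
    threshold. Below it, the eigenvectors are orthogonal to the kernel of the basis matrix of
    \<open>T'\<close>, and that kernel contains \<open>S'\<close>.\<close>
  show "pca_pair m p M (S', T')" if "compression_det m M q T' \<le> compression_det m M q T"
  proof (rule pca_pairI_threshold[where \<theta> = "l p" and l = l, OF M vs _ pair'])
    show "M *\<^sub>v vs ! j = l j \<cdot>\<^sub>v vs ! j" if "j < m" for j using that by (rule eig)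
    have eq: "compression_det m M q T' = (\<Prod>j=p..<m. l j)" using that ge(1) valT by simp
    show "p + q = m" using p q by simp
    show "vs ! j \<bullet> s = 0" if "j < m" "l j < l p" "s \<in> S'" for j s
    proof -
      have s: "s \<in> carrier_vec m" using that sub' by auto
      have "t \<bullet> s = 0" if "t \<in> T'" for t
        using orth'[OF \<open>s \<in> S'\<close> that] comm_scalar_prod[of s m t] s that sub' by auto
      then show ?thesis using ge(3)[OF eq that(1,2) s] orthT[OF s] by simp
    qed
    show "vs ! j \<bullet> t = 0" if "j < m" "l p < l j" "t \<in> T'" for j t
      using ge(2)[OF eq that(1,2)] orthT[OF vc[OF that(1)]] that comm_scalar_prod[of t m "vs ! j"] vc[OF that(1)] sub'
      by auto
  qed
  \<comment> \<open>Here the compression is to \<open>S'\<close>, so the roles are exchanged: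
    \<open>S'\<close> is restricted directly below the threshold, and \<open>T'\<close> through the
    kernel above it.\<close>
  show "pca_pair m p M (S', T')" if "compression_det m M p S \<le> compression_det m M p S'"
  proof (rule pca_pairI_threshold[where \<theta> = "l p" and l = l, OF M vs _ pair'])
    show "M *\<^sub>v vs ! j = l j \<cdot>\<^sub>v vs ! j" if "j < m" for j using that by (rule eig)
    have eq: "compression_det m M p S' = (\<Prod>j<p. l j)" using that le(1) valS by simp
    show "p + q = m" using p q by simp
    show "vs ! j \<bullet> s = 0" if "j < m" "l j < l p" "s \<in> S'" for j s
      using le(2)[OF eq that(1,2)] orthS[OF vc[OF that(1)]] that comm_scalar_prod[of s m "vs ! j"] vc[OF that(1)] sub'
      by auto
    show "vs ! j \<bullet> t = 0" if "j < m" "l p < l j" "t \<in> T'" for j t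
    proof -
      have t: "t \<in> carrier_vec m" using that sub' by auto
      have "s \<bullet> t = 0" if "s \<in> S'" for s using orth'[OF that \<open>t \<in> T'\<close>] .
      then show ?thesis using le(3)[OF eq that(1,2) t] orthS[OF t] by simp
    qed
  qed
qed

end

section \<open>From determinants to dispersions\<close>

lemma ennreal_sqrt_mult_less_iff:
  assumes "0 < a" "0 < b" "0 < \<kappa>" "\<kappa> < \<infinity>"
  shows "ennreal (sqrt a) * \<kappa> < ennreal (sqrt b) * \<kappa> \<longleftrightarrow> a < b"
proof -
  obtain k where k: "\<kappa> = ennreal k" "0 < k"
    using assms(3,4) by (cases \<kappa>) auto
  then show ?thesis
    using assms(1,2) by (simp add: ennreal_mult[symmetric] ennreal_less_iff)
qed

text \<open>Lets a single positive and finite dispersion value certify that the common factor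
  \<kappa> is positive and finite.\<close>

lemma ennreal_mult_factor_bounds:
  assumes "0 < ennreal a * \<kappa>" "ennreal a * \<kappa> < \<infinity>" "0 < a"
  shows "0 < \<kappa>" "\<kappa> < \<infinity>"
proof -
  show "0 < \<kappa>" using assms(1) by (cases "\<kappa> = 0") (auto simp: zero_less_iff_neq_zero)
  show "\<kappa> < \<infinity>" using assms(2,3) by (cases \<kappa>) (auto simp: ennreal_mult_top)
qed

text \<open>With \<open>us\<close> empty, the orthogonality condition that cuts out the span of
  \<open>ws\<close> is void.\<close>

lemma orthogonal_pairs_0_unique:
  assumes "P \<in> orthogonal_pairs m 0 m"
  shows "P = (vec_span m {}, carrier_vec m)"
proof -
  obtain S T where P: "P = (S, T)" by (cases P)
  obtain us ws where uw: "orthonormal_list m (us @ ws)" "length us = 0" "length ws = m"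
    "vec_span m (set us) = S" "vec_span m (set ws) = T"
    using assms unfolding P by (rule orthogonal_pairsE)
  then have "T = carrier_vec m"
    using orthonormal_list_append_in_span_iff(2)[OF uw(1)] by auto
  with P uw show ?thesis by simp
qed

text \<open>\<open>\<mu>\<^sub>0\<close> and \<open>\<Sigma>\<^sub>0\<close> are the parameters of
  the symmetry, \<mu> and \<Sigma> the moments; the scatter need only be proportional to the
  covariance. If the constant multiplying the determinant factor were 0 or infinite, all pairs would
  tie and each would be optimal; \<open>nondegenerate\<close> excludes this.\<close>

theorem proposition1:
  fixes m p q :: nat
    and F :: "real vec measure"
    and \<mu> \<mu>\<^sub>0 :: "real vec"
    and \<Sigma> \<Sigma>\<^sub>0 :: "real mat"
    and symm :: "real vec measure \<Rightarrow> real vec \<Rightarrow> bool"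
    and d :: "real vec \<Rightarrow> real vec measure \<Rightarrow> real"
    and S\<^sub>p S\<^sub>q :: "real vec set"
  assumes "p < m" and "q = m - p"
    and "distribution m F"
    and "absolutely_continuous (lborel_vec m) F"
    and "elliptically_symmetric m F \<mu>\<^sub>0 \<Sigma>\<^sub>0"
    and "has_mean m F \<mu>"
    and "has_covariance m F \<mu> \<Sigma>"
    and "includes_elliptical_symmetry symm"
    and "statistical_depth symm d"
    and "dispersion d m F < \<infinity>"
    and nondegenerate: "\<And>k B. 0 < p \<Longrightarrow> k \<in> {p, q} \<Longrightarrow> orthonormal_rows k m B \<Longrightarrow>
           0 < dispersion d k (linear_image k B F) \<and> dispersion d k (linear_image k B F) < \<infinity>"
  shows "(is_arg_min (\<lambda>(S, T). dispersion d q (linear_image q (basis_mat q m T) F))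
            (\<lambda>P. P \<in> orthogonal_pairs m p q) (S\<^sub>p, S\<^sub>q)
          \<longleftrightarrow> pca_pair m p \<Sigma> (S\<^sub>p, S\<^sub>q))
       \<and> (pca_pair m p \<Sigma> (S\<^sub>p, S\<^sub>q)
          \<longleftrightarrow> is_arg_max (\<lambda>(S, T). dispersion d p (linear_image p (basis_mat p m S) F))
                (\<lambda>P. P \<in> orthogonal_pairs m p q) (S\<^sub>p, S\<^sub>q))"
proof -
  note p = assms(1) and q = assms(2) and cov = assms(7)
  have m: "0 < m" using p by simp
  have \<mu>: "\<mu> \<in> carrier_vec m" using assms(6) by (simp add: has_mean_def)
  interpret positive_definite m \<Sigma>
    using covariance_symmetric[OF cov] covariance_positive_definite[OF assms(3,4) cov \<mu>]
    by unfold_locales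
  obtain vs where vs: "principal_directions m \<Sigma> vs"
    using M by (rule ex_principal_directions)
  \<comment> \<open>A reference optimum against which every candidate is compared; it exists by the
    spectral theorem.\<close>
  define P\<^sub>0 where "P\<^sub>0 = (vec_span m (set (take p vs)), vec_span m (set (drop p vs)))"
  have pca\<^sub>0: "pca_pair m p \<Sigma> P\<^sub>0"
    unfolding P\<^sub>0_def pca_pair_def using vs by auto
  let ?A = "orthogonal_pairs m p q"
  let ?f = "\<lambda>(S, T). dispersion d q (linear_image q (basis_mat q m T) F)"
  let ?g = "\<lambda>(S, T). dispersion d p (linear_image p (basis_mat p m S) F)"
  let ?D = "\<lambda>P. compression_det m \<Sigma> q (snd P)"
  let ?E = "\<lambda>P. compression_det m \<Sigma> p (fst P)"
  have opt: "P \<in> ?A" "Q \<in> ?A \<Longrightarrow> ?D P \<le> ?D Q" "Q \<in> ?A \<Longrightarrow> ?E Q \<le> ?E P"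
    "Q \<in> ?A \<Longrightarrow> ?D Q \<le> ?D P \<Longrightarrow> pca_pair m p \<Sigma> Q" "Q \<in> ?A \<Longrightarrow> ?E P \<le> ?E Q \<Longrightarrow> pca_pair m p \<Sigma> Q"
    if "pca_pair m p \<Sigma> P" for P Q
  proof -
    obtain S T where P: "P = (S, T)" by (cases P)
    obtain S' T' where Q: "Q = (S', T')" by (cases Q)
    note o = pca_pair_optimal[OF that[unfolded P] p q]
    show "P \<in> ?A" using o(1) by (simp add: P)
    show "?D P \<le> ?D Q" "?E Q \<le> ?E P" if "Q \<in> ?A"
      using o(2,3)[of S' T'] that by (simp_all add: P Q)
    show "pca_pair m p \<Sigma> Q" if "Q \<in> ?A" "?D Q \<le> ?D P"
      using o(4)[of S' T'] that by (simp add: P Q)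
    show "pca_pair m p \<Sigma> Q" if "Q \<in> ?A" "?E P \<le> ?E Q"
      using o(5)[of S' T'] that by (simp add: P Q)
  qed
  show ?thesis
  proof (cases "p = 0")
    case True
    \<comment> \<open>\<open>nondegenerate\<close> is void here, but there is only one pair.\<close>
    then have uniq: "P = P\<^sub>0" if "P \<in> ?A" for P
      using orthogonal_pairs_0_unique[of P m] orthogonal_pairs_0_unique[of P\<^sub>0 m] that opt(1)[OF pca\<^sub>0] q
      by simp
    have "is_arg_min f (\<lambda>P. P \<in> ?A) P \<longleftrightarrow> P = P\<^sub>0" "is_arg_max f (\<lambda>P. P \<in> ?A) P \<longleftrightarrow> P = P\<^sub>0"
      "pca_pair m p \<Sigma> P \<longleftrightarrow> P = P\<^sub>0" for f :: "real vec set \<times> real vec set \<Rightarrow> ennreal" and P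
      using uniq opt(1) pca\<^sub>0 unfolding is_arg_min_def is_arg_max_def by (metis less_irrefl)+
    then show ?thesis by blast
  next
    case False
    then have p0: "0 < p" by simp
    obtain \<kappa>q where \<kappa>q: "\<And>B. orthonormal_rows q m B \<Longrightarrow>
        dispersion d q (linear_image q B F) = ennreal (sqrt (det (B * \<Sigma> * B\<^sup>T))) * \<kappa>q"
      using m assms(3,4,5,6,7,9) by (rule dispersion_linear_image_covariance) blast
    obtain \<kappa>p where \<kappa>p: "\<And>B. orthonormal_rows p m B \<Longrightarrow>
        dispersion d p (linear_image p B F) = ennreal (sqrt (det (B * \<Sigma> * B\<^sup>T))) * \<kappa>p"
      using m assms(3,4,5,6,7,9) by (rule dispersion_linear_image_covariance) blast
    have val: "?f P = ennreal (sqrt (?D P)) * \<kappa>q" "?g P = ennreal (sqrt (?E P)) * \<kappa>p"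
      "0 < ?D P" "0 < ?E P" "0 < ?f P \<and> ?f P < \<infinity>" "0 < ?g P \<and> ?g P < \<infinity>" if P: "P \<in> ?A" for P
    proof -
      obtain S T where ST: "P = (S, T)" by (cases P)
      note bas = basis_mat_orthogonal_pair[OF P[unfolded ST]]
      show "?f P = ennreal (sqrt (?D P)) * \<kappa>q" "?g P = ennreal (sqrt (?E P)) * \<kappa>p"
        using \<kappa>q[OF bas(3)] \<kappa>p[OF bas(1)] by (simp_all add: ST compression_det_def)
      show "0 < ?D P" "0 < ?E P" using compression_det_pos[OF P[unfolded ST]] by (simp_all add: ST)
      show "0 < ?f P \<and> ?f P < \<infinity>" "0 < ?g P \<and> ?g P < \<infinity>"
        using nondegenerate[OF p0 _ bas(3)] nondegenerate[OF p0 _ bas(1)] by (simp_all add: ST)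
    qed
    note val\<^sub>0 = val[OF opt(1)[OF pca\<^sub>0]]
    have "0 < \<kappa>q \<and> \<kappa>q < \<infinity>"
      using ennreal_mult_factor_bounds[of "sqrt (?D P\<^sub>0)" \<kappa>q] val\<^sub>0(3,5) unfolding val\<^sub>0(1) by simp
    \<comment> \<open>\<open>is_arg_min\<close> involves only strict comparisons, so with a positive
      finite factor the determinant may replace the dispersion.\<close>
    then have f: "?f P < ?f Q \<longleftrightarrow> ?D P < ?D Q" if "P \<in> ?A" "Q \<in> ?A" for P Q
      unfolding val(1)[OF that(1)] val(1)[OF that(2)]
      using val(3)[OF that(1)] val(3)[OF that(2)] by (intro ennreal_sqrt_mult_less_iff) auto
    have "0 < \<kappa>p \<and> \<kappa>p < \<infinity>"
      using ennreal_mult_factor_bounds[of "sqrt (?E P\<^sub>0)" \<kappa>p] val\<^sub>0(4,6) unfolding val\<^sub>0(2) by simp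
    then have g: "?g P < ?g Q \<longleftrightarrow> ?E P < ?E Q" if "P \<in> ?A" "Q \<in> ?A" for P Q
      unfolding val(2)[OF that(1)] val(2)[OF that(2)]
      using val(4)[OF that(1)] val(4)[OF that(2)] by (intro ennreal_sqrt_mult_less_iff) auto
    have "is_arg_min ?f (\<lambda>P. P \<in> ?A) P \<longleftrightarrow> pca_pair m p \<Sigma> P" for P
    proof
      assume "is_arg_min ?f (\<lambda>P. P \<in> ?A) P"
      then have P: "P \<in> ?A" and "\<not> ?f P\<^sub>0 < ?f P"
        using opt(1)[OF pca\<^sub>0] unfolding is_arg_min_def by blast+
      \<comment> \<open>Not being beaten by \<open>P\<^sub>0\<close> already means doing as well as
        a PCA pair, and then the equality case applies.\<close>
      then have "?D P \<le> ?D P\<^sub>0"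
        unfolding f[OF opt(1)[OF pca\<^sub>0] P] by simp
      then show "pca_pair m p \<Sigma> P" by (rule opt(4)[OF pca\<^sub>0 P])
    next
      assume P: "pca_pair m p \<Sigma> P"
      have "\<not> ?f Q < ?f P" if "Q \<in> ?A" for Q
        using f[OF that opt(1)[OF P]] opt(2)[OF P that] by simp
      with opt(1)[OF P] show "is_arg_min ?f (\<lambda>P. P \<in> ?A) P" unfolding is_arg_min_def by blast
    qed
    moreover have "is_arg_max ?g (\<lambda>P. P \<in> ?A) P \<longleftrightarrow> pca_pair m p \<Sigma> P" for P
    proof
      assume "is_arg_max ?g (\<lambda>P. P \<in> ?A) P"
      then have P: "P \<in> ?A" and "\<not> ?g P < ?g P\<^sub>0"
        using opt(1)[OF pca\<^sub>0] unfolding is_arg_max_def by blast+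
      then have "?E P\<^sub>0 \<le> ?E P"
        unfolding g[OF P opt(1)[OF pca\<^sub>0]] by simp
      then show "pca_pair m p \<Sigma> P" by (rule opt(5)[OF pca\<^sub>0 P])
    next
      assume P: "pca_pair m p \<Sigma> P"
      have "\<not> ?g P < ?g Q" if "Q \<in> ?A" for Q
        using g[OF opt(1)[OF P] that] opt(3)[OF P that] by simp
      with opt(1)[OF P] show "is_arg_max ?g (\<lambda>P. P \<in> ?A) P" unfolding is_arg_max_def by blast
    qed
    ultimately show ?thesis by blast
  qed
qed

end
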